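(* Let $x\in[0,1]$ be polynomial time random. Then for every Pisot number $\beta>1$ the sequence $(x\beta^n)_{n\in\mathbb{N}}$ is uniformly distributed modulo one.
   Context: A (classical, binary) martingale is a function $f\colon\{0,1\}^*\to\mathbb{R}_{\ge 0}$ with $f(\sigma)=\tfrac12\big(f(\sigma 0)+f(\sigma 1)\big)$ for all words $\sigma$. It succeeds on $s\in\{0,1\}^{\mathbb{N}}$ if $\limsup_{N\to\infty} f(s\upharpoonright_N)=\infty$, where $s\upharpoonright_N$ is the word formed by the first $N$ symbols of $s$. A function $g\colon\Sigma^*\to\mathbb{R}$ ($\Sigma$ a finite alphabet) is polynomial time computable if there are a function $\widehat g\colon\Sigma^*\times\mathbb{N}\to\mathbb{Q}$ with $|\widehat g(\sigma,i)-g(\sigma)|\le 2^{-i}$ for all $\sigma,i$, a polynomial $t$, and a Turing machine which on input $\sigma$ and $i$ computes $\widehat g(\sigma,i)$ in time $O(t(|\sigma|+i))$. A real $x\in[0,1]$ is polynomial time random if no polynomial time computable martingale on $\{0,1\}^*$ succeeds on the fractional binary expansion of $x$ (for $x\in[0,1)$, the expansion with infinitely many $0$'s; for $x=1$, the sequence $1^\infty$). A Pisot number is a real algebraic integer $\beta>1$ (a root of a monic polynomial with integer coefficients) all of whose conjugates (the other roots of its minimal polynomial) have absolute value strictly less than $1$. *)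

theory Defs
  imports
    "HOL-Analysis.Analysis"
    "HOL-Library.Landau_Symbols"
    "HOL-Computational_Algebra.Polynomial"
begin

section \<open>Turing machines\<close>

text \<open>
  Deterministic machines with finitely many one-way infinite tapes. The tape alphabet is
  \<open>{0..<symbols M}\<close> and the working states are \<open>{0..<states M}\<close>, with \<open>0\<close> as the start state and
  \<open>states M\<close> as the halting state. One application of the transition function reads the symbols
  under all heads and yields the new state and, for every tape, the symbol to write and the
  direction in which to move that head.
\<close>

datatype head_move = Move_Left | Stay | Move_Right

record turing_machine =
  tapes :: nat
  symbols :: nat
  states :: nat
  trans :: "nat \<Rightarrow> nat list \<Rightarrow> nat \<times> (nat \<times> head_move) list"

abbreviation (input) blank_symbol :: nat where "blank_symbol \<equiv> 0"
abbreviation (input) start_symbol :: nat where "start_symbol \<equiv> 1"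
abbreviation (input) bit_symbol :: "bool \<Rightarrow> nat" where "bit_symbol b \<equiv> (if b then 3 else 2)"
abbreviation (input) separator_symbol :: nat where "separator_symbol \<equiv> 4"

definition wf_machine :: "turing_machine \<Rightarrow> bool" where
  "wf_machine M \<longleftrightarrow> tapes M \<ge> 3 \<and> symbols M \<ge> 5 \<and>
     (\<forall>q < states M. \<forall>w. length w = tapes M \<and> set w \<subseteq> {0..<symbols M} \<longrightarrow>
        (case trans M q w of (q', acts) \<Rightarrow>
           q' \<le> states M \<and> length acts = tapes M \<and> fst ` set acts \<subseteq> {0..<symbols M}))"

text \<open>A tape consists of the contents of its cells and the position of its head.\<close>

type_synonym tape = "(nat \<Rightarrow> nat) \<times> nat"

fun read_tape :: "tape \<Rightarrow> nat" where
  "read_tape (c, h) = c h"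

text \<open>In cell \<open>0\<close>, \<open>Move_Left\<close> leaves the head where it is.\<close>

fun act_tape :: "nat \<times> head_move \<Rightarrow> tape \<Rightarrow> tape" where
  "act_tape (a, m) (c, h) =
     (c(h := a), case m of Move_Left \<Rightarrow> h - 1 | Stay \<Rightarrow> h | Move_Right \<Rightarrow> h + 1)"

fun step :: "turing_machine \<Rightarrow> nat \<times> tape list \<Rightarrow> nat \<times> tape list" where
  "step M (q, ts) =
     (if q < states M
      then (case trans M q (map read_tape ts) of (q', acts) \<Rightarrow> (q', map2 act_tape acts ts))
      else (q, ts))"

text \<open>The head starts in cell \<open>0\<close>, which holds the start symbol; the word \<open>w\<close> occupies the
  cells \<open>1, \<dots>, length w\<close>.\<close>

definition word_tape :: "nat list \<Rightarrow> tape" where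
  "word_tape w =
     (\<lambda>j. if j = 0 then start_symbol else if j \<le> length w then w ! (j - 1) else blank_symbol, 0)"

text \<open>Tape \<open>0\<close> holds the input word, tape \<open>1\<close> holds the number \<open>i\<close> in unary (so that the length of
  the input is of the order \<open>length \<sigma> + i\<close>), and all other tapes are empty.\<close>

definition initial_config :: "turing_machine \<Rightarrow> bool list \<Rightarrow> nat \<Rightarrow> nat \<times> tape list" where
  "initial_config M \<sigma> i =
     (0, word_tape (map bit_symbol \<sigma>) # word_tape (replicate i (bit_symbol True))
         # replicate (tapes M - 2) (word_tape []))"

text \<open>
  A rational number is written as its sign bit, the binary digits of a numerator, a separator and
  the binary digits of a nonzero denominator. Digits are in order of increasing significance, and
  neither reduced fractions nor the absence of superfluous zero digits is required.
\<close>

definition encodes_rat :: "nat list \<Rightarrow> rat \<Rightarrow> bool" where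
  "encodes_rat w r \<longleftrightarrow>
     (\<exists>neg ps qs. w = bit_symbol neg # map bit_symbol ps @ separator_symbol # map bit_symbol qs \<and>
        (horner_sum of_bool 2 qs :: nat) \<noteq> 0 \<and>
        r = (if neg then - 1 else 1) *
              of_nat (horner_sum of_bool 2 ps) / of_nat (horner_sum of_bool 2 qs))"

text \<open>The output is the word on tape \<open>2\<close> from cell \<open>1\<close> up to the first blank.\<close>

definition has_word :: "tape \<Rightarrow> nat list \<Rightarrow> bool" where
  "has_word t w \<longleftrightarrow> blank_symbol \<notin> set w \<and>
     (\<forall>j < length w. fst t (Suc j) = w ! j) \<and> fst t (Suc (length w)) = blank_symbol"

definition computes_within ::
    "turing_machine \<Rightarrow> bool list \<Rightarrow> nat \<Rightarrow> rat \<Rightarrow> nat \<Rightarrow> bool" where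
  "computes_within M \<sigma> i r T \<longleftrightarrow>
     (case (step M ^^ T) (initial_config M \<sigma> i) of (q, ts) \<Rightarrow>
        q = states M \<and> (\<exists>w. encodes_rat w r \<and> has_word (ts ! 2) w))"

section \<open>Polynomial time randomness\<close>

definition polynomial_time_computable :: "(bool list \<Rightarrow> real) \<Rightarrow> bool" where
  "polynomial_time_computable g \<longleftrightarrow>
     (\<exists>(g' :: bool list \<Rightarrow> nat \<Rightarrow> rat) (t :: real poly) (T :: nat \<Rightarrow> nat) M.
        (\<forall>\<sigma> i. \<bar>of_rat (g' \<sigma> i) - g \<sigma>\<bar> \<le> 1 / 2 ^ i) \<and>
        wf_machine M \<and>
        (\<lambda>n. real (T n)) \<in> O(\<lambda>n. poly t (real n)) \<and>
        (\<forall>\<sigma> i. computes_within M \<sigma> i (g' \<sigma> i) (T (length \<sigma> + i))))"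

definition martingale :: "(bool list \<Rightarrow> real) \<Rightarrow> bool" where
  "martingale f \<longleftrightarrow>
     (\<forall>\<sigma>. f \<sigma> \<ge> 0) \<and> (\<forall>\<sigma>. f \<sigma> = (f (\<sigma> @ [False]) + f (\<sigma> @ [True])) / 2)"

definition succeeds_on :: "(bool list \<Rightarrow> real) \<Rightarrow> (nat \<Rightarrow> bool) \<Rightarrow> bool" where
  "succeeds_on f s \<longleftrightarrow> limsup (\<lambda>N. ereal (f (map s [0..<N]))) = \<infinity>"

text \<open>Only used for \<open>x \<in> {0..1}\<close>; the digit \<open>s n\<close> has weight \<open>1 / 2 ^ Suc n\<close>.\<close>

definition binary_expansion :: "real \<Rightarrow> nat \<Rightarrow> bool" where
  "binary_expansion x =
     (if x = 1 then (\<lambda>_. True)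
      else (THE s. (\<lambda>n. of_bool (s n) / 2 ^ Suc n) sums x \<and> infinite {n. \<not> s n}))"

definition polynomial_time_random :: "real \<Rightarrow> bool" where
  "polynomial_time_random x \<longleftrightarrow>
     \<not> (\<exists>f. martingale f \<and> polynomial_time_computable f \<and> succeeds_on f (binary_expansion x))"

section \<open>Pisot numbers and uniform distribution\<close>

definition minimal_polynomial :: "real \<Rightarrow> rat poly \<Rightarrow> bool" where
  "minimal_polynomial \<beta> p \<longleftrightarrow>
     lead_coeff p = 1 \<and> poly (map_poly of_rat p) \<beta> = 0 \<and>
     (\<forall>q. q \<noteq> 0 \<and> poly (map_poly of_rat q) \<beta> = 0 \<longrightarrow> degree p \<le> degree q)"

definition pisot :: "real \<Rightarrow> bool" where
  "pisot \<beta> \<longleftrightarrow> \<beta> > 1 \<and> algebraic_int \<beta> \<and>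
     (\<forall>p. minimal_polynomial \<beta> p \<longrightarrow>
        (\<forall>z :: complex. poly (map_poly of_rat p) z = 0 \<and> z \<noteq> of_real \<beta> \<longrightarrow> norm z < 1))"

definition uniformly_distributed_mod_one :: "(nat \<Rightarrow> real) \<Rightarrow> bool" where
  "uniformly_distributed_mod_one u \<longleftrightarrow>
     (\<forall>a b. 0 \<le> a \<and> a < b \<and> b \<le> 1 \<longrightarrow>
        (\<lambda>N. real (card {n. n < N \<and> frac (u n) \<in> {a..<b}}) / real N) \<longlonglongrightarrow> b - a)"

end

theory Submission
  imports Defs "HOL-Computational_Algebra.Fundamental_Theorem_Algebra"
    "HOL-Computational_Algebra.Polynomial_FPS"
begin

text \<open>
  The traces \<open>t m\<close> of the powers of \<open>\<beta>\<close> are integers satisfying a linear recurrence, and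
  \<open>t m - \<beta> ^ m\<close> tends to \<open>0\<close>; so \<open>x * \<beta> ^ m\<close> may be replaced by \<open>x * t m\<close>, whose
  fractional part can be computed exactly from the digits of \<open>x\<close>. If \<open>x * \<beta> ^ m\<close> visits an
  interval too often, then so does a subsequence along a residue class of \<open>m\<close> modulo a large \<open>r\<close>.
  Along this class, the digits of \<open>x\<close> that determine one term are almost independent of the previous
  terms. A martingale that stakes at each digit a small multiple of the change of the conditional
  probability of a visit grows exponentially along the times with too many visits.

  A Turing machine updates all data of this martingale by one sweep over its work tape per digit:
  the traces, their products with the digits read so far, and the numerator of the capital are
  integer registers which are transformed linearly, with bounded carries, and the stake depends only
  on the leading digits of the registers, which are kept in the finite control.
\<close>

section \<open>Sweeping Turing machines\<close>

text \<open>Stakes with denominator \<open>2 ^ D\<close> keep the capital an exact dyadic number, so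
  rounding affects single stakes but never accumulates in the capital. The integrality of the
  multipliers makes reduction modulo one compatible with linear updates of the registers. The
  balance is kept in logarithms. Stakes of order \<delta> gain \<delta> times the surplus of visits
  over their expected number, whereas each digit costs a second-order term
  \<open>2 * \<delta>\<^sup>2\<close> and a rounding term of the form
  \<open>\<delta> * \<epsilon>\<close>. Since the ratio of consecutive multipliers is bounded, a
  multiplier is kept for a bounded number of digits on average, and a small constant \<delta> lets
  the linear gain dominate. The ratio must also be large: after each change of the multiplier, the
  image of the current dyadic interval has to cover many periods, so that the conditional
  probability restarts near the length of the target arc, whatever happened before. This is why a
  residue class modulo a large \<open>r\<close> is used.\<close>

definition word_cells :: "nat list \<Rightarrow> nat \<Rightarrow> nat" where
  "word_cells w j = (if j = 0 then start_symbol else if j \<le> length w then w ! (j - 1) else blank_symbol)"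

lemma word_tape_word_cells: "word_tape w = (word_cells w, 0)"
  by (auto simp: word_tape_def word_cells_def fun_eq_iff)

lemma word_cells_0 [simp]: "word_cells w 0 = start_symbol"
  by (simp add: word_cells_def)

lemma word_cells_Suc: "word_cells w (Suc j) = (if j < length w then w ! j else blank_symbol)"
  by (auto simp: word_cells_def)

lemma word_cells_end [simp]: "word_cells w (Suc (length w)) = blank_symbol"
  by (simp add: word_cells_Suc)

lemma word_cells_update:
  "(word_cells (u @ a # v))(Suc (length u) := b) = word_cells (u @ b # v)"
  by (rule ext) (auto simp: word_cells_def nth_append nth_Cons split: nat.splits)

lemma word_cells_snoc: "(word_cells u)(Suc (length u) := b) = word_cells (u @ [b])"
  by (rule ext) (auto simp: word_cells_def nth_append)

lemma has_word_word_cells: "blank_symbol \<notin> set w \<Longrightarrow> has_word (word_cells w, h) w"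
  by (auto simp: has_word_def word_cells_Suc)

section \<open>Control states and passes over the work tape\<close>

datatype 's control =
  Init | Get 's | Sweep 's | Return 's | Sign | Numerator nat | Denominator nat | Halt

text \<open>\<open>fin\<close> acts on the blank behind the last cell, so every pass lengthens the
  word by one cell. This is the room for the additional digit that each register gains per input
  symbol.\<close>

fun sweep :: "('s \<Rightarrow> 'c \<Rightarrow> 's \<times> 'c) \<Rightarrow> ('s \<Rightarrow> 's \<times> 'c) \<Rightarrow> 's \<Rightarrow> 'c list \<Rightarrow> 's \<times> 'c list" where
  "sweep \<delta> fin s [] = (fst (fin s), [snd (fin s)])"
| "sweep \<delta> fin s (c # w) =
     (fst (sweep \<delta> fin (fst (\<delta> s c)) w), snd (\<delta> s c) # snd (sweep \<delta> fin (fst (\<delta> s c)) w))"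

lemma length_sweep [simp]: "length (snd (sweep \<delta> fin s w)) = Suc (length w)"
  by (induction w arbitrary: s) auto

text \<open>A cell contributes \<open>L\<close> bits to the numerator of the output and
  \<open>D\<close> zeros to its denominator, a power of two determined by the number of
  cells.\<close>

locale sweep_machine =
  fixes S :: "'s set" and \<Gamma> :: "'c set" and s0 :: 's
    and start :: "'s \<Rightarrow> bool \<Rightarrow> 's" and \<delta> :: "'s \<Rightarrow> 'c \<Rightarrow> 's \<times> 'c" and fin :: "'s \<Rightarrow> 's \<times> 'c"
    and digits :: "'c \<Rightarrow> bool list" and L D :: nat
  assumes finite_S: "finite S" and finite_\<Gamma>: "finite \<Gamma>" and s0: "s0 \<in> S"
    and start: "\<And>s b. s \<in> S \<Longrightarrow> start s b \<in> S"
    and \<delta>: "\<And>s c. s \<in> S \<Longrightarrow> c \<in> \<Gamma> \<Longrightarrow> \<delta> s c \<in> S \<times> \<Gamma>"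
    and fin: "\<And>s. s \<in> S \<Longrightarrow> fin s \<in> S \<times> \<Gamma>"
    and length_digits: "\<And>c. c \<in> \<Gamma> \<Longrightarrow> length (digits c) = L"
    and L: "L > 0" and D: "D > 0"
begin

text \<open>The most recent symbol stands at the head of the list, hence the reversal in
  \<open>output_bits\<close>. The run on the empty word already makes one pass, which creates the
  first cell.\<close>

fun run :: "bool list \<Rightarrow> 's \<times> 'c list" where
  "run [] = sweep \<delta> fin s0 []"
| "run (b # \<sigma>) = (case run \<sigma> of (s, w) \<Rightarrow> sweep \<delta> fin (start s b) w)"

definition output_bits :: "bool list \<Rightarrow> bool list" where
  "output_bits \<sigma> = concat (map digits (snd (run (rev \<sigma>))))"

lemma sweep_in:
  assumes "s \<in> S" "set w \<subseteq> \<Gamma>"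
  shows "fst (sweep \<delta> fin s w) \<in> S \<and> set (snd (sweep \<delta> fin s w)) \<subseteq> \<Gamma>"
  using assms
proof (induction w arbitrary: s)
  case Nil
  then show ?case using fin[of s] by (auto simp: mem_Times_iff)
next
  case (Cons c w)
  then show ?case using \<delta>[of s c] by (auto simp: mem_Times_iff)
qed

lemma run_in: "fst (run \<sigma>) \<in> S \<and> set (snd (run \<sigma>)) \<subseteq> \<Gamma>"
proof (induction \<sigma>)
  case Nil
  then show ?case using sweep_in[OF s0, of "[]"] by simp
next
  case (Cons b \<sigma>)
  then show ?case using sweep_in[OF start, of "fst (run \<sigma>)" "snd (run \<sigma>)" b] by (simp add: case_prod_beta)
qed

lemma length_run [simp]: "length (snd (run \<sigma>)) = Suc (length \<sigma>)"
  by (induction \<sigma>) (auto split: prod.splits)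

text \<open>\<open>Halt\<close> is left out because the halting state has the number
  \<open>states M\<close>, outside the range of the working states.\<close>

definition controls :: "'s control set" where
  "controls = {Init, Sign} \<union> Get ` S \<union> Sweep ` S \<union> Return ` S \<union> Numerator ` {..<L} \<union> Denominator ` {..<D}"

lemma finite_controls: "finite controls"
  unfolding controls_def using finite_S by simp

end

text \<open>Codes of cells start at 5 so that on the work tape they differ from the blank and the
  start symbol, which mark its two ends.\<close>

locale coded_sweep_machine = sweep_machine S \<Gamma> s0 start \<delta> fin digits L D
  for S :: "'s set" and \<Gamma> :: "'c set" and s0 start \<delta> fin digits L D +
  fixes code :: "'s control \<Rightarrow> nat" and enc :: "'c \<Rightarrow> nat" and n_states n_symbols :: nat
  assumes code: "bij_betw code controls {..<n_states}" and code_Init: "code Init = 0"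
    and code_Halt: "code Halt = n_states"
    and inj_enc: "inj_on enc \<Gamma>" and enc: "\<And>c. c \<in> \<Gamma> \<Longrightarrow> enc c \<in> {5..<n_symbols}"
    and n_symbols: "n_symbols \<ge> 5"
begin

text \<open>Well-formedness concerns all symbols a head might read, so a symbol that codes no cell
  is also decoded to an element of \<open>\<Gamma>\<close>.\<close>

definition dec :: "nat \<Rightarrow> 'c" where
  "dec y = (if y \<in> enc ` \<Gamma> then inv_into \<Gamma> enc y else snd (fin s0))"

lemma dec_enc [simp]: "c \<in> \<Gamma> \<Longrightarrow> dec (enc c) = c"
  using inj_enc by (simp add: dec_def)

lemma dec_in: "dec y \<in> \<Gamma>"
  using fin[OF s0] by (auto simp: dec_def mem_Times_iff inv_into_into)

text \<open>Tapes 0, 1, 2 are prescribed by the definitions; tape 3 is the work tape.\<close>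

fun control_step :: "'s control \<Rightarrow> nat list \<Rightarrow> 's control \<times> (nat \<times> head_move) list" where
  "control_step Init [a, i, z, y] =
     (Sweep s0, [(a, Move_Right), (i, Stay), (z, Stay), (y, Move_Right)])"
| "control_step (Get s) [a, i, z, y] =
     (if a = 2 \<or> a = 3 then (Sweep (start s (a = 3)), [(a, Move_Right), (i, Stay), (z, Stay), (y, Move_Right)])
      else (Sign, [(a, Stay), (i, Stay), (z, Move_Right), (y, Move_Right)]))"
| "control_step (Sweep s) [a, i, z, y] =
     (if y = blank_symbol then (Return (fst (fin s)), [(a, Stay), (i, Stay), (z, Stay), (enc (snd (fin s)), Stay)])
      else (Sweep (fst (\<delta> s (dec y))), [(a, Stay), (i, Stay), (z, Stay), (enc (snd (\<delta> s (dec y))), Move_Right)]))"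
| "control_step (Return s) [a, i, z, y] =
     (if y = start_symbol then (Get s, [(a, Stay), (i, Stay), (z, Stay), (y, Stay)])
      else (Return s, [(a, Stay), (i, Stay), (z, Stay), (y, Move_Left)]))"
| "control_step Sign [a, i, z, y] =
     (Numerator 0, [(a, Stay), (i, Stay), (bit_symbol False, Move_Right), (y, Stay)])"
| "control_step (Numerator j) [a, i, z, y] =
     (if y = blank_symbol then (Denominator 0, [(a, Stay), (i, Stay), (separator_symbol, Move_Right), (y, Move_Left)])
      else (if Suc j < L then Numerator (Suc j) else Numerator 0,
        [(a, Stay), (i, Stay), (bit_symbol (digits (dec y) ! j), Move_Right),
         (y, if Suc j < L then Stay else Move_Right)]))"
| "control_step (Denominator j) [a, i, z, y] =
     (if y = start_symbol then (Halt, [(a, Stay), (i, Stay), (bit_symbol True, Stay), (y, Stay)])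
      else (if Suc j < D then Denominator (Suc j) else Denominator 0,
        [(a, Stay), (i, Stay), (bit_symbol False, Move_Right), (y, if Suc j < D then Stay else Move_Left)]))"
| "control_step q w = (Halt, map (\<lambda>a. (a, Stay)) w)"

definition M :: turing_machine where
  "M = \<lparr>tapes = 4, symbols = n_symbols, states = n_states,
        trans = (\<lambda>q w. map_prod code id (control_step (inv_into controls code q) w))\<rparr>"

lemma length_4_exE:
  assumes "length w = 4"
  obtains a b c d where "w = [a, b, c, d]"
  using assms by (auto simp: numeral_eq_Suc length_Suc_conv)

lemma control_step_wf:
  assumes "q \<in> controls" "length w = 4" "set w \<subseteq> {0..<n_symbols}"
  shows "case control_step q w of (q', acts) \<Rightarrow>
    q' \<in> insert Halt controls \<and> length acts = 4 \<and> fst ` set acts \<subseteq> {0..<n_symbols}"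
proof -
  obtain a i z y where w: "w = [a, i, z, y]" using assms(2) by (rule length_4_exE)
  have *: "s \<in> S \<Longrightarrow> fst (fin s) \<in> S \<and> snd (fin s) \<in> \<Gamma>"
    "s \<in> S \<Longrightarrow> fst (\<delta> s (dec y)) \<in> S \<and> snd (\<delta> s (dec y)) \<in> \<Gamma>" for s
    using fin[of s] \<delta>[of s "dec y"] dec_in[of y] by (auto simp: mem_Times_iff)
  have enc': "c \<in> \<Gamma> \<Longrightarrow> enc c < n_symbols" for c using enc[of c] by simp
  show ?thesis
    using assms(1,3) n_symbols L D
    unfolding w by (cases q) (auto simp: controls_def s0 start * enc')
qed

lemma code_inj: "q \<in> controls \<Longrightarrow> inv_into controls code (code q) = q"
  using code by (simp add: bij_betw_def)

lemma code_less: "q \<in> controls \<Longrightarrow> code q < n_states"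
  using code by (auto simp: bij_betw_def)

lemma wf_M: "wf_machine M"
  unfolding wf_machine_def
proof (intro conjI allI impI)
  show "3 \<le> tapes M" "5 \<le> symbols M" using n_symbols by (simp_all add: M_def)
next
  fix q w assume q: "q < states M" and w: "length w = tapes M \<and> set w \<subseteq> {0..<symbols M}"
  from q code have c: "inv_into controls code q \<in> controls"
    by (auto simp: M_def bij_betw_def intro!: inv_into_into)
  have le: "q' \<in> insert Halt controls \<Longrightarrow> code q' \<le> n_states" for q'
    using code_less[of q'] code_Halt by auto
  show "case trans M q w of (q', acts) \<Rightarrow> q' \<le> states M \<and> length acts = tapes M \<and>
          fst ` set acts \<subseteq> {0..<symbols M}"
    using control_step_wf[OF c, of w] w le by (auto simp: M_def split: prod.splits)
qed

section \<open>Single steps on configurations\<close>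

definition config ::
    "'s control \<Rightarrow> bool list \<Rightarrow> nat \<Rightarrow> nat \<Rightarrow> nat list \<Rightarrow> nat \<Rightarrow> 'c list \<Rightarrow> nat \<Rightarrow> nat \<times> tape list" where
  "config q \<sigma> h i z k w l = (code q, [(word_cells (map bit_symbol \<sigma>), h),
     (word_cells (replicate i (bit_symbol True)), 0), (word_cells z, k), (word_cells (map enc w), l)])"

lemma step_config:
  assumes "q \<in> controls"
  shows "step M (config q \<sigma> h i z k w l) =
    (case control_step q [word_cells (map bit_symbol \<sigma>) h, start_symbol, word_cells z k, word_cells (map enc w) l] of
      (q', acts) \<Rightarrow> (code q', map2 act_tape acts
        [(word_cells (map bit_symbol \<sigma>), h), (word_cells (replicate i (bit_symbol True)), 0),
         (word_cells z, k), (word_cells (map enc w), l)]))"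
  using code_less[OF assms] code_inj[OF assms]
  by (simp add: config_def M_def split: prod.splits)

lemma in_controls [simp, intro]:
  "Init \<in> controls" "Sign \<in> controls" "s \<in> S \<Longrightarrow> Get s \<in> controls" "s \<in> S \<Longrightarrow> Sweep s \<in> controls"
  "s \<in> S \<Longrightarrow> Return s \<in> controls" "j < L \<Longrightarrow> Numerator j \<in> controls" "j < D \<Longrightarrow> Denominator j \<in> controls"
  by (auto simp: controls_def)

lemma step_Init: "step M (config Init \<sigma> 0 i [] 0 [] 0) = config (Sweep s0) \<sigma> 1 i [] 0 [] 1"
  by (simp add: step_config, simp add: config_def fun_upd_idem)

lemma step_Get_bit:
  assumes "s \<in> S"
  shows "step M (config (Get s) (u @ b # v) (Suc (length u)) i z k w 0) =
    config (Sweep (start s b)) (u @ b # v) (Suc (Suc (length u))) i z k w 1"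
  using assms by (simp add: step_config, simp add: config_def fun_upd_idem word_cells_Suc nth_append)

lemma step_Get_end:
  assumes "s \<in> S"
  shows "step M (config (Get s) \<sigma> (Suc (length \<sigma>)) i [] 0 w 0) = config Sign \<sigma> (Suc (length \<sigma>)) i [] 1 w 1"
  using assms by (simp add: step_config word_cells_Suc, simp add: config_def fun_upd_idem word_cells_Suc)

lemma step_Sweep:
  assumes "s \<in> S" "c \<in> \<Gamma>"
  shows "step M (config (Sweep s) \<sigma> h i z k (u @ c # v) (Suc (length u))) =
    config (Sweep (fst (\<delta> s c))) \<sigma> h i z k (u @ snd (\<delta> s c) # v) (Suc (Suc (length u)))"
  using assms enc[of c] word_cells_update[of "map enc u" "enc c" "map enc v"]
  by (simp add: step_config word_cells_Suc nth_append, simp add: config_def fun_upd_idem)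

lemma step_Sweep_end:
  assumes "s \<in> S"
  shows "step M (config (Sweep s) \<sigma> h i z k w (Suc (length w))) =
    config (Return (fst (fin s))) \<sigma> h i z k (w @ [snd (fin s)]) (Suc (length w))"
  using assms word_cells_snoc[of "map enc w"]
  by (simp add: step_config word_cells_Suc, simp add: config_def fun_upd_idem)

lemma word_cells_enc:
  assumes "set w \<subseteq> \<Gamma>" "l < length w"
  shows "word_cells (map enc w) (Suc l) = enc (w ! l)" "enc (w ! l) \<ge> 5"
  using assms enc[of "w ! l"] nth_mem[of l w] by (auto simp: word_cells_Suc subset_iff)

lemma step_Return:
  assumes "s \<in> S" "set w \<subseteq> \<Gamma>" "l < length w"
  shows "step M (config (Return s) \<sigma> h i z k w (Suc l)) = config (Return s) \<sigma> h i z k w l"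
  using assms word_cells_enc[OF assms(2,3)]
  by (simp add: step_config, simp add: config_def fun_upd_idem)

lemma step_Return_start:
  assumes "s \<in> S"
  shows "step M (config (Return s) \<sigma> h i z k w 0) = config (Get s) \<sigma> h i z k w 0"
  using assms by (simp add: step_config, simp add: config_def fun_upd_idem)

lemma step_Sign:
  "step M (config Sign \<sigma> h i [] 1 w l) = config (Numerator 0) \<sigma> h i [bit_symbol False] 2 w l"
  using word_cells_snoc[of "[]"] by (simp add: step_config, simp add: config_def fun_upd_idem numeral_2_eq_2)

lemma step_Numerator:
  assumes "j < L" "set w \<subseteq> \<Gamma>" "l < length w"
  shows "step M (config (Numerator j) \<sigma> h i z (Suc (length z)) w (Suc l)) =
    config (Numerator (if Suc j < L then Suc j else 0)) \<sigma> h i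
      (z @ [bit_symbol (digits (w ! l) ! j)]) (Suc (Suc (length z))) w (if Suc j < L then Suc l else Suc (Suc l))"
  using assms word_cells_enc[OF assms(2,3)] word_cells_snoc[of z] nth_mem[OF assms(3)]
  by (simp add: step_config subset_iff, simp add: config_def fun_upd_idem)

lemma step_Numerator_end:
  "step M (config (Numerator 0) \<sigma> h i z (Suc (length z)) w (Suc (length w))) =
    config (Denominator 0) \<sigma> h i (z @ [separator_symbol]) (Suc (Suc (length z))) w (length w)"
  using L word_cells_snoc[of z]
  by (simp add: step_config word_cells_Suc, simp add: config_def fun_upd_idem word_cells_Suc)

text \<open>The zeros are written while the work head walks back to the start, \<open>D\<close> per
  cell, so the tape itself serves as the counter. With the final 1 they form a power of two, least
  significant digit first.\<close>

lemma step_Denominator: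
  assumes "j < D" "set w \<subseteq> \<Gamma>" "l < length w"
  shows "step M (config (Denominator j) \<sigma> h i z (Suc (length z)) w (Suc l)) =
    config (Denominator (if Suc j < D then Suc j else 0)) \<sigma> h i
      (z @ [bit_symbol False]) (Suc (Suc (length z))) w (if Suc j < D then Suc l else l)"
  using assms word_cells_enc[OF assms(2,3)] word_cells_snoc[of z]
  by (simp add: step_config, simp add: config_def fun_upd_idem)

lemma step_Denominator_end:
  "step M (config (Denominator 0) \<sigma> h i z (Suc (length z)) w 0) =
    config Halt \<sigma> h i (z @ [bit_symbol True]) (Suc (length z)) w 0"
  using D word_cells_snoc[of z]
  by (simp add: step_config, simp add: config_def fun_upd_idem)

section \<open>Step counts of complete runs\<close>

definition reaches :: "nat \<Rightarrow> nat \<times> tape list \<Rightarrow> nat \<times> tape list \<Rightarrow> bool" where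
  "reaches n c c' \<longleftrightarrow> (step M ^^ n) c = c'"

lemma reaches_0: "reaches 0 c c"
  by (simp add: reaches_def)

lemma reaches_1: "step M c = c' \<Longrightarrow> reaches 1 c c'"
  by (simp add: reaches_def)

lemma reaches_trans: "reaches m a b \<Longrightarrow> reaches n b c \<Longrightarrow> k = m + n \<Longrightarrow> reaches k a c"
  unfolding reaches_def by (simp add: funpow_add add.commute[of m])

lemma reaches_Suc: "step M a = b \<Longrightarrow> reaches n b c \<Longrightarrow> reaches (Suc n) a c"
  using reaches_trans[OF reaches_1] by auto

lemma reaches_sweep:
  assumes "s \<in> S" "set v \<subseteq> \<Gamma>"
  shows "reaches (Suc (length v)) (config (Sweep s) \<sigma> h i z k (u @ v) (Suc (length u)))
    (config (Return (fst (sweep \<delta> fin s v))) \<sigma> h i z k (u @ snd (sweep \<delta> fin s v)) (Suc (length u + length v)))"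
  using assms
proof (induction v arbitrary: s u)
  case Nil
  then show ?case using step_Sweep_end[of s \<sigma> h i z k u] by (simp add: reaches_def)
next
  case (Cons c v)
  have "reaches (Suc (length v)) (config (Sweep (fst (\<delta> s c))) \<sigma> h i z k ((u @ [snd (\<delta> s c)]) @ v) (Suc (length (u @ [snd (\<delta> s c)]))))
    (config (Return (fst (sweep \<delta> fin (fst (\<delta> s c)) v))) \<sigma> h i z k
       ((u @ [snd (\<delta> s c)]) @ snd (sweep \<delta> fin (fst (\<delta> s c)) v)) (Suc (length (u @ [snd (\<delta> s c)]) + length v)))"
    using Cons.prems \<delta>[of s c] by (intro Cons.IH) (auto simp: mem_Times_iff)
  from reaches_Suc[OF _ this] show ?case
    using Cons.prems by (simp add: step_Sweep)
qed

lemma reaches_Return: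
  assumes "s \<in> S" "set w \<subseteq> \<Gamma>" "l \<le> length w"
  shows "reaches (Suc l) (config (Return s) \<sigma> h i z k w l) (config (Get s) \<sigma> h i z k w 0)"
  using assms(3)
proof (induction l)
  case 0
  then show ?case using step_Return_start assms by (simp add: reaches_def)
next
  case (Suc l)
  then show ?case using reaches_Suc[OF step_Return[OF assms(1,2)]] by simp
qed

lemma reaches_Get:
  assumes "s \<in> S" "set w \<subseteq> \<Gamma>" "sweep \<delta> fin (start s b) w = (s', w')"
  shows "reaches (2 * length w + 4) (config (Get s) (u @ b # v) (Suc (length u)) i z k w 0)
    (config (Get s') (u @ b # v) (Suc (Suc (length u))) i z k w' 0)"
proof -
  have 1: "reaches (Suc (length w)) (config (Sweep (start s b)) (u @ b # v) (Suc (Suc (length u))) i z k w 1)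
    (config (Return s') (u @ b # v) (Suc (Suc (length u))) i z k w' (Suc (length w)))"
    using reaches_sweep[OF start[OF assms(1)] assms(2), of b "u @ b # v" "Suc (Suc (length u))" i z k "[]"] assms(3)
    by simp
  have 2: "s' \<in> S" "set w' \<subseteq> \<Gamma>" using sweep_in[OF start[OF assms(1)] assms(2), of b] assms(3) by auto
  have "length w' = Suc (length w)" using length_sweep assms(3) by (metis snd_conv)
  then have 3: "reaches (Suc (Suc (length w))) (config (Return s') (u @ b # v) (Suc (Suc (length u))) i z k w' (Suc (length w)))
     (config (Get s') (u @ b # v) (Suc (Suc (length u))) i z k w' 0)"
    by (intro reaches_Return 2) auto
  show ?thesis
    by (rule reaches_trans[OF reaches_Suc[OF step_Get_bit[OF assms(1)] 1] 3]) simp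
qed

text \<open>With \<open>k\<close> symbols read there are \<open>k + 1\<close> cells, and the next
  symbol costs \<open>2 * (k + 1) + 4\<close> steps; the sum over \<open>k < n\<close> is
  \<open>n * (n + 5)\<close>. The first pass adds 3.\<close>

lemma reaches_read:
  "reaches (length u * (length u + 5) + 3) (config (Sweep s0) (u @ v) 1 i z k [] 1)
    (config (Get (fst (run (rev u)))) (u @ v) (Suc (length u)) i z k (snd (run (rev u))) 0)"
proof (induction u arbitrary: v rule: rev_induct)
  case Nil
  have "reaches 1 (config (Sweep s0) v 1 i z k [] 1)
    (config (Return (fst (run []))) v 1 i z k (snd (run [])) 1)"
    using reaches_sweep[OF s0, of "[]" v 1 i z k "[]"] by simp
  moreover have "reaches 2 (config (Return (fst (run []))) v 1 i z k (snd (run [])) 1)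
    (config (Get (fst (run []))) v 1 i z k (snd (run [])) 0)"
    using reaches_Return[of "fst (run [])" "snd (run [])" 1 v 1 i z k] run_in[of "[]"]
    by (simp add: numeral_2_eq_2)
  ultimately show ?case using reaches_trans[where k = 3] by fastforce
next
  case (snoc b u)
  obtain s w where sw: "run (rev u) = (s, w)" by fastforce
  have in_S: "s \<in> S" "set w \<subseteq> \<Gamma>" "length w = Suc (length u)"
    using run_in[of "rev u"] length_run[of "rev u"] sw by auto
  obtain s' w' where sw': "sweep \<delta> fin (start s b) w = (s', w')" by fastforce
  have "length u * (length u + 5) + 3 + (2 * length w + 4) = length (u @ [b]) * (length (u @ [b]) + 5) + 3"
    using in_S(3) by (simp add: algebra_simps)
  then show ?case
    using reaches_trans[OF snoc[of "b # v"] , of "2 * length w + 4" _ "length (u @ [b]) * (length (u @ [b]) + 5) + 3"]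
      reaches_Get[OF in_S(1,2) sw', of u v] sw sw' by simp
qed

lemma reaches_Numerator_cell:
  assumes "j < L" "set w \<subseteq> \<Gamma>" "l < length w"
  shows "reaches (L - j) (config (Numerator j) \<sigma> h i z (Suc (length z)) w (Suc l))
    (config (Numerator 0) \<sigma> h i (z @ map bit_symbol (drop j (digits (w ! l))))
      (Suc (length z + (L - j))) w (Suc (Suc l)))"
  using assms(1)
proof (induction "L - j" arbitrary: j z)
  case 0
  then show ?case by simp
next
  case (Suc m)
  have len: "length (digits (w ! l)) = L" using assms(2,3) nth_mem[of l w] by (auto intro!: length_digits)
  then have drop: "drop j (digits (w ! l)) = digits (w ! l) ! j # drop (Suc j) (digits (w ! l))"
    using Suc.prems by (simp add: Cons_nth_drop_Suc)
  show ?case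
  proof (cases "Suc j < L")
    case True
    let ?z = "z @ [bit_symbol (digits (w ! l) ! j)]"
    have "reaches (L - Suc j) (config (Numerator (Suc j)) \<sigma> h i ?z (Suc (length ?z)) w (Suc l))
      (config (Numerator 0) \<sigma> h i (?z @ map bit_symbol (drop (Suc j) (digits (w ! l))))
        (Suc (length ?z + (L - Suc j))) w (Suc (Suc l)))"
      using Suc.hyps(2) True by (intro Suc.hyps(1)) auto
    from reaches_Suc[OF _ this] show ?thesis
      using step_Numerator[OF Suc.prems assms(2,3)] True Suc.prems drop by (simp add: Suc_diff_Suc)
  next
    case False
    then have "drop (Suc j) (digits (w ! l)) = []" "L - j = 1" using len Suc.prems by auto
    then show ?thesis
      using step_Numerator[OF Suc.prems assms(2,3)] False Suc.prems drop
      by (simp add: reaches_def)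
  qed
qed

lemma reaches_Numerator:
  assumes "set (u @ v) \<subseteq> \<Gamma>"
  shows "reaches (L * length v) (config (Numerator 0) \<sigma> h i z (Suc (length z)) (u @ v) (Suc (length u)))
    (config (Numerator 0) \<sigma> h i (z @ map bit_symbol (concat (map digits v)))
      (Suc (length z + L * length v)) (u @ v) (Suc (length u + length v)))"
  using assms
proof (induction v arbitrary: u z)
  case Nil
  then show ?case by (simp add: reaches_0)
next
  case (Cons c v)
  let ?z = "z @ map bit_symbol (digits c)"
  have len: "length (digits c) = L" using Cons.prems by (auto intro!: length_digits)
  have 1: "reaches L (config (Numerator 0) \<sigma> h i z (Suc (length z)) (u @ c # v) (Suc (length u)))
     (config (Numerator 0) \<sigma> h i ?z (Suc (length ?z)) (u @ c # v) (Suc (Suc (length u))))"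
    using reaches_Numerator_cell[of 0 "u @ c # v" "length u" \<sigma> h i z] L Cons.prems len by simp
  have 2: "reaches (L * length v) (config (Numerator 0) \<sigma> h i ?z (Suc (length ?z)) ((u @ [c]) @ v) (Suc (length (u @ [c]))))
    (config (Numerator 0) \<sigma> h i (?z @ map bit_symbol (concat (map digits v)))
      (Suc (length ?z + L * length v)) ((u @ [c]) @ v) (Suc (length (u @ [c]) + length v)))"
    using Cons.prems by (intro Cons.IH) auto
  show ?case
    using reaches_trans[OF 1, of "L * length v"] 2 len by (simp add: algebra_simps)
qed

lemma reaches_Denominator_cell:
  assumes "j < D" "set w \<subseteq> \<Gamma>" "l < length w"
  shows "reaches (D - j) (config (Denominator j) \<sigma> h i z (Suc (length z)) w (Suc l))
    (config (Denominator 0) \<sigma> h i (z @ replicate (D - j) (bit_symbol False)) (Suc (length z + (D - j))) w l)"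
  using assms(1)
proof (induction "D - j" arbitrary: j z)
  case 0
  then show ?case by simp
next
  case (Suc m)
  show ?case
  proof (cases "Suc j < D")
    case True
    let ?z = "z @ [bit_symbol False]"
    have "reaches (D - Suc j) (config (Denominator (Suc j)) \<sigma> h i ?z (Suc (length ?z)) w (Suc l))
      (config (Denominator 0) \<sigma> h i (?z @ replicate (D - Suc j) (bit_symbol False))
        (Suc (length ?z + (D - Suc j))) w l)"
      using Suc.hyps(2) True by (intro Suc.hyps(1)) auto
    from reaches_Suc[OF _ this] show ?thesis
      using step_Denominator[OF Suc.prems assms(2,3)] True Suc.prems
      by (simp add: Suc_diff_Suc flip: replicate_Suc)
  next
    case False
    then have "D - j = 1" using Suc.prems by auto
    then show ?thesis
      using step_Denominator[OF Suc.prems assms(2,3)] False Suc.prems by (simp add: reaches_def)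
  qed
qed

lemma reaches_Denominator:
  assumes "set w \<subseteq> \<Gamma>" "l \<le> length w"
  shows "reaches (D * l) (config (Denominator 0) \<sigma> h i z (Suc (length z)) w l)
    (config (Denominator 0) \<sigma> h i (z @ replicate (D * l) (bit_symbol False)) (Suc (length z + D * l)) w 0)"
  using assms(2)
proof (induction l arbitrary: z)
  case 0
  then show ?case by (simp add: reaches_0)
next
  case (Suc l)
  let ?z = "z @ replicate D (bit_symbol False)"
  have 1: "reaches D (config (Denominator 0) \<sigma> h i z (Suc (length z)) w (Suc l))
    (config (Denominator 0) \<sigma> h i ?z (Suc (length ?z)) w l)"
    using reaches_Denominator_cell[of 0 w l \<sigma> h i z] D assms(1) Suc.prems by simp
  have "reaches (D * l) (config (Denominator 0) \<sigma> h i ?z (Suc (length ?z)) w l)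
    (config (Denominator 0) \<sigma> h i (?z @ replicate (D * l) (bit_symbol False)) (Suc (length ?z + D * l)) w 0)"
    using Suc.prems by (intro Suc.IH) auto
  with reaches_trans[OF 1, of "D * l"] show ?case
    by (simp add: algebra_simps flip: replicate_add)
qed

definition run_time :: "nat \<Rightarrow> nat" where
  "run_time n = n * (n + 5) + (L + D) * Suc n + 8"

lemma reaches_result:
  fixes \<sigma> :: "bool list"
  defines "z \<equiv> bit_symbol False # map bit_symbol (output_bits \<sigma>) @
      separator_symbol # map bit_symbol (replicate (D * Suc (length \<sigma>)) False @ [True])"
  shows "\<exists>k. reaches (run_time (length \<sigma>)) (initial_config M \<sigma> i)
    (config Halt \<sigma> (Suc (length \<sigma>)) i z k (snd (run (rev \<sigma>))) 0)"
proof -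
  obtain s w where sw: "run (rev \<sigma>) = (s, w)" by fastforce
  have in_S: "s \<in> S" "set w \<subseteq> \<Gamma>" "length w = Suc (length \<sigma>)"
    using run_in[of "rev \<sigma>"] length_run[of "rev \<sigma>"] sw by auto
  let ?n = "length \<sigma>" let ?h = "Suc ?n"
  let ?z1 = "bit_symbol False # map bit_symbol (output_bits \<sigma>)"
  let ?z2 = "?z1 @ [separator_symbol]"
  let ?z3 = "?z2 @ replicate (D * Suc ?n) (bit_symbol False)"
  have len: "length (output_bits \<sigma>) = L * Suc ?n"
  proof -
    have "length (concat (map digits v)) = L * length v" if "set v \<subseteq> \<Gamma>" for v
      using that by (induction v) (auto simp: length_digits)
    then show ?thesis using in_S by (simp add: output_bits_def sw)
  qed
  have init: "initial_config M \<sigma> i = config Init \<sigma> 0 i [] 0 [] 0"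
    by (simp add: initial_config_def config_def code_Init M_def word_tape_word_cells numeral_2_eq_2)
  have 1: "reaches 1 (initial_config M \<sigma> i) (config (Sweep s0) \<sigma> 1 i [] 0 [] 1)"
    unfolding init by (rule reaches_1[OF step_Init])
  have 2: "reaches (?n * (?n + 5) + 3) (config (Sweep s0) \<sigma> 1 i [] 0 [] 1) (config (Get s) \<sigma> ?h i [] 0 w 0)"
    using reaches_read[of \<sigma> "[]"] sw by simp
  have 3: "reaches 1 (config (Get s) \<sigma> ?h i [] 0 w 0) (config Sign \<sigma> ?h i [] 1 w 1)"
    using step_Get_end[OF in_S(1)] by (intro reaches_1)
  have 4: "reaches 1 (config Sign \<sigma> ?h i [] 1 w 1) (config (Numerator 0) \<sigma> ?h i [bit_symbol False] 2 w 1)"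
    by (intro reaches_1 step_Sign)
  have 5: "reaches (L * Suc ?n) (config (Numerator 0) \<sigma> ?h i [bit_symbol False] 2 w 1)
      (config (Numerator 0) \<sigma> ?h i ?z1 (Suc (length ?z1)) w (Suc (length w)))"
    using reaches_Numerator[of "[]" w \<sigma> ?h i "[bit_symbol False]"] in_S len
    by (simp add: output_bits_def sw numeral_2_eq_2)
  have 6: "reaches 1 (config (Numerator 0) \<sigma> ?h i ?z1 (Suc (length ?z1)) w (Suc (length w)))
      (config (Denominator 0) \<sigma> ?h i ?z2 (Suc (length ?z2)) w (length w))"
    using step_Numerator_end[of \<sigma> ?h i ?z1 w] by (intro reaches_1) simp
  have 7: "reaches (D * Suc ?n) (config (Denominator 0) \<sigma> ?h i ?z2 (Suc (length ?z2)) w (length w))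
      (config (Denominator 0) \<sigma> ?h i ?z3 (Suc (length ?z3)) w 0)"
    using reaches_Denominator[OF in_S(2) order.refl, of \<sigma> ?h i ?z2] in_S(3) by simp
  have 8: "reaches 1 (config (Denominator 0) \<sigma> ?h i ?z3 (Suc (length ?z3)) w 0)
      (config Halt \<sigma> ?h i z (Suc (length ?z3)) w 0)"
    using step_Denominator_end[of \<sigma> ?h i ?z3 w] by (intro reaches_1) (simp add: z_def)
  note trans = reaches_trans[OF _ _ refl]
  note all = trans[OF trans[OF trans[OF trans[OF trans[OF trans[OF trans[OF 1 2] 3] 4] 5] 6] 7] 8]
  have "1 + (?n * (?n + 5) + 3) + 1 + 1 + L * Suc ?n + 1 + D * Suc ?n + 1 = run_time ?n"
    by (simp add: run_time_def algebra_simps)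
  with all show ?thesis unfolding sw by auto
qed

text \<open>\<open>computes_within\<close> fixes the number of steps; as a halted configuration is
  stationary, every larger number serves as well.\<close>

lemma step_halted: "fst c = states M \<Longrightarrow> (step M ^^ n) c = c"
  by (induction n) (cases c; auto)+

lemma horner_sum_power: "horner_sum of_bool 2 (replicate k False @ [True]) = (2 ^ k :: nat)"
  by (induction k) auto

lemma computes:
  assumes "T \<ge> run_time (length \<sigma>)"
  shows "computes_within M \<sigma> i (of_nat (horner_sum of_bool 2 (output_bits \<sigma>)) / 2 ^ (D * Suc (length \<sigma>))) T"
proof -
  let ?ds = "replicate (D * Suc (length \<sigma>)) False @ [True]"
  let ?z = "bit_symbol False # map bit_symbol (output_bits \<sigma>) @ separator_symbol # map bit_symbol ?ds"
  obtain k where "reaches (run_time (length \<sigma>)) (initial_config M \<sigma> i)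
    (config Halt \<sigma> (Suc (length \<sigma>)) i ?z k (snd (run (rev \<sigma>))) 0)"
    using reaches_result by blast
  then have "(step M ^^ T) (initial_config M \<sigma> i) =
      (step M ^^ (T - run_time (length \<sigma>))) (config Halt \<sigma> (Suc (length \<sigma>)) i ?z k (snd (run (rev \<sigma>))) 0)"
    using funpow_add[of "T - run_time (length \<sigma>)" "run_time (length \<sigma>)" "step M"] assms
    by (simp add: reaches_def)
  also have "\<dots> = config Halt \<sigma> (Suc (length \<sigma>)) i ?z k (snd (run (rev \<sigma>))) 0"
    by (intro step_halted) (simp add: config_def code_Halt M_def)
  finally have *: "(step M ^^ T) (initial_config M \<sigma> i) = \<dots>" .
  have "encodes_rat ?z (of_nat (horner_sum of_bool 2 (output_bits \<sigma>)) / 2 ^ (D * Suc (length \<sigma>)))"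
    unfolding encodes_rat_def
    by (intro exI[of _ False] exI[of _ "output_bits \<sigma>"] exI[of _ ?ds])
      (auto simp only: horner_sum_power, auto)
  moreover have "has_word (word_cells ?z, k) ?z"
    by (intro has_word_word_cells) auto
  ultimately show ?thesis
    unfolding computes_within_def * config_def by (auto simp: code_Halt M_def)
qed

lemma polynomial_time_computable_output:
  "polynomial_time_computable (\<lambda>\<sigma>. real (horner_sum of_bool 2 (output_bits \<sigma>)) / 2 ^ (D * Suc (length \<sigma>)))"
  unfolding polynomial_time_computable_def
proof (intro exI conjI allI)
  show "wf_machine M" by (rule wf_M)
  \<comment> \<open>The output is exact, so one value serves every precision \<open>i\<close>, and
    monotonicity of \<open>run_time\<close> covers the longer time allowed.\<close>
  show "computes_within M \<sigma> i (of_nat (horner_sum of_bool 2 (output_bits \<sigma>)) / 2 ^ (D * Suc (length \<sigma>)))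
    (run_time (length \<sigma> + i))" for \<sigma> i
    by (rule computes) (auto simp: run_time_def intro!: add_mono mult_mono)
  show "\<bar>of_rat (of_nat (horner_sum of_bool 2 (output_bits \<sigma>)) / 2 ^ (D * Suc (length \<sigma>))) -
      real (horner_sum of_bool 2 (output_bits \<sigma>)) / 2 ^ (D * Suc (length \<sigma>))\<bar> \<le> 1 / 2 ^ i" for \<sigma> i
    by (simp add: of_rat_divide of_rat_power)
  show "(\<lambda>n. real (run_time n)) \<in> O(\<lambda>n. poly [:real (L + D + 8), real (L + D + 5), 1:] (real n))"
    by (intro bigoI[of _ 1]) (auto simp: run_time_def algebra_simps)
qed

end

theorem (in sweep_machine) polynomial_time_computable_output:
  "polynomial_time_computable (\<lambda>\<sigma>. real (horner_sum of_bool 2 (output_bits \<sigma>)) / 2 ^ (D * Suc (length \<sigma>)))"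
proof -
  obtain e where e: "bij_betw e (controls - {Init}) {0..<card (controls - {Init})}"
    using ex_bij_betw_finite_nat finite_controls by blast
  define N where "N = Suc (card (controls - {Init}))"
  define code where "code q = (if q = Init then 0 else if q = Halt then N else Suc (e q))" for q
  obtain g where g: "bij_betw g \<Gamma> {0..<card \<Gamma>}"
    using ex_bij_betw_finite_nat finite_\<Gamma> by blast
  have H: "Halt \<notin> controls" "Init \<in> controls" by (auto simp: controls_def)
  have "bij_betw (Suc \<circ> e) (controls - {Init}) (Suc ` {0..<card (controls - {Init})})"
    by (rule bij_betw_trans[OF e]) (auto simp: bij_betw_def)
  then have "bij_betw code (controls - {Init}) (Suc ` {0..<card (controls - {Init})})"
    using H by (subst bij_betw_cong[of _ _ "Suc \<circ> e"]) (auto simp: code_def)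
  then have "bij_betw code ({Init} \<union> (controls - {Init})) ({0} \<union> Suc ` {0..<card (controls - {Init})})"
    by (intro bij_betw_combine) (auto simp: code_def)
  moreover have "{0} \<union> Suc ` {0..<card (controls - {Init})} = {..<N}"
    by (auto simp: N_def image_iff less_Suc_eq_0_disj)
  ultimately have code: "bij_betw code controls {..<N}" using H by (simp add: insert_absorb)
  have g': "inj_on (\<lambda>c. g c + 5) \<Gamma>" "c \<in> \<Gamma> \<Longrightarrow> g c < card \<Gamma>" for c
    using g by (auto simp: bij_betw_def inj_on_def)
  have "coded_sweep_machine S \<Gamma> s0 start \<delta> fin digits L D code (\<lambda>c. g c + 5) N (card \<Gamma> + 5)"
    by unfold_locales (use code g' in \<open>auto simp: code_def\<close>)
  then show ?thesis by (rule coded_sweep_machine.polynomial_time_computable_output)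
qed

section \<open>Integer registers on a sweeping machine\<close>

text \<open>
  A register holds an integer \<open>l + 2 ^ n * v\<close> with \<open>0 \<le> l < 2 ^ n\<close>: the binary digits of \<open>l\<close> are
  spread over the \<open>n\<close> cells of the work tape, while the top part \<open>v\<close> belongs to the finite
  control. One sweep applies an integer matrix to all registers, with bounded carries.
\<close>

locale register_machine =
  fixes k :: nat and V :: "(nat \<Rightarrow> int) set" and v0 :: "nat \<Rightarrow> int"
    and A :: "(nat \<Rightarrow> int) \<Rightarrow> bool \<Rightarrow> nat \<Rightarrow> nat \<Rightarrow> int"
    and clip :: "(nat \<Rightarrow> int) \<Rightarrow> nat \<Rightarrow> int" and mult :: "(nat \<Rightarrow> int) \<Rightarrow> bool \<Rightarrow> nat"
    and L D :: nat
  assumes finite_V: "finite V" and v0: "v0 \<in> V" and clip: "\<And>y. clip y \<in> V"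
    and mult: "\<And>v b. v \<in> V \<Longrightarrow> mult v b < 2 ^ L" and D: "0 < D" "D < L"
begin

definition image_regs :: "(nat \<Rightarrow> int) \<Rightarrow> bool \<Rightarrow> (nat \<Rightarrow> int) \<Rightarrow> nat \<Rightarrow> int" where
  "image_regs v b x i = (\<Sum>l<k. A v b i l * x l)"

text \<open>A bound that reproduces itself: a row applied to binary digits is at most
  \<open>R\<close> in absolute value, and adding a carry of size at most \<open>R\<close> and
  halving leads back to at most \<open>R\<close>.\<close>

definition R :: int where
  "R = Max (insert 0 ((\<lambda>(v, b, i). \<Sum>l<k. \<bar>A v b i l\<bar>) ` (V \<times> UNIV \<times> {..<k})))"

lemma R: "0 \<le> R" and A: "v \<in> V \<Longrightarrow> i < k \<Longrightarrow> (\<Sum>l<k. \<bar>A v b i l\<bar>) \<le> R"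
proof -
  have fin: "finite ((\<lambda>(v, b, i). \<Sum>l<k. \<bar>A v b i l\<bar>) ` (V \<times> (UNIV :: bool set) \<times> {..<k}))"
    using finite_V by (intro finite_imageI finite_cartesian_product) auto
  then show "0 \<le> R" unfolding R_def by (intro Max_ge) auto
  assume "v \<in> V" "i < k"
  then have "(\<Sum>l<k. \<bar>A v b i l\<bar>) \<in> (\<lambda>(v, b, i). \<Sum>l<k. \<bar>A v b i l\<bar>) ` (V \<times> UNIV \<times> {..<k})"
    by (intro image_eqI[of _ _ "(v, b, i)"]) auto
  then show "(\<Sum>l<k. \<bar>A v b i l\<bar>) \<le> R"
    unfolding R_def using fin by (intro Max_ge) auto
qed

text \<open>The sweeps on the level of integers: top parts, low parts, numerator of the capital.
  After \<open>n\<close> symbols there are \<open>n + 1\<close> cells, so the split is at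
  \<open>2 ^ (n + 1)\<close>, and the initial numerator \<open>2 ^ D\<close> means capital 1.
  \<open>clip\<close> forces the top parts into the finite set \<open>V\<close>; that this loses
  nothing essential depends on the instance.\<close>

fun exec :: "bool list \<Rightarrow> (nat \<Rightarrow> int) \<times> (nat \<Rightarrow> int) \<times> nat" where
  "exec [] = (v0, \<lambda>_. 0, 2 ^ D)"
| "exec (b # \<sigma>) = (case exec \<sigma> of (v, lo, m) \<Rightarrow>
     let y = image_regs v b (\<lambda>l. lo l + 2 ^ Suc (length \<sigma>) * v l); N = Suc (Suc (length \<sigma>))
     in (clip (\<lambda>i\<in>{..<k}. y i div 2 ^ N), \<lambda>i. y i mod 2 ^ N, mult v b * m))"

section \<open>Finite control and work cells\<close>

type_synonym sweep_state = "((nat \<Rightarrow> int) \<times> bool \<times> (nat \<Rightarrow> int) \<times> nat) option"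
type_synonym cell = "(nat \<Rightarrow> int) \<times> nat"

definition zeros :: "nat \<Rightarrow> int" where
  "zeros = (\<lambda>i\<in>{..<k}. 0)"

text \<open>\<open>None\<close> is the state of the very first pass. Otherwise the components are
  the top parts, the current input bit, the carries of the registers and the carry of the
  numerator.\<close>

definition S :: "sweep_state set" where
  "S = insert None (Some ` (V \<times> UNIV \<times> ({..<k} \<rightarrow>\<^sub>E {-R..R}) \<times> {..<2 ^ L}))"

definition \<Gamma> :: "cell set" where
  "\<Gamma> = ({..<k} \<rightarrow>\<^sub>E {0..1}) \<times> {..<2 ^ L}"

fun start :: "sweep_state \<Rightarrow> bool \<Rightarrow> sweep_state" where
  "start None b = None"
| "start (Some (v, _, _, _)) b = Some (v, b, zeros, 0)"

fun \<delta> :: "sweep_state \<Rightarrow> cell \<Rightarrow> sweep_state \<times> cell" where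
  "\<delta> None c = (None, c)"
| "\<delta> (Some (v, b, u, a)) (z, d) =
     (let y = (\<lambda>i. image_regs v b z i + u i); h = mult v b * d + a in
      (Some (v, b, \<lambda>i\<in>{..<k}. y i div 2, h div 2 ^ L), (\<lambda>i\<in>{..<k}. y i mod 2, h mod 2 ^ L)))"

fun fin :: "sweep_state \<Rightarrow> sweep_state \<times> cell" where
  "fin None = (Some (v0, False, zeros, 0), (zeros, 2 ^ D))"
| "fin (Some (v, b, u, a)) =
     (let y = (\<lambda>i. image_regs v b v i + u i) in
      (Some (clip (\<lambda>i\<in>{..<k}. y i div 2), False, zeros, 0), (\<lambda>i\<in>{..<k}. y i mod 2, a)))"

definition digits :: "cell \<Rightarrow> bool list" where
  "digits c = map (bit (snd c)) [0..<L]"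

lemma zeros_in: "zeros \<in> {..<k} \<rightarrow>\<^sub>E {-R..R}" "zeros \<in> {..<k} \<rightarrow>\<^sub>E {0..1}"
  using R by (auto simp: zeros_def)

lemma abs_image_regs_le:
  assumes "v \<in> V" "i < k" "z \<in> {..<k} \<rightarrow>\<^sub>E {0..1}"
  shows "\<bar>image_regs v b z i\<bar> \<le> R"
proof -
  have "\<bar>image_regs v b z i\<bar> \<le> (\<Sum>l<k. \<bar>A v b i l * z l\<bar>)"
    unfolding image_regs_def by (rule sum_abs)
  also have "\<dots> \<le> (\<Sum>l<k. \<bar>A v b i l\<bar>)"
  proof (rule sum_mono)
    fix l assume "l \<in> {..<k}"
    with assms(3) have "z l \<in> {0..1}" by (rule PiE_mem)
    then have "z l = 0 \<or> z l = 1" unfolding atLeastAtMost_iff by linarith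
    then show "\<bar>A v b i l * z l\<bar> \<le> \<bar>A v b i l\<bar>" by auto
  qed
  also have "\<dots> \<le> R" using A[OF assms(1,2)] .
  finally show ?thesis .
qed

text \<open>In base \<open>2 ^ L\<close> a one-digit factor produces only one-digit carries: with
  \<open>B\<close> the largest digit, \<open>B * B + B\<close> is less than the square of
  \<open>B + 1\<close>.\<close>

lemma mult_carry:
  assumes "v \<in> V" "d < 2 ^ L" "a < (2 :: nat) ^ L"
  shows "(mult v b * d + a) div 2 ^ L < 2 ^ L"
proof -
  define B where "B = (2 :: nat) ^ L - 1"
  have B: "2 ^ L = Suc B" by (simp add: B_def)
  have le: "mult v b \<le> B" "d \<le> B" "a \<le> B"
    using mult[OF assms(1), of b] assms(2,3) unfolding B by (simp_all add: less_Suc_eq_le)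
  have "mult v b * d + a \<le> B * B + B"
    by (intro add_mono mult_le_mono le)
  also have "\<dots> < Suc B * Suc B" by simp
  finally show ?thesis unfolding B by (rule less_mult_imp_div_less)
qed

lemma mod2_le_1: "(y :: int) mod 2 \<le> 1"
  by (simp add: pos_mod_bound[of 2, simplified] zle_diff1_eq[symmetric])

lemma \<delta>_in:
  assumes "s \<in> S" "c \<in> \<Gamma>"
  shows "\<delta> s c \<in> S \<times> \<Gamma>"
proof (cases s)
  case None
  then show ?thesis using assms by (simp add: S_def)
next
  case (Some t)
  then obtain v b u a where t: "t = (v, b, u, a)" "v \<in> V" "u \<in> {..<k} \<rightarrow>\<^sub>E {-R..R}" "a < 2 ^ L"
    using assms(1) unfolding S_def by auto
  obtain z d where cz: "c = (z, d)" "z \<in> {..<k} \<rightarrow>\<^sub>E {0..1}" "d < 2 ^ L"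
    using assms(2) unfolding \<Gamma>_def by (cases c) simp
  define y where "y i = image_regs v b z i + u i" for i
  have "y i div 2 \<in> {-R..R}" if "i < k" for i
  proof -
    have "u i \<in> {-R..R}" using t(3) that by (intro PiE_mem[of u "{..<k}"]) simp_all
    then have "-(2 * R) \<le> y i" "y i \<le> 2 * R"
      using abs_image_regs_le[OF t(2) that cz(2), of b] by (simp_all add: y_def abs_le_iff)
    then show ?thesis by simp linarith
  qed
  then have 1: "(\<lambda>i\<in>{..<k}. y i div 2) \<in> {..<k} \<rightarrow>\<^sub>E {-R..R}"
    by (intro restrict_PiE_iff[THEN iffD2]) blast
  have 2: "(\<lambda>i\<in>{..<k}. y i mod 2) \<in> {..<k} \<rightarrow>\<^sub>E {0..1}"
    by (intro restrict_PiE_iff[THEN iffD2]) (auto simp: mod2_le_1)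
  have "\<delta> s c = (Some (v, b, \<lambda>i\<in>{..<k}. y i div 2, (mult v b * d + a) div 2 ^ L),
      (\<lambda>i\<in>{..<k}. y i mod 2, (mult v b * d + a) mod 2 ^ L))"
    by (simp add: Some t(1) cz(1) Let_def y_def)
  moreover have "Some (v, b, \<lambda>i\<in>{..<k}. y i div 2, (mult v b * d + a) div 2 ^ L) \<in> S"
    unfolding S_def by (intro insertI2 imageI SigmaI t(2) 1 UNIV_I) (use mult_carry[OF t(2) cz(3) t(4)] in simp)
  moreover have "(\<lambda>i\<in>{..<k}. y i mod 2, (mult v b * d + a) mod 2 ^ L) \<in> \<Gamma>"
    unfolding \<Gamma>_def by (intro SigmaI 2) simp
  ultimately show ?thesis by simp
qed

lemma fin_in:
  assumes "s \<in> S"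
  shows "fin s \<in> S \<times> \<Gamma>"
proof (cases s)
  case None
  have "Some (v0, False, zeros, 0) \<in> S"
    unfolding S_def by (intro insertI2 imageI SigmaI v0 zeros_in UNIV_I) simp
  moreover have "(zeros, 2 ^ D) \<in> \<Gamma>"
    unfolding \<Gamma>_def by (intro SigmaI zeros_in) (use D in simp)
  ultimately show ?thesis using None by simp
next
  case (Some t)
  then obtain v b u a where t: "t = (v, b, u, a)" "a < 2 ^ L"
    using assms unfolding S_def by auto
  have "Some (clip y, False, zeros, 0) \<in> S" for y
    unfolding S_def by (intro insertI2 imageI SigmaI clip zeros_in UNIV_I) simp
  moreover have "(\<lambda>i\<in>{..<k}. y i mod 2, a) \<in> \<Gamma>" for y
    unfolding \<Gamma>_def by (intro SigmaI restrict_PiE_iff[THEN iffD2]) (auto simp: mod2_le_1 t)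
  ultimately show ?thesis by (simp add: Some t(1) Let_def)
qed

lemma start_in:
  assumes "s \<in> S"
  shows "start s b \<in> S"
proof (cases s)
  case None
  then show ?thesis by (simp add: S_def)
next
  case (Some t)
  then obtain v b' u a where t: "t = (v, b', u, a)" "v \<in> V"
    using assms unfolding S_def by auto
  have "Some (v, b, zeros, 0) \<in> S"
    unfolding S_def by (intro insertI2 imageI SigmaI t(2) zeros_in UNIV_I) simp
  then show ?thesis by (simp add: Some t(1))
qed

lemma finite_S: "finite S" and finite_\<Gamma>: "finite \<Gamma>"
  unfolding S_def \<Gamma>_def using finite_V
  by (intro finite.insertI finite_imageI finite_cartesian_product finite_PiE finite_UNIV; simp)+

sublocale sweep_machine S \<Gamma> None start \<delta> fin digits L D
  by unfold_locales
    (use D in \<open>simp_all add: finite_S finite_\<Gamma> start_in \<delta>_in fin_in digits_def, simp add: S_def\<close>)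

section \<open>Correctness of the sweeps\<close>

definition low_part :: "cell list \<Rightarrow> nat \<Rightarrow> int" where
  "low_part w i = horner_sum (\<lambda>c. fst c i) 2 w"

definition number :: "cell list \<Rightarrow> nat" where
  "number w = horner_sum snd (2 ^ L) w"

lemma image_regs_cong: "(\<And>l. l < k \<Longrightarrow> x l = x' l) \<Longrightarrow> image_regs v b x = image_regs v b x'"
  unfolding image_regs_def by (intro ext sum.cong) auto

lemma image_regs_add_mult:
  "image_regs v b (\<lambda>l. x l + c * x' l) i = image_regs v b x i + c * image_regs v b x' i"
  unfolding image_regs_def by (simp add: algebra_simps sum.distrib sum_distrib_left)

text \<open>Linearity lets the lowest digits be split off: the image of \<open>z + 2 * x\<close> is
  that of \<open>z\<close> plus twice that of \<open>x\<close>. The first part together with the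
  incoming carry yields one digit and, after halving, the carry for the remaining cells. The
  induction therefore runs over arbitrary carries \<open>u\<close> and \<open>a\<close>.\<close>

lemma sweep_registers:
  fixes b :: bool
  assumes "v \<in> V"
  defines "y \<equiv> \<lambda>w u i. image_regs v b (\<lambda>l. low_part w l + 2 ^ length w * v l) i + u i"
  shows "fst (sweep \<delta> fin (Some (v, b, u, a)) w) =
           Some (clip (\<lambda>i\<in>{..<k}. y w u i div 2 ^ Suc (length w)), False, zeros, 0) \<and>
    (\<forall>i<k. low_part (snd (sweep \<delta> fin (Some (v, b, u, a)) w)) i = y w u i mod 2 ^ Suc (length w)) \<and>
    number (snd (sweep \<delta> fin (Some (v, b, u, a)) w)) = mult v b * number w + a"
proof (induction w arbitrary: u a)
  case Nil
  show ?case by (simp add: y_def low_part_def number_def Let_def restrict_def)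
next
  case (Cons c w)
  obtain z d where c: "c = (z, d)" by fastforce
  define u' where "u' = (\<lambda>i\<in>{..<k}. (image_regs v b z i + u i) div 2)"
  define a' where "a' = (mult v b * d + a) div 2 ^ L"
  have \<delta>: "\<delta> (Some (v, b, u, a)) c = (Some (v, b, u', a'),
      (\<lambda>i\<in>{..<k}. (image_regs v b z i + u i) mod 2, (mult v b * d + a) mod 2 ^ L))"
    by (simp add: c u'_def a'_def Let_def)
  have y: "y (c # w) u i = 2 * y w u' i + (image_regs v b z i + u i) mod 2" if "i < k" for i
  proof -
    have "(\<lambda>l. low_part (c # w) l + 2 ^ length (c # w) * v l) =
        (\<lambda>l. z l + 2 * (low_part w l + 2 ^ length w * v l))"
      by (auto simp: low_part_def c algebra_simps)
    then have "y (c # w) u i = image_regs v b z i + u i + 2 * image_regs v b (\<lambda>l. low_part w l + 2 ^ length w * v l) i"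
      unfolding y_def by (simp only: image_regs_add_mult)
    also have "image_regs v b z i + u i = 2 * u' i + (image_regs v b z i + u i) mod 2"
      using that by (simp add: u'_def)
    finally show ?thesis by (simp add: y_def algebra_simps)
  qed
  have y_div: "y (c # w) u i div (2 * 2 ^ n) = y w u' i div 2 ^ n" if "i < k" for i n
    unfolding y[OF that] by (subst zdiv_zmult2_eq) simp_all
  have y_mod: "y (c # w) u i mod (2 * 2 ^ n) = (image_regs v b z i + u i) mod 2 + 2 * (y w u' i mod 2 ^ n)"
    if "i < k" for i n
    unfolding y[OF that] by (subst zmod_zmult2_eq) simp_all
  have "(\<lambda>i\<in>{..<k}. y (c # w) u i div 2 ^ Suc (length (c # w))) = (\<lambda>i\<in>{..<k}. y w u' i div 2 ^ Suc (length w))"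
    by (intro restrict_ext) (use y_div[of _ "Suc (length w)"] in \<open>simp add: mult.assoc\<close>)
  moreover have "low_part (snd (sweep \<delta> fin (Some (v, b, u, a)) (c # w))) i = y (c # w) u i mod 2 ^ Suc (length (c # w))"
    if "i < k" for i
    using Cons[of u' a'] y_mod[OF that, of "Suc (length w)"] that by (simp add: \<delta> low_part_def)
  moreover have "number (snd (sweep \<delta> fin (Some (v, b, u, a)) (c # w))) = mult v b * number (c # w) + a"
  proof -
    have "number (snd (sweep \<delta> fin (Some (v, b, u, a)) (c # w))) =
        (mult v b * d + a) mod 2 ^ L + 2 ^ L * (mult v b * number w + a')"
      using Cons[of u' a'] by (simp add: \<delta> number_def)
    also have "\<dots> = ((mult v b * d + a) mod 2 ^ L + 2 ^ L * a') + mult v b * (2 ^ L * number w)"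
      by (simp add: distrib_left mult.left_commute)
    also have "(mult v b * d + a) mod 2 ^ L + 2 ^ L * a' = mult v b * d + a"
      by (simp add: a'_def)
    also have "\<dots> + mult v b * (2 ^ L * number w) = mult v b * number (c # w) + a"
      by (simp add: number_def c distrib_left)
    finally show ?thesis .
  qed
  ultimately show ?case using Cons[of u' a'] by (simp add: \<delta> del: power_Suc)
qed

lemma run_exec:
  assumes "exec \<sigma> = (v, lo, m)"
  shows "fst (run \<sigma>) = Some (v, False, zeros, 0) \<and> v \<in> V \<and>
    (\<forall>i<k. low_part (snd (run \<sigma>)) i = lo i) \<and> number (snd (run \<sigma>)) = m"
  using assms
proof (induction \<sigma> arbitrary: v lo m)
  case Nil
  then have "v = v0" "lo = (\<lambda>_. 0)" "m = 2 ^ D" by simp_all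
  then show ?case using v0 by (simp add: low_part_def number_def zeros_def restrict_def)
next
  case (Cons b \<sigma>)
  obtain v' lo' m' where e: "exec \<sigma> = (v', lo', m')" by (metis prod_cases3)
  obtain s w where r: "run \<sigma> = (s, w)" by fastforce
  have w: "length w = Suc (length \<sigma>)" using length_run[of \<sigma>] r by simp
  note IH = Cons.IH[OF e, unfolded r]
  define y where "y = image_regs v' b (\<lambda>l. lo' l + 2 ^ Suc (length \<sigma>) * v' l)"
  have v': "v' \<in> V" and s: "s = Some (v', False, zeros, 0)" using IH by simp_all
  have "image_regs v' b (\<lambda>l. low_part w l + 2 ^ length w * v' l) = y"
    unfolding y_def using IH w by (intro image_regs_cong) simp
  then have lw: "y = image_regs v' b (\<lambda>l. low_part w l + 2 ^ Suc (length \<sigma>) * v' l)"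
    unfolding w by (rule sym)
  note sw = sweep_registers[OF v', where b = b and u = zeros and a = 0 and w = w, unfolded w, folded lw]
  have z: "y i + zeros i = y i" if "i < k" for i
    using that by (simp add: zeros_def)
  have "exec (b # \<sigma>) = (clip (\<lambda>i\<in>{..<k}. y i div 2 ^ Suc (Suc (length \<sigma>))),
      \<lambda>i. y i mod 2 ^ Suc (Suc (length \<sigma>)), mult v' b * m')"
    by (simp add: e y_def Let_def)
  then have vlm: "v = clip (\<lambda>i\<in>{..<k}. y i div 2 ^ Suc (Suc (length \<sigma>)))"
      "lo = (\<lambda>i. y i mod 2 ^ Suc (Suc (length \<sigma>)))" "m = mult v' b * m'"
    using Cons.prems by simp_all
  have run: "run (b # \<sigma>) = sweep \<delta> fin (Some (v', b, zeros, 0)) w"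
    by (simp add: r s)
  have c: "(\<lambda>i\<in>{..<k}. (y i + zeros i) div 2 ^ Suc (Suc (length \<sigma>))) =
      (\<lambda>i\<in>{..<k}. y i div 2 ^ Suc (Suc (length \<sigma>)))"
    by (intro restrict_ext) (simp add: z)
  show ?case
    unfolding run vlm using sw c z clip IH by (simp del: power_Suc)
qed

lemma output_number: "horner_sum of_bool 2 (output_bits \<sigma>) = snd (snd (exec (rev \<sigma>)))"
proof -
  have "horner_sum of_bool 2 (concat (map digits w)) = number w" if "set w \<subseteq> \<Gamma>" for w
    using that
  proof (induction w)
    case Nil
    then show ?case by (simp add: number_def)
  next
    case (Cons c w)
    have "horner_sum of_bool 2 (digits c) = snd c"
      using Cons.prems unfolding digits_def horner_sum_bit_eq_take_bit
      by (auto simp: \<Gamma>_def take_bit_nat_eq_self)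
    then show ?case using Cons by (simp add: number_def horner_sum_append digits_def)
  qed
  moreover obtain v lo m where "exec (rev \<sigma>) = (v, lo, m)" by (metis prod_cases3)
  ultimately show ?thesis using run_in[of "rev \<sigma>"] run_exec[of "rev \<sigma>"]
    by (auto simp: output_bits_def)
qed

definition capital :: "bool list \<Rightarrow> real" where
  "capital \<sigma> = real (snd (snd (exec (rev \<sigma>)))) / 2 ^ (D * Suc (length \<sigma>))"

lemma polynomial_time_computable_capital: "polynomial_time_computable capital"
  using polynomial_time_computable_output unfolding output_number capital_def .

lemma capital_Nil: "capital [] = 1"
  by (simp add: capital_def)

lemma capital_snoc:
  "capital (\<sigma> @ [b]) = capital \<sigma> * (real (mult (fst (exec (rev \<sigma>))) b) / 2 ^ D)"
  by (simp add: capital_def Let_def power_add mult_ac split: prod.splits)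

end

section \<open>Traces of powers of a Pisot number\<close>

lemma map_poly_mult_hom:
  fixes h :: "'a :: comm_ring_1 \<Rightarrow> 'b :: comm_ring_1"
  assumes [simp]: "h 0 = 0" and add: "\<And>a b. h (a + b) = h a + h b" and mult: "\<And>a b. h (a * b) = h a * h b"
  shows "map_poly h (p * q) = map_poly h p * map_poly h q"
proof (rule poly_eqI)
  have sum: "h (sum f A) = (\<Sum>i\<in>A. h (f i))" for f :: "nat \<Rightarrow> 'a" and A
    by (induction A rule: infinite_finite_induct) (auto simp: add)
  show "coeff (map_poly h (p * q)) n = coeff (map_poly h p * map_poly h q) n" for n
    by (simp add: coeff_map_poly coeff_mult sum mult)
qed

lemma map_poly_of_rat_mult:
  "map_poly (of_rat :: rat \<Rightarrow> 'a :: field_char_0) (p * q) = map_poly of_rat p * map_poly of_rat q"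
  by (rule map_poly_mult_hom) (auto simp: of_rat_add of_rat_mult)

lemma map_poly_of_rat_add:
  "map_poly (of_rat :: rat \<Rightarrow> 'a :: field_char_0) (p + q) = map_poly of_rat p + map_poly of_rat q"
  by (rule poly_eqI) (simp add: coeff_map_poly of_rat_add)

lemma clear_denominators:
  fixes p :: "rat poly"
  obtains a P where "a \<noteq> 0" "smult (of_int a) p = map_poly of_int P"
proof (induction p arbitrary: thesis)
  case 0
  show ?case by (rule 0[of 1 0]) auto
next
  case (pCons c p)
  obtain a P where aP: "a \<noteq> 0" "smult (of_int a) p = map_poly of_int P"
    using pCons.IH by blast
  obtain m n where c: "c = of_int m / of_int n" "n \<noteq> 0"
    by (metis Rat_cases Fract_of_int_quotient less_numeral_extra(3))
  show ?case
  proof (rule pCons.prems)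
    show "a * n \<noteq> 0" using aP c by simp
    have "map_poly of_int (smult n P) = smult (of_int n :: rat) (map_poly of_int P)"
      by (rule poly_eqI) (simp add: coeff_map_poly)
    then show "smult (of_int (a * n)) (pCons c p) = map_poly of_int (pCons (a * m) (smult n P))"
      using c by (simp add: map_poly_pCons flip: aP(2)) (simp add: mult.commute)
  qed
qed

text \<open>Gauss's lemma through contents. Clearing denominators gives \<open>P\<close> and
  \<open>Q\<close> with leading coefficients \<open>a\<close> and \<open>b\<close>, so their
  contents divide \<open>a\<close> and \<open>b\<close>; as \<open>f\<close> is primitive, the
  product of the contents is \<open>\<bar>a * b\<bar>\<close>. Hence \<open>a\<close> divides every
  coefficient of \<open>P\<close>.\<close>

lemma monic_factor_integral:
  fixes p q :: "rat poly" and f :: "int poly"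
  assumes pq: "p * q = map_poly of_int f" and p: "lead_coeff p = 1" and f: "lead_coeff f = 1"
  obtains P where "p = map_poly of_int P"
proof -
  obtain a P where P: "a \<noteq> 0" "smult (of_int a) p = map_poly of_int P" by (rule clear_denominators)
  obtain b Q where Q: "b \<noteq> 0" "smult (of_int b) q = map_poly of_int Q" by (rule clear_denominators)
  have deg: "degree (map_poly of_int r :: rat poly) = degree r" for r
    by (rule degree_map_poly) simp
  have lead: "lead_coeff (map_poly of_int r :: rat poly) = of_int (lead_coeff r)" for r
    by (simp add: deg coeff_map_poly)
  have q: "lead_coeff q = 1" using arg_cong[OF pq, of lead_coeff] p f unfolding lead_coeff_mult lead by simp
  have "lead_coeff (smult (of_int a) p) = of_int (lead_coeff P)" unfolding P(2) lead ..
  then have lP: "lead_coeff P = a" using p P(1) by simp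
  have "lead_coeff (smult (of_int b) q) = of_int (lead_coeff Q)" unfolding Q(2) lead ..
  then have lQ: "lead_coeff Q = b" using q Q(1) by simp
  have "map_poly of_int (P * Q) = (smult (of_int a) p * smult (of_int b) q :: rat poly)"
    unfolding P(2) Q(2) by (rule map_poly_mult_hom) auto
  also have "\<dots> = smult (of_int (a * b)) (map_poly of_int f)"
    by (simp add: mult.commute flip: pq)
  also have "\<dots> = map_poly of_int (smult (a * b) f)"
    by (rule poly_eqI) (simp add: coeff_map_poly)
  finally have PQ: "P * Q = smult (a * b) f"
    by (simp add: poly_eq_iff coeff_map_poly flip: of_int_mult)
  have "content f dvd 1" using content_dvd_coeff[of f "degree f"] f by simp
  then have "content f = 1" by (metis content_1 is_unit_normalize normalize_content)
  then have "content P * content Q = \<bar>a * b\<bar>"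
    using arg_cong[OF PQ, of content] by (simp add: content_mult)
  moreover have "content P dvd a" "content Q dvd b"
    using content_dvd_coeff[of P "degree P"] content_dvd_coeff[of Q "degree Q"] lP lQ by simp_all
  ultimately have a: "a dvd content P"
  proof -
    obtain c d where cd: "a = content P * c" "b = content Q * d"
      using \<open>content P dvd a\<close> \<open>content Q dvd b\<close> by (auto elim!: dvdE)
    have "\<bar>content P * content Q\<bar> * \<bar>c * d\<bar> = \<bar>a * b\<bar>"
      unfolding cd by (simp add: abs_mult mult_ac)
    then have "\<bar>a * b\<bar> * \<bar>c * d\<bar> = \<bar>a * b\<bar>"
      using \<open>content P * content Q = \<bar>a * b\<bar>\<close> by simp
    then have "\<bar>c * d\<bar> = 1" using P(1) Q(1) by simp
    then have "\<bar>c\<bar> = 1" using abs_zmult_eq_1 by blast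
    then have "c = 1 \<or> c = -1" by linarith
    then have "c * c = 1" by auto
    then have "content P = a * c" unfolding cd by (simp add: mult.assoc)
    then show ?thesis by simp
  qed
  have "p = map_poly of_int (map_poly (\<lambda>x. x div a) P)"
  proof (rule poly_eqI)
    fix i
    have "a dvd coeff P i" using a content_dvd_coeff dvd_trans by blast
    moreover have "of_int a * coeff p i = of_int (coeff P i)"
      using arg_cong[OF P(2), of "\<lambda>r. coeff r i"] by (simp add: coeff_map_poly)
    ultimately show "coeff p i = coeff (map_poly of_int (map_poly (\<lambda>x. x div a) P)) i"
      using P(1) by (auto simp: coeff_map_poly elim!: dvdE)
  qed
  then show thesis by (rule that)
qed

text \<open>A monic rational annihilator of least degree divides the integer polynomial that
  witnesses the integrality of \<beta>, and so it is integral by Gauss's lemma.\<close>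

lemma minimal_polynomial_exists:
  assumes "algebraic_int (\<beta> :: real)"
  obtains P :: "int poly" where "minimal_polynomial \<beta> (map_poly of_int P)"
proof -
  obtain f :: "int poly" where f: "poly (map_poly of_int f) \<beta> = 0" "lead_coeff f = 1"
    using assms unfolding algebraic_int_altdef_ipoly by blast
  define F :: "rat poly" where "F = map_poly of_int f"
  have mF: "map_poly of_rat F = (map_poly of_int f :: real poly)"
    by (rule poly_eqI) (simp add: F_def coeff_map_poly)
  define root where "root q \<longleftrightarrow> q \<noteq> 0 \<and> poly (map_poly of_rat q) \<beta> = 0" for q :: "rat poly"
  have "F \<noteq> 0" using f(2) by (auto simp: F_def poly_eq_iff coeff_map_poly intro!: exI[of _ "degree f"])
  then have "root F" using f(1) by (simp add: root_def mF)
  then obtain q where q: "root q" "\<And>r. root r \<Longrightarrow> degree q \<le> degree r"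
    using exists_least_iff[of "\<lambda>n. \<exists>q. root q \<and> degree q = n"] by (metis not_le_imp_less)
  define p where "p = smult (inverse (lead_coeff q)) q"
  have p: "lead_coeff p = 1" using q(1) by (simp add: p_def root_def)
  have "p \<noteq> 0" using p by auto
  have "map_poly of_rat p = (smult (of_rat (inverse (lead_coeff q))) (map_poly of_rat q) :: real poly)"
    by (rule poly_eqI) (simp add: p_def coeff_map_poly of_rat_mult)
  then have rp: "poly (map_poly of_rat p) \<beta> = 0" using q(1) by (simp add: root_def)
  have min: "minimal_polynomial \<beta> p"
    unfolding minimal_polynomial_def using p rp q by (auto simp: root_def p_def)
  have "F mod p = 0"
  proof (rule ccontr)
    assume ne: "F mod p \<noteq> 0"
    have "map_poly of_rat F = (map_poly of_rat p * map_poly of_rat (F div p) + map_poly of_rat (F mod p) :: real poly)"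
      by (simp flip: map_poly_of_rat_mult map_poly_of_rat_add)
    then have "poly (map_poly of_rat (F mod p)) \<beta> = 0"
      using rp f(1) mF by simp
    then have "degree p \<le> degree (F mod p)"
      using min ne unfolding minimal_polynomial_def by blast
    then show False using degree_mod_less'[OF \<open>p \<noteq> 0\<close> ne] by simp
  qed
  then have "p * (F div p) = map_poly of_int f"
    unfolding F_def[symmetric] by (simp add: mod_0_imp_dvd)
  then obtain P where "p = map_poly of_int P"
    using monic_factor_integral p f(2) by blast
  then show thesis using that min by simp
qed

section \<open>Newton's identities and traces\<close>

lemma fps_deriv_prod_linear:
  fixes R :: "complex multiset"
  defines "F \<equiv> (\<Prod>z\<in>#R. 1 - fps_const z * fps_X)"
  shows "fps_deriv F = - F * Abs_fps (\<lambda>m. \<Sum>z\<in>#R. z ^ Suc m)"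
  unfolding F_def
proof (induction R)
  case empty
  show ?case by (simp add: fps_eq_iff fps_mult_nth)
next
  case (add z R)
  let ?F = "\<Prod>z\<in>#R. 1 - fps_const z * fps_X" and ?S = "Abs_fps (\<lambda>m. \<Sum>z\<in>#R. z ^ Suc m)"
  \<comment> \<open>The geometric series \<open>z / (1 - z * X)\<close>, which is minus the
    logarithmic derivative of one factor; the logarithmic derivative turns the product into a
    sum.\<close>
  let ?G = "Abs_fps (\<lambda>m. z ^ Suc m)"
  have G: "(1 - fps_const z * fps_X) * ?G = fps_const z"
    by (rule fps_ext) (simp add: left_diff_distrib mult.assoc fps_X_mult_nth power_eq_if)
  have S: "Abs_fps (\<lambda>m. \<Sum>w\<in>#add_mset z R. w ^ Suc m) = ?G + ?S"
    by (rule fps_ext) simp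
  have "fps_deriv ((1 - fps_const z * fps_X) * ?F) = - fps_const z * ?F + (1 - fps_const z * fps_X) * (- ?F * ?S)"
    by (simp add: add)
  also have "\<dots> = - ((1 - fps_const z * fps_X) * ?F) * (?G + ?S)"
    by (subst (1) G[symmetric]) (simp add: algebra_simps)
  finally show ?case unfolding S by simp
qed

text \<open>Newton's identities: comparing coefficients in the formula for the derivative expresses
  \<open>S n\<close> by earlier power sums. The constant coefficient of \<open>F\<close> is 1, so no
  division occurs and integrality is inherited.\<close>

lemma power_sums_integral:
  fixes R :: "complex multiset"
  assumes "\<And>i. coeff (\<Prod>z\<in>#R. [:-z, 1:]) i \<in> \<int>"
  shows "(\<Sum>z\<in>#R. z ^ m) \<in> \<int>"
proof (cases m)
  case 0
  then show ?thesis by simp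
next
  case (Suc n)
  define F :: "complex fps" where "F = (\<Prod>z\<in>#R. 1 - fps_const z * fps_X)"
  \<comment> \<open>The factors of \<open>F\<close> are the reversed polynomials
    \<open>X - z\<close>, so its coefficients are the given integers in reverse order.\<close>
  have "F = fps_of_poly (reflect_poly (\<Prod>z\<in>#R. [:-z, 1:]))"
    unfolding F_def
  proof (induction R)
    case (add z R)
    have "reflect_poly [:-z, 1:] = [:1, -z:]"
      by (rule poly_eqI) (auto simp: coeff_reflect_poly coeff_pCons split: nat.splits)
    then show ?case by (simp only: image_mset_add_mset prod_mset.add_mset reflect_poly_mult fps_of_poly_mult add)
        (simp add: fps_of_poly_pCons algebra_simps)
  qed simp
  then have F: "fps_nth F i \<in> \<int>" for i
    using assms by (simp add: coeff_reflect_poly)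
  have F0: "fps_nth F 0 = 1" unfolding F_def by (induction R) simp_all
  define S where "S = (\<lambda>n. \<Sum>z\<in>#R. z ^ Suc n)"
  have deriv: "fps_deriv F = - F * Abs_fps S"
    unfolding F_def S_def by (rule fps_deriv_prod_linear)
  have "S n \<in> \<int>" for n
  proof (induction n rule: less_induct)
    case (less n)
    have "- (of_nat (Suc n) * fps_nth F (Suc n)) = fps_nth (F * Abs_fps S) n"
      using arg_cong[OF deriv, of "\<lambda>G. fps_nth G n"] by simp
    also have "\<dots> = (\<Sum>i=0..n. fps_nth F i * S (n - i))" by (simp add: fps_mult_nth)
    also have "\<dots> = S n + (\<Sum>i=Suc 0..n. fps_nth F i * S (n - i))"
      by (subst sum.atLeast_Suc_atMost) (simp_all add: F0)
    finally have "S n = - (of_nat (Suc n) * fps_nth F (Suc n)) - (\<Sum>i=Suc 0..n. fps_nth F i * S (n - i))"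
      by (simp add: algebra_simps)
    moreover have "(\<Sum>i=Suc 0..n. fps_nth F i * S (n - i)) \<in> \<int>"
      using less F by (intro Ints_sum Ints_mult) auto
    moreover have "of_nat (Suc n) * fps_nth F (Suc n) \<in> \<int>" using F by (intro Ints_mult) auto
    ultimately show ?case by (simp only:) (intro Ints_diff Ints_minus; assumption)
  qed
  then show ?thesis by (simp only: Suc S_def)
qed

text \<open>\<open>t m\<close> is the sum of the \<open>m\<close>-th powers of all roots of the
  minimal polynomial. Newton's identities make it an integer, the polynomial gives the recurrence,
  and without the summand \<open>\<beta> ^ m\<close> only powers of numbers inside the unit disc
  remain.\<close>

lemma pisot_traces:
  assumes "pisot \<beta>"
  obtains t :: "nat \<Rightarrow> int" and d :: nat and c :: "nat \<Rightarrow> int"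
  where "d > 0" "\<And>m. t (m + d) = (\<Sum>l<d. c l * t (m + l))" "(\<lambda>m. of_int (t m) - \<beta> ^ m) \<longlonglongrightarrow> 0"
proof -
  obtain P :: "int poly" where P: "minimal_polynomial \<beta> (map_poly of_int P)"
    using minimal_polynomial_exists assms unfolding pisot_def by blast
  define p :: "rat poly" where "p = map_poly of_int P"
  note P = P[folded p_def]
  have degp: "degree p = degree P" unfolding p_def by (rule degree_map_poly) simp
  have lp: "coeff P (degree P) = 1"
    using P unfolding minimal_polynomial_def degp by (simp add: p_def coeff_map_poly)
  define Q :: "complex poly" where "Q = map_poly of_int P"
  have Qp: "map_poly of_rat p = Q" by (rule poly_eqI) (simp add: Q_def p_def coeff_map_poly)
  have degQ: "degree Q = degree P" unfolding Q_def by (rule degree_map_poly) simp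
  have Q1: "lead_coeff Q = 1" using lp unfolding degQ by (simp add: Q_def coeff_map_poly)
  then have "Q \<noteq> 0" by auto
  have of_rat: "(of_rat r :: complex) = of_real (of_rat r)" for r
    by (cases r) (simp add: of_rat_rat)
  have of_real: "poly (map_poly of_rat q) (of_real x :: complex) = of_real (poly (map_poly of_rat q) x)"
    for q :: "rat poly" and x :: real
    by (simp add: poly_altdef degree_map_poly coeff_map_poly of_rat)
  have Q\<beta>: "poly Q (of_real \<beta>) = 0"
    using P unfolding Qp[symmetric] of_real minimal_polynomial_def by simp
  have small: "poly Q z = 0 \<Longrightarrow> z \<noteq> of_real \<beta> \<Longrightarrow> norm z < 1" for z
    using assms P unfolding pisot_def Qp[symmetric] by blast
  have pos: "degree P > 0"
  proof (rule ccontr)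
    assume "\<not> degree P > 0"
    then obtain a where "Q = [:a:]" using degQ by (metis degree_eq_zeroE not_gr0)
    then show False using Q\<beta> Q1 by simp
  qed
  \<comment> \<open>A multiple root would be a root of the derivative, a nonzero rational polynomial
    of smaller degree. Simplicity is what makes \<beta> absent from the remaining roots
    \<open>R'\<close>.\<close>
  have "order (of_real \<beta>) Q = 1"
  proof (rule ccontr)
    assume ne: "order (of_real \<beta>) Q \<noteq> 1"
    then have "order (of_real \<beta>) Q \<ge> 2"
      using Q\<beta> \<open>Q \<noteq> 0\<close> order_root[of Q "of_real \<beta>"] by simp
    then have "[:- of_real \<beta>, 1:] ^ 2 dvd Q" by (simp add: order_divides)
    then obtain q where "Q = [:- of_real \<beta>, 1:] ^ 2 * q" by (elim dvdE)
    then have "Q = [:- of_real \<beta>, 1:] * ([:- of_real \<beta>, 1:] * q)"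
      by (simp only: power2_eq_square mult.assoc)
    then have "poly (pderiv Q) (of_real \<beta>) = 0"
      by (simp only: pderiv_mult poly_add poly_mult) simp
    moreover have "pderiv Q = map_poly of_rat (pderiv p)"
      by (rule poly_eqI) (simp add: coeff_pderiv coeff_map_poly of_rat_mult of_rat_add flip: Qp)
    ultimately have "poly (map_poly of_rat (pderiv p)) \<beta> = 0"
      using of_real[of "pderiv p" \<beta>] by simp
    moreover have "pderiv p \<noteq> 0" using pos degp by (simp add: pderiv_eq_0_iff)
    ultimately have "degree p \<le> degree (pderiv p)"
      using P unfolding minimal_polynomial_def by blast
    then show False using pos degp by (simp add: degree_pderiv)
  qed
  define R where "R = proots Q"
  have prod: "(\<Prod>z\<in>#R. [:-z, 1:]) = Q"
    using complex_poly_decompose_multiset[of Q] Q1 by (simp add: R_def)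
  have "(\<Sum>z\<in>#R. z ^ m) \<in> \<int>" for m
    by (rule power_sums_integral) (simp add: prod Q_def coeff_map_poly)
  then have "\<forall>m. \<exists>k. (\<Sum>z\<in>#R. z ^ m) = of_int k" by (auto elim!: Ints_cases)
  then obtain t where t: "(\<Sum>z\<in>#R. z ^ m) = of_int (t m)" for m by metis
  show thesis
  proof (rule that)
    show "degree P > 0" by (rule pos)
  next
    fix m
    have "(\<Sum>z\<in>#R. z ^ (m + degree P)) = (\<Sum>z\<in>#R. \<Sum>l<degree P. of_int (- coeff P l) * z ^ (m + l))"
    proof (intro arg_cong[where f = sum_mset] image_mset_cong)
      fix z assume "z \<in># R"
      then have "poly Q z = 0" using \<open>Q \<noteq> 0\<close> by (simp add: R_def)
      then have "0 = z ^ m * (\<Sum>l\<le>degree P. of_int (coeff P l) * z ^ l)"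
        by (simp add: poly_altdef Q_def coeff_map_poly degQ[unfolded Q_def])
      also have "\<dots> = z ^ (m + degree P) + (\<Sum>l<degree P. of_int (coeff P l) * z ^ (m + l))"
        by (simp add: lessThan_Suc_atMost[symmetric] lp algebra_simps sum_distrib_left power_add)
      finally show "z ^ (m + degree P) = (\<Sum>l<degree P. of_int (- coeff P l) * z ^ (m + l))"
        by (simp add: sum_negf eq_neg_iff_add_eq_0)
    qed
    also have "\<dots> = (\<Sum>l<degree P. of_int (- coeff P l) * (\<Sum>z\<in>#R. z ^ (m + l)))"
    proof (induction R)
      case (add x R)
      then show ?case by (simp only: image_mset_add_mset sum_mset.add_mset distrib_left sum.distrib)
    qed simp
    finally have "(of_int (t (m + degree P)) :: complex) = of_int (\<Sum>l<degree P. - coeff P l * t (m + l))"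
      unfolding t by simp
    then show "t (m + degree P) = (\<Sum>l<degree P. - coeff P l * t (m + l))"
      by (simp only: of_int_eq_iff)
  next
    have "of_real \<beta> \<in># R" using Q\<beta> \<open>Q \<noteq> 0\<close> by (simp add: R_def)
    then obtain R' where R': "R = add_mset (of_real \<beta>) R'" by (metis multi_member_split)
    have "count R (of_real \<beta>) = 1" using \<open>order _ Q = 1\<close> \<open>Q \<noteq> 0\<close> by (simp add: R_def)
    then have "of_real \<beta> \<notin># R'" unfolding R' by (simp add: not_in_iff)
    have "\<forall>z\<in>#R'. norm z < 1"
    proof (intro ballI small)
      fix z assume "z \<in># R'"
      then have "z \<in># R" unfolding R' by simp
      then show "poly Q z = 0" using \<open>Q \<noteq> 0\<close> by (simp add: R_def)
      show "z \<noteq> of_real \<beta>" using \<open>z \<in># R'\<close> \<open>of_real \<beta> \<notin># R'\<close> by blast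
    qed
    then have "(\<lambda>m. \<Sum>z\<in>#R'. z ^ m) \<longlonglongrightarrow> 0"
    proof (induction R')
      case (add z R')
      then have "(\<lambda>m. z ^ m + (\<Sum>z\<in>#R'. z ^ m)) \<longlonglongrightarrow> 0 + 0"
        by (intro tendsto_add LIMSEQ_power_zero) auto
      then show ?case by simp
    qed simp
    moreover have "(\<Sum>z\<in>#R'. z ^ m) = of_real (of_int (t m) - \<beta> ^ m)" for m
      using t[of m] by (simp add: R' algebra_simps)
    ultimately have "(\<lambda>m. complex_of_real (of_int (t m) - \<beta> ^ m)) \<longlonglongrightarrow> of_real 0" by simp
    then show "(\<lambda>m. of_int (t m) - \<beta> ^ m) \<longlonglongrightarrow> 0" unfolding tendsto_of_real_iff .
  qed
qed

section \<open>Conditional probabilities of a visit\<close>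

text \<open>A primitive of the indicator function of \<open>\<Union>j. {j..j + \<alpha>}\<close> (\<open>j\<close> an integer), for \<open>0 \<le> \<alpha> \<le> 1\<close>.\<close>

definition ramp :: "real \<Rightarrow> real \<Rightarrow> real" where
  "ramp \<alpha> y = \<alpha> * of_int \<lfloor>y\<rfloor> + min (frac y) \<alpha>"

text \<open>The proportion of the interval from \<open>u\<close> to \<open>u + s\<close> covered by
  the arcs, that is, the conditional probability of a visit for a uniform point of the
  interval.\<close>

definition hit_density :: "real \<Rightarrow> real \<Rightarrow> real \<Rightarrow> real" where
  "hit_density \<alpha> u s = (ramp \<alpha> (u + s) - ramp \<alpha> u) / s"

text \<open>Half the difference of the densities on the right and the left half of the interval: up
  to sign, the change of the conditional probability caused by the next bit.\<close>

definition bet :: "real \<Rightarrow> real \<Rightarrow> real \<Rightarrow> real" where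
  "bet \<alpha> u s = (ramp \<alpha> (u + s) - 2 * ramp \<alpha> (u + s / 2) + ramp \<alpha> u) / s"

lemma ramp_mono_lipschitz:
  assumes "0 \<le> \<alpha>" "\<alpha> \<le> 1" "x \<le> y"
  shows "ramp \<alpha> x \<le> ramp \<alpha> y" "ramp \<alpha> y - ramp \<alpha> x \<le> y - x"
proof -
  define k where "k = \<lfloor>y\<rfloor> - \<lfloor>x\<rfloor>"
  have k: "k \<ge> 0" using floor_mono[OF assms(3)] by (simp add: k_def)
  define fx fy where f: "fx = frac x" "fy = frac y"
  have xy: "x = of_int \<lfloor>x\<rfloor> + fx" "y = of_int \<lfloor>x\<rfloor> + of_int k + fy"
    by (simp_all add: f k_def frac_def)
  have fr: "0 \<le> fx" "fx < 1" "0 \<le> fy" "fy < 1" by (simp_all add: f frac_lt_1)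
  have diff: "ramp \<alpha> y - ramp \<alpha> x = \<alpha> * of_int k + min fy \<alpha> - min fx \<alpha>"
    by (simp add: f ramp_def k_def algebra_simps)
  have "0 \<le> \<alpha> * of_int k + min fy \<alpha> - min fx \<alpha> \<and>
    \<alpha> * of_int k + min fy \<alpha> - min fx \<alpha> \<le> of_int k + fy - fx"
  proof (cases "k = 0")
    case True
    then have "fx \<le> fy" using xy assms(3) by simp
    then show ?thesis using True assms by (auto simp: min_def)
  next
    case False
    then have "of_int k \<ge> (1 :: real)" using k by simp
    then have "\<alpha> * 1 \<le> \<alpha> * of_int k" "(1 - \<alpha>) * 1 \<le> (1 - \<alpha>) * of_int k"
      using assms by (intro mult_left_mono; simp)+
    then show ?thesis using fr assms by (auto simp: min_def algebra_simps)
  qed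
  then show "ramp \<alpha> x \<le> ramp \<alpha> y" "ramp \<alpha> y - ramp \<alpha> x \<le> y - x"
    using diff xy by linarith+
qed

lemma ramp_lipschitz: "0 \<le> \<alpha> \<Longrightarrow> \<alpha> \<le> 1 \<Longrightarrow> \<bar>ramp \<alpha> x - ramp \<alpha> y\<bar> \<le> \<bar>x - y\<bar>"
  using ramp_mono_lipschitz[of \<alpha> x y] ramp_mono_lipschitz[of \<alpha> y x] by linarith

text \<open>The mean slope over a period is \<alpha>, and the deviation within a period is at most
  1. This becomes the error \<open>1 / s\<close> in the density of a long interval.\<close>

lemma ramp_bounds:
  assumes "0 \<le> \<alpha>" "\<alpha> \<le> 1"
  shows "\<alpha> * y \<le> ramp \<alpha> y" "ramp \<alpha> y \<le> \<alpha> * y + 1"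
proof -
  define f where "f = frac y"
  have fr: "0 \<le> f" "f < 1" by (simp_all add: f_def frac_lt_1)
  have "\<alpha> * f \<le> 1 * f" "\<alpha> * f \<le> \<alpha> * 1" "0 \<le> \<alpha> * f"
    using fr assms by (intro mult_right_mono mult_left_mono mult_nonneg_nonneg; simp)+
  moreover have "\<alpha> * y = \<alpha> * of_int \<lfloor>y\<rfloor> + \<alpha> * f" by (simp add: f_def frac_def algebra_simps)
  ultimately show "\<alpha> * y \<le> ramp \<alpha> y" "ramp \<alpha> y \<le> \<alpha> * y + 1"
    using fr assms unfolding ramp_def f_def[symmetric] by linarith+
qed

lemma ramp_shift: "ramp \<alpha> (y + of_int j) = ramp \<alpha> y + \<alpha> * of_int j"
  by (simp add: ramp_def frac_def algebra_simps)

lemma ramp_inside: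
  assumes "0 \<le> \<alpha>" "\<alpha> \<le> 1" "of_int j \<le> y" "y \<le> of_int j + \<alpha>"
  shows "ramp \<alpha> y = \<alpha> * of_int j + (y - of_int j)"
proof (cases "y < of_int j + 1")
  case True
  then have "\<lfloor>y\<rfloor> = j" using assms(3) by (simp add: floor_eq_iff)
  then show ?thesis using assms by (simp add: ramp_def frac_def)
next
  case False
  then have "y = of_int (j + 1)" "\<alpha> = 1" using assms by auto
  then show ?thesis by (simp add: ramp_def)
qed

section \<open>Densities of visits and their increments\<close>

context
  fixes \<alpha> :: real
  assumes \<alpha>: "0 \<le> \<alpha>" "\<alpha> \<le> 1"
begin

lemma hit_density_bounds:
  assumes "s > 0"
  shows "0 \<le> hit_density \<alpha> u s" "hit_density \<alpha> u s \<le> 1" "hit_density \<alpha> u s \<le> \<alpha> + 1 / s"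
proof -
  show "0 \<le> hit_density \<alpha> u s" "hit_density \<alpha> u s \<le> 1"
    using ramp_mono_lipschitz[OF \<alpha>, of u "u + s"] assms by (simp_all add: hit_density_def)
  have "ramp \<alpha> (u + s) - ramp \<alpha> u \<le> \<alpha> * s + 1"
    using ramp_bounds[OF \<alpha>, of u] ramp_bounds[OF \<alpha>, of "u + s"] by (simp add: algebra_simps)
  then show "hit_density \<alpha> u s \<le> \<alpha> + 1 / s"
    using assms by (simp add: hit_density_def pos_divide_le_eq distrib_right)
qed

lemma hit_density_inside:
  assumes "s > 0" "of_int j \<le> u" "u + s \<le> of_int j + \<alpha>"
  shows "hit_density \<alpha> u s = 1"
  using ramp_inside[OF \<alpha>, of j u] ramp_inside[OF \<alpha>, of j "u + s"] assms by (simp add: hit_density_def)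

text \<open>The densities of the two halves average to that of the whole interval, so the
  conditional probability is itself a martingale, with increment \<open>bet\<close> up to
  sign.\<close>

lemma hit_density_halves:
  assumes "s > 0"
  shows "hit_density \<alpha> u (s / 2) = hit_density \<alpha> u s - bet \<alpha> u s"
    and "hit_density \<alpha> (u + s / 2) (s / 2) = hit_density \<alpha> u s + bet \<alpha> u s"
proof -
  have "u + s / 2 + s / 2 = u + s" by simp
  then show "hit_density \<alpha> u (s / 2) = hit_density \<alpha> u s - bet \<alpha> u s"
    and "hit_density \<alpha> (u + s / 2) (s / 2) = hit_density \<alpha> u s + bet \<alpha> u s"
    by (simp_all add: hit_density_def bet_def diff_divide_distrib add_divide_distrib mult.commute[of _ 2] add.commute[of s u])
qed

lemma abs_bet_le:
  assumes "s > 0"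
  shows "\<bar>bet \<alpha> u s\<bar> \<le> 1 / 2"
  using hit_density_halves[OF assms, of u] hit_density_bounds[of "s / 2" u] hit_density_bounds[of "s / 2" "u + s / 2"] assms
  by (simp add: abs_le_iff)

lemma bet_shift: "bet \<alpha> (u + of_int j) s = bet \<alpha> u s"
  using ramp_shift[of \<alpha> "u + s" j] ramp_shift[of \<alpha> "u + s / 2" j] ramp_shift[of \<alpha> u j]
  by (simp add: bet_def algebra_simps)

text \<open>The control knows position and scale only by their leading digits; this bounds the
  effect on the stake. The lower bound \<theta> controls the division by \<open>s\<close>.\<close>

lemma bet_lipschitz:
  assumes "\<theta> > 0" "s \<ge> \<theta>" "s' \<ge> \<theta>" "\<bar>u - u'\<bar> \<le> e" "\<bar>s - s'\<bar> \<le> e"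
  shows "\<bar>bet \<alpha> u s - bet \<alpha> u' s'\<bar> \<le> 7 * e / \<theta>"
proof -
  define N where "N u s = ramp \<alpha> (u + s) - 2 * ramp \<alpha> (u + s / 2) + ramp \<alpha> u" for u s
  have pos: "s > 0" "s' > 0" using assms by auto
  have "\<bar>ramp \<alpha> (u + s) - ramp \<alpha> (u' + s')\<bar> \<le> 2 * e"
    using ramp_lipschitz[OF \<alpha>, of "u + s" "u' + s'"] assms(4,5) by linarith
  moreover have "\<bar>ramp \<alpha> (u + s / 2) - ramp \<alpha> (u' + s' / 2)\<bar> \<le> 3 / 2 * e"
    using ramp_lipschitz[OF \<alpha>, of "u + s / 2" "u' + s' / 2"] assms(4,5) by linarith
  moreover have "\<bar>ramp \<alpha> u - ramp \<alpha> u'\<bar> \<le> e"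
    using ramp_lipschitz[OF \<alpha>, of u u'] assms(4) by linarith
  ultimately have N: "\<bar>N u s - N u' s'\<bar> \<le> 6 * e" unfolding N_def by linarith
  \<comment> \<open>The change of the numerator, at most \<open>2 + 3 + 1 = 6\<close> times
    \<open>e\<close>, is separated from the change of the denominator, which is weighted by a bet of
    size at most 1/2. The total 6.5 is rounded up to 7.\<close>
  have "bet \<alpha> u s - bet \<alpha> u' s' = (N u s - N u' s') / s + bet \<alpha> u' s' * ((s' - s) / s)"
  proof -
    have "bet \<alpha> u s = N u s / s" "bet \<alpha> u' s' = N u' s' / s'" by (simp_all add: bet_def N_def)
    then show ?thesis using pos by (simp add: field_simps)
  qed
  also have "\<bar>\<dots>\<bar> \<le> \<bar>(N u s - N u' s') / s\<bar> + \<bar>bet \<alpha> u' s' * ((s' - s) / s)\<bar>"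
    by (rule abs_triangle_ineq)
  also have "\<bar>(N u s - N u' s') / s\<bar> \<le> 6 * e / \<theta>"
    using N assms pos by (simp add: abs_divide) (intro frac_le; simp)
  also have "\<bar>bet \<alpha> u' s' * ((s' - s) / s)\<bar> \<le> 1 / 2 * (e / \<theta>)"
    unfolding abs_mult abs_divide
    using abs_bet_le[OF pos(2), of u'] assms pos by (intro mult_mono frac_le) auto
  also have "6 * e / \<theta> + 1 / 2 * (e / \<theta>) \<le> 7 * e / \<theta>"
    using assms by (simp add: field_simps)
  finally show ?thesis by simp
qed

end

section \<open>The betting strategy\<close>

lemma sum_lessThan_double:
  fixes f :: "nat \<Rightarrow> 'a :: comm_monoid_add"
  shows "(\<Sum>l<2 * m. f l) = (\<Sum>l<m. f l) + (\<Sum>l<m. f (m + l))"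
proof -
  have "(\<Sum>l<m + n. f l) = (\<Sum>l<m. f l) + (\<Sum>l<n. f (m + l))" for n
    by (induction n) (simp_all add: add.assoc)
  then show ?thesis by (simp add: mult_2)
qed

text \<open>Every later term is a fixed linear function of \<open>d\<close> consecutive ones. Hence
  \<open>r\<close> steps of the recurrence amount to one matrix, which a single sweep can
  apply.\<close>

lemma linear_recurrence_shift:
  fixes t :: "nat \<Rightarrow> 'a :: comm_ring_1"
  assumes "d > 0" "\<And>m. t (m + d) = (\<Sum>l<d. c l * t (m + l))"
  shows "\<exists>g. \<forall>m. t (m + j) = (\<Sum>l<d. g l * t (m + l))"
proof (induction j)
  case 0
  have "t m = (\<Sum>l<d. of_bool (l = 0) * t (m + l))" for m
    using assms(1) by (simp add: of_bool_def if_distrib[of "\<lambda>x. x * _"] sum.delta cong: if_cong)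
  then show ?case by (intro exI[of _ "\<lambda>l. of_bool (l = 0)"]) simp
next
  case (Suc j)
  then obtain g where g: "t (m + j) = (\<Sum>l<d. g l * t (m + l))" for m by blast
  obtain e where d: "d = Suc e" using assms(1) gr0_implies_Suc by blast
  have "t (m + Suc j) = (\<Sum>l<d. ((if l = 0 then 0 else g (l - 1)) + g e * c l) * t (m + l))" for m
  proof -
    have "t (m + Suc j) = (\<Sum>l<d. g l * t (Suc m + l))" using g[of "Suc m"] by simp
    also have "\<dots> = (\<Sum>l<e. g l * t (m + Suc l)) + g e * t (m + d)" by (simp add: d)
    also have "(\<Sum>l<e. g l * t (m + Suc l)) = (\<Sum>l<d. (if l = 0 then 0 else g (l - 1)) * t (m + l))"
      unfolding d sum.lessThan_Suc_shift by simp
    also have "g e * t (m + d) = (\<Sum>l<d. g e * c l * t (m + l))"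
      unfolding assms(2) sum_distrib_left by (simp add: mult.assoc)
    finally show ?thesis by (simp add: distrib_right sum.distrib)
  qed
  then show ?case
    by (intro exI[of _ "\<lambda>l. (if l = 0 then 0 else g (l - 1)) + g e * c l"] allI)
qed

fun prefix_value :: "(nat \<Rightarrow> bool) \<Rightarrow> nat \<Rightarrow> int" where
  "prefix_value bs 0 = 0"
| "prefix_value bs (Suc n) = 2 * prefix_value bs n + of_bool (bs n)"

text \<open>
  After \<open>n\<close> bits the strategy bets on the fractional part of \<open>T (phase n) * x\<close>; it moves on to the
  next multiplier once the interval of all \<open>x\<close> with the given \<open>n\<close> bits is mapped to a short one.
\<close>

fun phase :: "(nat \<Rightarrow> int) \<Rightarrow> nat \<Rightarrow> real \<Rightarrow> nat \<Rightarrow> nat" where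
  "phase T K \<theta> 0 = 0"
| "phase T K \<theta> (Suc n) =
     (if of_int ((2 ^ K * T (phase T K \<theta> n)) div 2 ^ n) < \<theta> * 2 ^ K then Suc (phase T K \<theta> n) else phase T K \<theta> n)"

text \<open>The end of a phase is decided by an integer part that the control knows exactly, not by
  the real scale. One direction is exact, the other is off by less than
  \<open>1 / 2 ^ K\<close>.\<close>

lemma quotient_threshold:
  fixes m :: int and \<theta> :: real
  shows "\<not> of_int ((2 ^ K * m) div 2 ^ n) < \<theta> * 2 ^ K \<Longrightarrow> \<theta> \<le> of_int m / 2 ^ n"
    and "of_int ((2 ^ K * m) div 2 ^ n) < \<theta> * 2 ^ K \<Longrightarrow> of_int m / 2 ^ n < \<theta> + 1 / 2 ^ K"
proof -
  define s where "s = real_of_int m / 2 ^ n"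
  have "real_of_int \<lfloor>s * 2 ^ K\<rfloor> = of_int ((2 ^ K * m) div 2 ^ n)"
    using floor_divide_of_int_eq[of "2 ^ K * m" "2 ^ n", where 'a = real]
    by (simp add: s_def mult.commute)
  note * = this[symmetric]
  show "\<theta> \<le> s" if "\<not> of_int ((2 ^ K * m) div 2 ^ n) < \<theta> * 2 ^ K"
  proof -
    have "\<theta> * 2 ^ K \<le> s * 2 ^ K" using that of_int_floor_le[of "s * 2 ^ K"] unfolding * by linarith
    then show ?thesis by simp
  qed
  show "s < \<theta> + 1 / 2 ^ K" if "of_int ((2 ^ K * m) div 2 ^ n) < \<theta> * 2 ^ K"
  proof -
    have "s * 2 ^ K < \<theta> * 2 ^ K + 1" using that unfolding * by linarith
    also have "\<dots> = (\<theta> + 1 / 2 ^ K) * 2 ^ K" by (simp add: distrib_right)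
    finally show ?thesis by simp
  qed
qed

lemma scaled_quotient:
  fixes p k l v x q :: real
  assumes "p > 0" "k > 0"
  shows "l + 2 * p * v = 2 * k * x \<Longrightarrow> x / p = l / (2 * p * k) + v / k"
    and "2 * k * x = 2 * (p * k) * q + (l + 2 * p * v) \<Longrightarrow> x / p = l / (2 * p * k) + (v / k + q)"
  using assms by (simp_all add: field_simps)

text \<open>The multipliers are the traces at \<open>r * k + m0\<close>, and a phase ends near scale
  \<theta>. The arcs start at \<open>a\<close> modulo one and have length \<alpha>; \<delta> scales
  the stakes; \<open>K\<close> and \<open>D\<close> are the binary places kept of positions and
  stakes. \<open>bnd\<close> limits the top parts that occur, which makes the control
  finite.\<close>

locale bettor =
  fixes t :: "nat \<Rightarrow> int" and d :: nat and c :: "nat \<Rightarrow> int" and r m0 K D :: nat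
    and \<theta> a \<alpha> \<delta> :: real and bnd :: int
  assumes d: "d > 0" and rec: "\<And>m. t (m + d) = (\<Sum>l<d. c l * t (m + l))"
    and \<theta>: "\<theta> > 0" and \<alpha>: "0 \<le> \<alpha>" "\<alpha> \<le> 1" and \<delta>: "0 < \<delta>" "\<delta> \<le> 1 / 2" and D: "D > 0"
    and bnd_ge: "bnd \<ge> 2 ^ K"
    and bnd: "\<And>n i. i < d \<Longrightarrow>
      \<bar>2 ^ K * t (r * phase (\<lambda>k. t (r * k + m0)) K \<theta> n + m0 + i)\<bar> \<le> bnd * 2 ^ n"
begin

abbreviation T :: "nat \<Rightarrow> int" where "T k \<equiv> t (r * k + m0)"

definition ph :: "nat \<Rightarrow> nat" where "ph = phase T K \<theta>"

definition flagged :: "nat \<Rightarrow> bool" where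
  "flagged n \<longleftrightarrow> of_int ((2 ^ K * T (ph n)) div 2 ^ n) < \<theta> * 2 ^ K"

lemma ph_Suc: "ph (Suc n) = (if flagged n then Suc (ph n) else ph n)"
  by (simp add: flagged_def ph_def)

lemma ph_0 [simp]: "ph 0 = 0"
  by (simp add: ph_def)

definition coef :: "nat \<Rightarrow> nat \<Rightarrow> int" where
  "coef j = (SOME g. \<forall>m. t (m + j) = (\<Sum>l<d. g l * t (m + l)))"

lemma coef: "t (m + j) = (\<Sum>l<d. coef j l * t (m + l))"
  using someI_ex[OF linear_recurrence_shift[of d t c j, OF d rec]] unfolding coef_def by blast

text \<open>
  For \<open>i < d\<close>, register \<open>i\<close> holds a multiple of the trace number \<open>i\<close> places after the current one,
  and register \<open>d + i\<close> that trace times the integer formed by the bits read so far.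
\<close>

definition flag :: "(nat \<Rightarrow> int) \<Rightarrow> bool" where
  "flag v \<longleftrightarrow> of_int (v 0) < \<theta> * 2 ^ K"

definition advance :: "(nat \<Rightarrow> int) \<Rightarrow> nat \<Rightarrow> nat \<Rightarrow> int" where
  "advance v i l = (if flag v then coef (r + i) l else of_bool (i = l))"

text \<open>A block matrix. If \<open>X\<close> is the integer formed by the bits read, the next one
  is \<open>2 * X + b\<close>, so a product register is doubled and receives the trace once more if
  the bit is 1. Both blocks advance the traces by \<open>r\<close> places when a phase ends.\<close>

definition A :: "(nat \<Rightarrow> int) \<Rightarrow> bool \<Rightarrow> nat \<Rightarrow> nat \<Rightarrow> int" where
  "A v b i l =
     (if i < d then (if l < d then advance v i l else 0)
      else (if l < d then of_bool b * advance v (i - d) l else 2 * advance v (i - d) (l - d)))"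

text \<open>On actual runs the top parts of the traces stay within \<open>bnd\<close>, so the
  default 0 does not occur there. Of the products only the position modulo one matters, hence the
  reduction modulo \<open>2 ^ K\<close>.\<close>

definition clip :: "(nat \<Rightarrow> int) \<Rightarrow> nat \<Rightarrow> int" where
  "clip y = (\<lambda>i\<in>{..<2 * d}. if i < d then (if \<bar>y i\<bar> \<le> bnd then y i else 0) else y i mod 2 ^ K)"

definition V :: "(nat \<Rightarrow> int) set" where
  "V = {..<2 * d} \<rightarrow>\<^sub>E {-bnd..bnd}"

definition v0 :: "nat \<Rightarrow> int" where
  "v0 = (\<lambda>i\<in>{..<2 * d}. if i < d then 2 ^ K * t (m0 + i) else 0)"

text \<open>The same integer is added for one bit and subtracted for the other, so rounding leaves
  the martingale equation exact.\<close>

definition stake :: "(nat \<Rightarrow> int) \<Rightarrow> int" where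
  "stake v = \<lfloor>2 ^ D * (\<delta> * bet \<alpha> (of_int (v d) / 2 ^ K - a) (of_int (v 0) / 2 ^ K))\<rfloor>"

definition mult :: "(nat \<Rightarrow> int) \<Rightarrow> bool \<Rightarrow> nat" where
  "mult v b = nat (if flag v then 2 ^ D else if b then 2 ^ D + stake v else 2 ^ D - stake v)"

text \<open>The real stake is at most \<open>2 ^ (D - 1)\<close> in absolute value, and this is an
  integer because \<open>D > 0\<close>, so rounding down cannot cross its negative. Every factor of
  the capital is therefore positive.\<close>

lemma stake_bound:
  assumes "\<not> flag v"
  shows "\<bar>stake v\<bar> < 2 ^ D"
proof -
  let ?z = "2 ^ D * (\<delta> * bet \<alpha> (of_int (v d) / 2 ^ K - a) (of_int (v 0) / 2 ^ K))"
  obtain e where e: "D = Suc e" using D gr0_implies_Suc by blast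
  have "0 < \<theta> * 2 ^ K" using \<theta> by simp
  then have "of_int (v 0) / 2 ^ K > (0 :: real)"
    using assms unfolding flag_def by simp
  then have "\<bar>\<delta> * bet \<alpha> (of_int (v d) / 2 ^ K - a) (of_int (v 0) / 2 ^ K)\<bar> \<le> 1 * (1 / 2)"
    unfolding abs_mult using \<delta> by (intro mult_mono abs_bet_le \<alpha>) auto
  then have "\<bar>?z\<bar> \<le> 2 ^ D * (1 / 2)" unfolding abs_mult by simp
  then have "\<bar>?z\<bar> \<le> of_int (2 ^ e)" by (simp add: e)
  then have "stake v \<le> 2 ^ e" "- (2 ^ e) \<le> stake v"
    unfolding stake_def by (simp_all only: abs_le_iff floor_le_iff le_floor_iff) linarith+
  then show ?thesis by (simp add: e abs_less_iff) (smt (verit) zero_less_power)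
qed

lemma real_mult:
  "real (mult v b) = (if flag v then 2 ^ D else if b then 2 ^ D + of_int (stake v) else 2 ^ D - of_int (stake v))"
  using stake_bound[of v] by (auto simp: mult_def abs_less_iff)

lemma clip_in: "clip y \<in> V"
  unfolding clip_def V_def
proof (intro restrict_PiE_iff[THEN iffD2] ballI)
  fix i
  define z where "z = y i mod 2 ^ K"
  have "0 \<le> z" "z < 2 ^ K" by (simp_all add: z_def)
  moreover have "0 \<le> bnd" using bnd_ge zero_le_power[of "2 :: int" K] by linarith
  ultimately show "(if i < d then if \<bar>y i\<bar> \<le> bnd then y i else 0 else y i mod 2 ^ K) \<in> {- bnd..bnd}"
    unfolding z_def[symmetric] using bnd_ge by auto
qed

lemma v0_in: "v0 \<in> V"
  unfolding v0_def V_def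
proof (intro restrict_PiE_iff[THEN iffD2] ballI)
  fix i
  have "0 \<le> bnd" using bnd_ge zero_le_power[of "2 :: int" K] by linarith
  then show "(if i < d then 2 ^ K * t (m0 + i) else 0) \<in> {- bnd..bnd}"
    using bnd[of i 0] by (auto simp: abs_le_iff)
qed

sublocale reg: register_machine "2 * d" V v0 A clip mult "Suc D" D
proof
  show "finite V" unfolding V_def by (intro finite_PiE) auto
  show "mult v b < 2 ^ Suc D" for v b
  proof -
    have "\<bar>real_of_int (stake v)\<bar> < 2 ^ D" if "\<not> flag v"
      using stake_bound[OF that] by (metis of_int_abs of_int_less_iff of_int_numeral of_int_power)
    then have "real (mult v b) < 2 ^ D + 2 ^ D"
      unfolding real_mult by (cases "flag v"; cases b) (simp_all add: abs_less_iff)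
    then have "real (mult v b) < real (2 ^ Suc D)" by simp
    then show ?thesis by (simp only: of_nat_less_iff)
  qed
qed (use v0_in clip_in D in simp_all)

lemma capital_nonneg: "reg.capital \<sigma> \<ge> 0"
  by (simp add: reg.capital_def)

lemma martingale_capital: "martingale reg.capital"
  unfolding martingale_def
proof (intro conjI allI capital_nonneg)
  fix \<sigma>
  show "reg.capital \<sigma> = (reg.capital (\<sigma> @ [False]) + reg.capital (\<sigma> @ [True])) / 2"
    unfolding reg.capital_snoc real_mult by (simp add: field_simps)
qed

section \<open>The invariant of the registers\<close>

lemma sum_advance:
  assumes "i < d"
  shows "(\<Sum>l<d. advance v i l * f l) = (if flag v then \<Sum>l<d. coef (r + i) l * f l else f i)"
  using assms by (simp add: advance_def of_bool_def if_distrib[of "\<lambda>x. x * _"] sum.delta cong: if_cong)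

lemma image_regs:
  assumes "i < d"
  shows "reg.image_regs v b x i = (\<Sum>l<d. advance v i l * x l)"
    and "reg.image_regs v b x (d + i) =
      of_bool b * (\<Sum>l<d. advance v i l * x l) + 2 * (\<Sum>l<d. advance v i l * x (d + l))"
  using assms unfolding reg.image_regs_def sum_lessThan_double A_def
  by (simp_all add: sum_distrib_left mult.assoc)

text \<open>The first cell, present before any input, accounts for the factor 2 beyond
  \<open>2 ^ K\<close>. Cutting at \<open>2 ^ (n + 1)\<close> leaves as top parts the integer part
  of \<open>2 ^ K\<close> times the scale and, modulo \<open>2 ^ K\<close>, that of
  \<open>2 ^ K\<close> times the position. All \<open>d\<close> products are kept because the
  product for the next multiplier is a combination of them.\<close>

lemma exec_registers:
  "\<exists>v lo N. reg.exec (rev (map bs [0..<n])) = (v, lo, N) \<and>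
    (\<forall>i. 0 \<le> lo i \<and> lo i < 2 ^ Suc n) \<and>
    (\<forall>i<d. lo i + 2 ^ Suc n * v i = 2 ^ Suc K * t (r * ph n + m0 + i)) \<and>
    (\<forall>i<d. lo (d + i) + 2 ^ Suc n * v (d + i) =
      (2 ^ Suc K * t (r * ph n + m0 + i) * prefix_value bs n) mod 2 ^ (Suc n + K)) \<and>
    (flag v \<longleftrightarrow> flagged n)"
proof (induction n)
  case 0
  have "i < d \<Longrightarrow> v0 i = 2 ^ K * t (m0 + i)" "i < d \<Longrightarrow> v0 (d + i) = 0" for i
    by (simp_all add: v0_def)
  then show ?case
    using d by (intro exI[of _ v0] exI[of _ "\<lambda>_. 0"] exI[of _ "2 ^ D"]) (simp add: flag_def flagged_def)
next
  case (Suc n)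
  let ?X = "prefix_value bs n" and ?E = "r * ph n + m0" and ?E' = "r * ph (Suc n) + m0"
  obtain v lo N where e: "reg.exec (rev (map bs [0..<n])) = (v, lo, N)"
    and lo: "\<And>i. 0 \<le> lo i \<and> lo i < 2 ^ Suc n"
    and reg1: "\<And>i. i < d \<Longrightarrow> lo i + 2 ^ Suc n * v i = 2 ^ Suc K * t (?E + i)"
    and reg2: "\<And>i. i < d \<Longrightarrow> lo (d + i) + 2 ^ Suc n * v (d + i) = (2 ^ Suc K * t (?E + i) * ?X) mod 2 ^ (Suc n + K)"
    and flag: "flag v \<longleftrightarrow> flagged n"
    using Suc.IH by blast
  define x where "x l = lo l + 2 ^ Suc n * v l" for l
  define y where "y = reg.image_regs v (bs n) x"
  define v' where "v' = clip (\<lambda>i\<in>{..<2 * d}. y i div 2 ^ Suc (Suc n))"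
  define lo' where "lo' i = y i mod 2 ^ Suc (Suc n)" for i
  have e': "reg.exec (rev (map bs [0..<Suc n])) = (v', lo', mult v (bs n) * N)"
    by (simp add: e Let_def y_def v'_def lo'_def[abs_def] x_def[abs_def])
  have E': "?E' = ?E + (if flagged n then r else 0)" by (simp add: ph_Suc)
  have adv: "(\<Sum>l<d. advance v i l * t (?E + l)) = t (?E' + i)" if "i < d" for i
    unfolding sum_advance[OF that] E' flag using coef[of ?E "r + i"] by (simp add: add.assoc)
  have x: "(\<Sum>l<d. advance v i l * x l) = 2 ^ Suc K * t (?E' + i)" if "i < d" for i
  proof -
    have "(\<Sum>l<d. advance v i l * x l) = (\<Sum>l<d. 2 ^ Suc K * (advance v i l * t (?E + l)))"
      by (intro sum.cong) (simp_all add: x_def reg1 mult.left_commute del: power_Suc)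
    then show ?thesis unfolding sum_distrib_left[symmetric] adv[OF that] .
  qed
  have y1: "y i = 2 ^ Suc K * t (?E' + i)" if "i < d" for i
    unfolding y_def image_regs[OF that] x[OF that] ..
  \<comment> \<open>The multiples of the modulus dropped so far pass through an integer matrix and
    are doubled, so they are multiples of the next modulus.\<close>
  have y2: "y (d + i) mod 2 ^ (Suc (Suc n) + K) =
      (2 ^ Suc K * t (?E' + i) * prefix_value bs (Suc n)) mod 2 ^ (Suc (Suc n) + K)" if "i < d" for i
  proof -
    let ?M = "2 ^ (Suc n + K) :: int"
    define q where "q l = (2 ^ Suc K * t (?E + l) * ?X) div ?M" for l
    have "(\<Sum>l<d. advance v i l * x (d + l)) =
        (\<Sum>l<d. 2 ^ Suc K * ?X * (advance v i l * t (?E + l)) - ?M * (advance v i l * q l))"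
    proof (intro sum.cong refl)
      fix l assume "l \<in> {..<d}"
      then have eq: "x (d + l) = 2 ^ Suc K * t (?E + l) * ?X - ?M * q l"
        using reg2[of l] by (simp only: x_def q_def lessThan_iff minus_mult_div_eq_mod)
      show "advance v i l * x (d + l) =
          2 ^ Suc K * ?X * (advance v i l * t (?E + l)) - ?M * (advance v i l * q l)"
        unfolding eq right_diff_distrib by (simp only: mult_ac)
    qed
    also have "\<dots> = 2 ^ Suc K * ?X * t (?E' + i) - ?M * (\<Sum>l<d. advance v i l * q l)"
      unfolding sum_subtractf sum_distrib_left[symmetric] adv[OF that] ..
    finally have "y (d + i) = of_bool (bs n) * (2 ^ Suc K * t (?E' + i)) +
        2 * (2 ^ Suc K * ?X * t (?E' + i) - ?M * (\<Sum>l<d. advance v i l * q l))"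
      unfolding y_def image_regs[OF that] x[OF that] by (simp only:)
    also have "\<dots> = 2 ^ Suc K * t (?E' + i) * prefix_value bs (Suc n) - 2 ^ (Suc (Suc n) + K) * (\<Sum>l<d. advance v i l * q l)"
      by (simp add: algebra_simps)
    finally show ?thesis by (simp add: mod_eq_dvd_iff del: power_Suc)
  qed
  \<comment> \<open>Here \<open>bnd\<close> guarantees that \<open>clip\<close> changes
    nothing.\<close>
  have v'1: "v' i = y i div 2 ^ Suc (Suc n)" if "i < d" for i
  proof -
    have "\<bar>2 ^ K * t (?E' + i)\<bar> \<le> bnd * 2 ^ Suc n" using bnd[OF that, of "Suc n"] unfolding ph_def .
    then have "\<bar>y i\<bar> \<le> bnd * 2 ^ Suc (Suc n)" unfolding y1[OF that] by (simp add: abs_mult)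
    then have "y i \<le> bnd * 2 ^ Suc (Suc n)" "(- bnd) * 2 ^ Suc (Suc n) \<le> y i" by (simp_all add: abs_le_iff)
    then have "y i div 2 ^ Suc (Suc n) \<le> (bnd * 2 ^ Suc (Suc n)) div 2 ^ Suc (Suc n)"
      "((- bnd) * 2 ^ Suc (Suc n)) div 2 ^ Suc (Suc n) \<le> y i div 2 ^ Suc (Suc n)"
      by - (rule zdiv_mono1, assumption, simp)+
    then have "y i div 2 ^ Suc (Suc n) \<le> bnd" "- bnd \<le> y i div 2 ^ Suc (Suc n)"
      by (simp_all only: nonzero_mult_div_cancel_right power_not_zero zero_neq_numeral[symmetric] not_False_eq_True)
    then show ?thesis using that by (simp add: v'_def clip_def abs_le_iff del: power_Suc)
  qed
  have v'2: "v' (d + i) = y (d + i) div 2 ^ Suc (Suc n) mod 2 ^ K" if "i < d" for i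
    using that by (simp add: v'_def clip_def del: power_Suc)
  have reg1': "lo' i + 2 ^ Suc (Suc n) * v' i = 2 ^ Suc K * t (?E' + i)" if "i < d" for i
    unfolding lo'_def v'1[OF that] y1[OF that] by (simp del: power_Suc)
  have "flag v' \<longleftrightarrow> flagged (Suc n)"
  proof -
    have "v' 0 = (2 ^ Suc K * T (ph (Suc n))) div 2 ^ Suc (Suc n)"
      using v'1[OF d] y1[OF d] by simp
    also have "\<dots> = (2 ^ K * T (ph (Suc n))) div 2 ^ Suc n"
      by (simp add: mult.assoc)
    finally show ?thesis unfolding flag_def flagged_def by (simp only:)
  qed
  moreover have "lo' (d + i) + 2 ^ Suc (Suc n) * v' (d + i) =
      (2 ^ Suc K * t (?E' + i) * prefix_value bs (Suc n)) mod 2 ^ (Suc (Suc n) + K)" if "i < d" for i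
  proof -
    have "lo' (d + i) + 2 ^ Suc (Suc n) * v' (d + i) = y (d + i) mod (2 ^ Suc (Suc n) * 2 ^ K)"
      unfolding lo'_def v'2[OF that] by (subst zmod_zmult2_eq) (simp_all del: power_Suc)
    then show ?thesis by (simp only: power_add[symmetric] y2[OF that])
  qed
  moreover have "0 \<le> lo' i \<and> lo' i < 2 ^ Suc (Suc n)" for i
    unfolding lo'_def by (simp del: power_Suc)
  ultimately show ?case using e' reg1' by blast
qed

text \<open>Multiplication by the current multiplier maps the dyadic interval of the first
  \<open>n\<close> bits to an interval of length \<open>scale\<close> with left end
  \<open>pos\<close>.\<close>

definition scale :: "nat \<Rightarrow> real" where
  "scale n = of_int (T (ph n)) / 2 ^ n"

definition pos :: "(nat \<Rightarrow> bool) \<Rightarrow> nat \<Rightarrow> real" where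
  "pos bs n = of_int (T (ph n)) * of_int (prefix_value bs n) / 2 ^ n"

lemma scale_Suc: "\<not> flagged n \<Longrightarrow> scale (Suc n) = scale n / 2"
  by (simp add: scale_def ph_Suc)

lemma pos_Suc: "\<not> flagged n \<Longrightarrow> pos bs (Suc n) = pos bs n + of_bool (bs n) * (scale n / 2)"
  by (simp add: scale_def pos_def ph_Suc distrib_left add_divide_distrib)

lemma flagged_scale:
  shows "\<not> flagged n \<Longrightarrow> \<theta> \<le> scale n" "flagged n \<Longrightarrow> scale n < \<theta> + 1 / 2 ^ K"
  using quotient_threshold[of K "T (ph n)" n \<theta>] unfolding flagged_def scale_def by simp_all

text \<open>The reduction of the product registers loses the integer \<open>j\<close>, to which the
  bet is insensitive by \<open>bet_shift\<close>.\<close>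

lemma exec_approx:
  "\<exists>v lo N j. reg.exec (rev (map bs [0..<n])) = (v, lo, N) \<and> (flag v \<longleftrightarrow> flagged n) \<and>
    \<bar>scale n - of_int (v 0) / 2 ^ K\<bar> \<le> 1 / 2 ^ K \<and>
    \<bar>pos bs n - (of_int (v d) / 2 ^ K + of_int j)\<bar> \<le> 1 / 2 ^ K"
proof -
  obtain v lo N where e: "reg.exec (rev (map bs [0..<n])) = (v, lo, N)"
    and lo: "\<forall>i. 0 \<le> lo i \<and> lo i < 2 ^ Suc n"
    and reg1: "\<forall>i<d. lo i + 2 ^ Suc n * v i = 2 ^ Suc K * t (r * ph n + m0 + i)"
    and reg2: "\<forall>i<d. lo (d + i) + 2 ^ Suc n * v (d + i) =
      (2 ^ Suc K * t (r * ph n + m0 + i) * prefix_value bs n) mod 2 ^ (Suc n + K)"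
    and flag: "flag v \<longleftrightarrow> flagged n"
    using exec_registers[of bs n] by (elim exE conjE) (rule that)
  note reg1 = reg1[rule_format, OF d] and reg2 = reg2[rule_format, OF d]
  define q where "q = (2 ^ Suc K * T (ph n) * prefix_value bs n) div 2 ^ (Suc n + K)"
  have lo': "0 \<le> real_of_int (lo i) / (2 ^ Suc n * 2 ^ K)" "real_of_int (lo i) / (2 ^ Suc n * 2 ^ K) \<le> 1 / 2 ^ K" for i
  proof -
    show "0 \<le> real_of_int (lo i) / (2 ^ Suc n * 2 ^ K)" using lo by (simp add: divide_nonneg_pos)
    have "real_of_int (lo i) \<le> real_of_int (2 ^ Suc n)" using lo by (simp only: of_int_le_iff less_imp_le)
    then have "real_of_int (lo i) / (2 ^ Suc n * 2 ^ K) \<le> real_of_int (2 ^ Suc n) / (2 ^ Suc n * 2 ^ K)"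
      by (rule divide_right_mono) simp
    also have "\<dots> = 1 / 2 ^ K" by simp
    finally show "real_of_int (lo i) / (2 ^ Suc n * 2 ^ K) \<le> 1 / 2 ^ K" .
  qed
  have "real_of_int (lo 0 + 2 ^ Suc n * v 0) = real_of_int (2 ^ Suc K * T (ph n))"
    by (simp only: reg1 add_0_right)
  then have "of_int (lo 0) + 2 * 2 ^ n * of_int (v 0) = 2 * 2 ^ K * real_of_int (T (ph n))" by simp
  from scaled_quotient(1)[OF _ _ this]
  have "scale n = real_of_int (lo 0) / (2 ^ Suc n * 2 ^ K) + of_int (v 0) / 2 ^ K"
    unfolding scale_def by simp
  moreover have "pos bs n = real_of_int (lo d) / (2 ^ Suc n * 2 ^ K) + (of_int (v d) / 2 ^ K + of_int q)"
  proof -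
    have "2 ^ Suc K * T (ph n) * prefix_value bs n = 2 ^ (Suc n + K) * q + (lo d + 2 ^ Suc n * v d)"
      using reg2 unfolding q_def add_0_right by (simp only: mult_div_mod_eq)
    then have "real_of_int (2 ^ Suc K * T (ph n) * prefix_value bs n) = real_of_int (2 ^ (Suc n + K) * q + (lo d + 2 ^ Suc n * v d))"
      by (simp only:)
    then have "2 * 2 ^ K * (real_of_int (T (ph n)) * of_int (prefix_value bs n)) =
        2 * (2 ^ n * 2 ^ K) * of_int q + (of_int (lo d) + 2 * 2 ^ n * of_int (v d))"
      by (simp add: power_add mult.assoc)
    from scaled_quotient(2)[OF _ _ this] show ?thesis unfolding pos_def by simp
  qed
  ultimately have "\<bar>scale n - of_int (v 0) / 2 ^ K\<bar> \<le> 1 / 2 ^ K"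
    "\<bar>pos bs n - (of_int (v d) / 2 ^ K + of_int q)\<bar> \<le> 1 / 2 ^ K"
    using lo'[of 0] lo'[of d] by linarith+
  with e flag show ?thesis by (intro exI conjI)
qed

lemma stake_approx:
  assumes "\<not> flag v" "\<not> flagged n" "\<bar>scale n - of_int (v 0) / 2 ^ K\<bar> \<le> 1 / 2 ^ K"
    "\<bar>pos bs n - (of_int (v d) / 2 ^ K + of_int j)\<bar> \<le> 1 / 2 ^ K"
  shows "\<bar>of_int (stake v) / 2 ^ D - \<delta> * bet \<alpha> (pos bs n - a) (scale n)\<bar> \<le> 1 / 2 ^ D + 7 * \<delta> / (\<theta> * 2 ^ K)"
proof -
  let ?b = "bet \<alpha> (of_int (v d) / 2 ^ K - a) (of_int (v 0) / 2 ^ K)"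
  have "\<theta> \<le> of_int (v 0) / 2 ^ K"
    using assms(1) by (simp add: flag_def pos_le_divide_eq)
  then have "\<bar>bet \<alpha> (pos bs n - a) (scale n) - bet \<alpha> (of_int (v d) / 2 ^ K - a + of_int j) (of_int (v 0) / 2 ^ K)\<bar>
      \<le> 7 * (1 / 2 ^ K) / \<theta>"
    using assms(3,4) flagged_scale(1)[OF assms(2)]
    by (intro bet_lipschitz \<alpha> \<theta>) (simp_all add: diff_diff_eq2 add.commute)
  then have "\<delta> * \<bar>bet \<alpha> (pos bs n - a) (scale n) - ?b\<bar> \<le> \<delta> * (7 * (1 / 2 ^ K) / \<theta>)"
    unfolding bet_shift[OF \<alpha>] using \<delta> by (intro mult_left_mono) auto
  then have "\<bar>\<delta> * bet \<alpha> (pos bs n - a) (scale n) - \<delta> * ?b\<bar> \<le> 7 * \<delta> / (\<theta> * 2 ^ K)"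
  proof -
    have "\<delta> * bet \<alpha> (pos bs n - a) (scale n) - \<delta> * ?b = \<delta> * (bet \<alpha> (pos bs n - a) (scale n) - ?b)"
      by (rule right_diff_distrib[symmetric])
    moreover have "\<delta> * (7 * (1 / 2 ^ K) / \<theta>) = 7 * \<delta> / (\<theta> * 2 ^ K)" by (simp add: mult.commute)
    ultimately show ?thesis using \<open>\<delta> * _ \<le> _\<close> \<delta> by (simp only: abs_mult abs_of_pos)
  qed
  moreover have "\<bar>of_int (stake v) / 2 ^ D - \<delta> * ?b\<bar> \<le> 1 / 2 ^ D"
  proof -
    have "\<bar>of_int (stake v) - 2 ^ D * (\<delta> * ?b)\<bar> \<le> 1"
      unfolding stake_def by linarith
    moreover have "of_int (stake v) / 2 ^ D - \<delta> * ?b = (of_int (stake v) - 2 ^ D * (\<delta> * ?b)) / 2 ^ D"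
      by (simp add: diff_divide_distrib)
    ultimately show ?thesis by (simp only: abs_divide) (simp add: divide_right_mono)
  qed
  ultimately show ?thesis by linarith
qed

text \<open>The first bracket is a potential. During betting the density changes by the bet up to
  sign, and the logarithm of the capital follows \<delta> times this change up to the loss per
  digit. When a phase ends, the final density, which is 1 after a visit, is exchanged for the visit
  counter, and the fresh density is paid for by \<open>\<alpha> + 1 / Q\<close>; the 1 in
  \<open>ph n + 1\<close> pays for the phase still open.\<close>

lemma capital_growth:
  fixes Q \<epsilon> :: real and G :: "nat \<Rightarrow> bool"
  assumes err: "1 / 2 ^ D + 7 * \<delta> / (\<theta> * 2 ^ K) \<le> \<delta> * \<epsilon>" "\<epsilon> \<le> 1 / 2" and Q: "Q > 0"
    and T_pos: "\<And>k. T k > 0" and init: "scale 0 \<ge> Q" and jump: "\<And>n. flagged n \<Longrightarrow> scale (Suc n) \<ge> Q"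
    and good: "\<And>n. flagged n \<Longrightarrow> G (ph n) \<Longrightarrow>
      \<exists>j :: int. a + of_int j \<le> pos bs n \<and> pos bs n + scale n \<le> a + of_int j + \<alpha>"
  shows "reg.capital (map bs [0..<n]) > 0 \<and>
    ln (reg.capital (map bs [0..<n])) \<ge>
      \<delta> * (hit_density \<alpha> (pos bs n - a) (scale n) + card {k. k < ph n \<and> G k} - (\<alpha> + 1 / Q) * (ph n + 1))
      - (\<delta> * \<epsilon> + 2 * \<delta>\<^sup>2) * n"
proof (induction n)
  case 0
  have "hit_density \<alpha> (pos bs 0 - a) (scale 0) \<le> \<alpha> + 1 / scale 0"
    using init Q by (intro hit_density_bounds \<alpha>) auto
  also have "\<dots> \<le> \<alpha> + 1 / Q" using init Q by (intro add_left_mono divide_left_mono) auto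
  finally have "\<delta> * (hit_density \<alpha> (pos bs 0 - a) (scale 0) - (\<alpha> + 1 / Q)) \<le> 0"
    using \<delta> by (intro mult_nonneg_nonpos) auto
  then show ?case by (simp add: reg.capital_Nil)
next
  case (Suc n)
  let ?f = "\<lambda>n. reg.capital (map bs [0..<n])"
  let ?den = "\<lambda>n. hit_density \<alpha> (pos bs n - a) (scale n)" and ?C = "\<lambda>n. real (card {k. k < ph n \<and> G k})"
  let ?\<kappa> = "\<delta> * \<epsilon> + 2 * \<delta>\<^sup>2"
  obtain v lo N j where e: "reg.exec (rev (map bs [0..<n])) = (v, lo, N)" and flag: "flag v \<longleftrightarrow> flagged n"
    and approx: "\<bar>scale n - of_int (v 0) / 2 ^ K\<bar> \<le> 1 / 2 ^ K"
      "\<bar>pos bs n - (of_int (v d) / 2 ^ K + of_int j)\<bar> \<le> 1 / 2 ^ K"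
    using exec_approx[of bs n] by blast
  have f: "?f (Suc n) = ?f n * (real (mult v (bs n)) / 2 ^ D)"
    using reg.capital_snoc[of "map bs [0..<n]" "bs n"] e by simp
  have scale_pos: "scale n > 0" for n using T_pos[of "ph n"] by (simp add: scale_def)
  have err_pos: "0 \<le> \<delta> * \<epsilon>"
  proof -
    have "0 \<le> 1 / 2 ^ D + 7 * \<delta> / (\<theta> * 2 ^ K)" using \<delta> \<theta> by simp
    then show ?thesis using err(1) by linarith
  qed
  have \<kappa>: "0 \<le> ?\<kappa>" using err_pos by simp
  show ?case
  proof (cases "flagged n")
    case True
    have "?den (Suc n) \<le> \<alpha> + 1 / scale (Suc n)" by (intro hit_density_bounds \<alpha> scale_pos)
    also have "\<dots> \<le> \<alpha> + 1 / Q" using jump[OF True] Q by (intro add_left_mono divide_left_mono) auto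
    finally have 1: "?den (Suc n) \<le> \<alpha> + 1 / Q" .
    have "{k. k < ph (Suc n) \<and> G k} = {k. k < ph n \<and> G k} \<union> (if G (ph n) then {ph n} else {})"
      unfolding ph_Suc using True by (auto simp: less_Suc_eq)
    then have 2: "?C (Suc n) = ?C n + of_bool (G (ph n))" by simp
    have 4: "ph (Suc n) = Suc (ph n)" using True by (simp add: ph_Suc)
    \<comment> \<open>By \<open>good\<close> the whole image interval then lies in one arc.\<close>
    have 3: "of_bool (G (ph n)) \<le> ?den n"
    proof (cases "G (ph n)")
      case True
      then obtain j :: int where "a + of_int j \<le> pos bs n" "pos bs n + scale n \<le> a + of_int j + \<alpha>"
        using good \<open>flagged n\<close> by blast
      then have "?den n = 1" using scale_pos by (intro hit_density_inside[OF \<alpha>, of _ j]) auto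
      then show ?thesis by simp
    qed (simp add: hit_density_bounds[OF \<alpha> scale_pos])
    have "?den (Suc n) + ?C (Suc n) - (\<alpha> + 1 / Q) * (ph (Suc n) + 1) \<le> ?den n + ?C n - (\<alpha> + 1 / Q) * (ph n + 1)"
      using 1 3 unfolding 2 unfolding 4 by (simp add: algebra_simps)
    then have "\<delta> * (?den (Suc n) + ?C (Suc n) - (\<alpha> + 1 / Q) * (ph (Suc n) + 1)) \<le>
        \<delta> * (?den n + ?C n - (\<alpha> + 1 / Q) * (ph n + 1))"
      using \<delta> by (intro mult_left_mono) auto
    moreover have "?f (Suc n) = ?f n" using True flag by (simp add: f real_mult del: upt_Suc)
    moreover have "?\<kappa> * real (Suc n) \<ge> ?\<kappa> * real n" using \<kappa> by (intro mult_left_mono) auto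
    ultimately show ?thesis using Suc.IH by (simp del: upt_Suc)
  next
    case False
    define \<xi> :: real where "\<xi> = (if bs n then 1 else -1) * (of_int (stake v) / 2 ^ D)"
    define b where "b = (if bs n then 1 else -1) * bet \<alpha> (pos bs n - a) (scale n)"
    have f': "?f (Suc n) = ?f n * (1 + \<xi>)"
    proof -
      have "real (mult v (bs n)) / 2 ^ D = 1 + \<xi>"
        using False flag unfolding real_mult \<xi>_def by (simp add: add_divide_distrib diff_divide_distrib)
      then show ?thesis by (simp only: f)
    qed
    have "\<bar>\<xi> - \<delta> * b\<bar> \<le> 1 / 2 ^ D + 7 * \<delta> / (\<theta> * 2 ^ K)"
      using stake_approx[OF _ False approx] False flag unfolding \<xi>_def b_def
      by (cases "bs n") (simp_all add: abs_minus_commute)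
    then have 1: "\<bar>\<xi> - \<delta> * b\<bar> \<le> \<delta> * \<epsilon>" using err(1) by linarith
    have "\<bar>\<delta> * b\<bar> \<le> \<delta> * (1 / 2)"
      using abs_bet_le[OF \<alpha> scale_pos, of "pos bs n - a" n] \<delta> unfolding b_def abs_mult
      by (intro mult_mono) auto
    moreover have "\<delta> * \<epsilon> \<le> \<delta> * (1 / 2)" using \<delta> err(2) by (intro mult_left_mono) auto
    \<comment> \<open>Half of \<delta> comes from the bet and half from rounding. With
      \<open>\<delta> \<le> 1 / 2\<close> this puts \<xi> into the range of the quadratic bound for
      the logarithm.\<close>
    ultimately have \<xi>: "\<bar>\<xi>\<bar> \<le> \<delta>" using 1 by linarith
    then have "\<bar>ln (1 + \<xi>) - \<xi>\<bar> \<le> 2 * \<xi>\<^sup>2"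
      using \<delta> by (intro abs_ln_one_plus_x_minus_x_bound) auto
    moreover have "\<xi>\<^sup>2 \<le> \<delta>\<^sup>2" using \<xi> by (simp add: abs_le_square_iff[symmetric])
    ultimately have ln: "ln (1 + \<xi>) \<ge> \<delta> * b - ?\<kappa>" using 1 by linarith
    have "?den (Suc n) = ?den n + b"
      using hit_density_halves[OF \<alpha> scale_pos, of "pos bs n - a" n]
      unfolding pos_Suc[OF False] scale_Suc[OF False] b_def by (simp add: algebra_simps)
    moreover have "ph (Suc n) = ph n" using False ph_Suc by simp
    ultimately have 2: "\<delta> * (?den (Suc n) + ?C (Suc n) - (\<alpha> + 1 / Q) * (ph (Suc n) + 1)) =
        \<delta> * (?den n + ?C n - (\<alpha> + 1 / Q) * (ph n + 1)) + \<delta> * b"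
      by (simp only: distrib_left[symmetric]) simp
    have 3: "?\<kappa> * real (Suc n) = ?\<kappa> * real n + ?\<kappa>"
      by (simp only: of_nat_Suc distrib_left mult_1_right add.commute)
    have "1 + \<xi> > 0" using \<xi> \<delta> by linarith
    then have "?f (Suc n) > 0" "ln (?f (Suc n)) = ln (?f n) + ln (1 + \<xi>)"
      using Suc.IH unfolding f' by (simp_all add: ln_mult)
    then show ?thesis unfolding 2 3 using Suc.IH ln by linarith
  qed
qed

end

section \<open>Binary expansions and frequencies of visits\<close>

lemma partial_sum_prefix_value:
  "(\<Sum>i<n. of_bool (s i) / 2 ^ Suc i) = (of_int (prefix_value s n) / 2 ^ n :: real)"
  by (induction n) (auto simp: field_simps)

text \<open>The dyadic intervals are nested, so the limit lies in each of them. They are closed,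
  which also covers expansions ending in ones and thus \<open>x = 1\<close>.\<close>

lemma prefix_value_bounds:
  assumes "(\<lambda>n. of_bool (s n) / 2 ^ Suc n :: real) sums x"
  shows "of_int (prefix_value s n) / 2 ^ n \<le> x" "x \<le> (of_int (prefix_value s n) + 1) / 2 ^ n"
proof -
  have lim: "(\<lambda>m. of_int (prefix_value s m) / 2 ^ m) \<longlonglongrightarrow> x"
    using assms by (simp only: sums_def partial_sum_prefix_value)
  have *: "of_int (prefix_value s n) / 2 ^ n \<le> (of_int (prefix_value s (n + k)) / 2 ^ (n + k) :: real) \<and>
    (of_int (prefix_value s (n + k)) + 1) / 2 ^ (n + k) \<le> (of_int (prefix_value s n) + 1) / (2 ^ n :: real)" for k
  proof (induction k)
    case (Suc k)
    define p where "p = real_of_int (prefix_value s (n + k))"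
    have "real_of_int (prefix_value s (n + Suc k)) = 2 * p + of_bool (s (n + k))" by (simp add: p_def)
    moreover have "p / 2 ^ (n + k) \<le> (2 * p + of_bool (s (n + k))) / (2 * 2 ^ (n + k))"
      "(2 * p + of_bool (s (n + k)) + 1) / (2 * 2 ^ (n + k)) \<le> (p + 1) / 2 ^ (n + k)"
      by (simp_all add: field_simps)
    ultimately show ?case using Suc unfolding p_def[symmetric] by simp
  qed simp
  then have "of_int (prefix_value s n) / 2 ^ n \<le> (of_int (prefix_value s m) / 2 ^ m :: real) \<and>
    of_int (prefix_value s m) / 2 ^ m \<le> (of_int (prefix_value s n) + 1) / (2 ^ n :: real)" if "m \<ge> n" for m
  proof -
    note nm = that
    obtain k where m: "m = n + k" using le_Suc_ex[OF nm] by blast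
    have "of_int (prefix_value s m) / 2 ^ m \<le> (of_int (prefix_value s m) + 1) / (2 ^ m :: real)"
      by (intro divide_right_mono) auto
    then show ?thesis using *[of k] unfolding m by linarith
  qed
  then show "of_int (prefix_value s n) / 2 ^ n \<le> x" "x \<le> (of_int (prefix_value s n) + 1) / 2 ^ n"
    by (blast intro: LIMSEQ_le_const[OF lim] LIMSEQ_le_const2[OF lim])+
qed

lemma prefix_value_floor:
  assumes "(\<lambda>n. of_bool (s n) / 2 ^ Suc n :: real) sums x" "infinite {n. \<not> s n}"
  shows "prefix_value s n = \<lfloor>2 ^ n * x\<rfloor>"
proof -
  have upper: "(of_int (prefix_value s (n + k)) + 1) / 2 ^ (n + k) \<le> (of_int (prefix_value s n) + 1) / (2 ^ n :: real)" for k
  proof (induction k)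
    case (Suc k)
    have "(of_int (prefix_value s (n + Suc k)) + 1) / 2 ^ (n + Suc k) \<le> (of_int (prefix_value s (n + k)) + 1) / (2 ^ (n + k) :: real)"
      by (simp add: field_simps)
    then show ?case using Suc by linarith
  qed simp
  \<comment> \<open>A zero digit strictly lowers the right end, so \<open>x\<close> is not the right
    end of its interval.\<close>
  obtain m where m: "m \<ge> n" "\<not> s m"
    using assms(2) by (metis finite_nat_set_iff_bounded_le mem_Collect_eq nat_le_linear)
  have "x \<le> (of_int (prefix_value s (Suc m)) + 1) / 2 ^ Suc m" using prefix_value_bounds(2)[OF assms(1)] .
  also have "\<dots> < (of_int (prefix_value s m) + 1) / 2 ^ m" using m(2) by (simp add: field_simps)
  also have "\<dots> \<le> (of_int (prefix_value s n) + 1) / 2 ^ n" using upper[of "m - n"] m(1) by simp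
  finally have "2 ^ n * x < of_int (prefix_value s n) + 1" by (simp add: field_simps)
  moreover have "of_int (prefix_value s n) \<le> 2 ^ n * x"
    using prefix_value_bounds(1)[OF assms(1), of n] by (simp add: field_simps)
  ultimately show ?thesis by (intro sym[OF floor_unique])
qed

lemma binary_expansion_exists:
  fixes x :: real
  assumes "0 \<le> x" "x < 1"
  shows "\<exists>s. (\<lambda>n. of_bool (s n) / 2 ^ Suc n) sums x \<and> infinite {n. \<not> s n}"
proof -
  define s where "s n = odd \<lfloor>2 ^ Suc n * x\<rfloor>" for n
  have pv: "prefix_value s n = \<lfloor>2 ^ n * x\<rfloor>" for n
  proof (induction n)
    case 0
    have "\<lfloor>x\<rfloor> = 0" using assms by (simp add: floor_eq_iff)
    then show ?case by simp
  next
    case (Suc n)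
    have "\<lfloor>2 ^ n * x\<rfloor> = \<lfloor>2 ^ Suc n * x\<rfloor> div 2"
    proof -
      have "2 ^ Suc n * x / of_int 2 = 2 ^ n * x" by simp
      then show ?thesis using floor_divide_real_eq_div[of 2 "2 ^ Suc n * x"] by (simp only: zero_le_numeral)
    qed
    moreover have "2 * (z div 2) + of_bool (odd z) = z" for z :: int
      by (cases "odd z") (simp_all add: odd_two_times_div_two_succ)
    ultimately show ?case using Suc by (simp only: prefix_value.simps s_def)
  qed
  have err: "\<bar>of_int (prefix_value s n) / 2 ^ n - x\<bar> \<le> 1 / 2 ^ n" for n
  proof -
    have "of_int (prefix_value s n) \<le> 2 ^ n * x" "2 ^ n * x < of_int (prefix_value s n) + 1"
      unfolding pv by linarith+
    then have "of_int (prefix_value s n) \<le> x * 2 ^ n" "x * 2 ^ n \<le> of_int (prefix_value s n) + 1"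
      unfolding mult.commute[of x] by linarith+
    then have "of_int (prefix_value s n) / 2 ^ n \<le> x" "x \<le> (of_int (prefix_value s n) + 1) / 2 ^ n"
      by (simp_all add: pos_divide_le_eq pos_le_divide_eq)
    then show ?thesis unfolding add_divide_distrib by linarith
  qed
  have "(\<lambda>n. of_int (prefix_value s n) / 2 ^ n - x) \<longlonglongrightarrow> 0"
  proof (rule Lim_null_comparison)
    show "\<forall>\<^sub>F n in sequentially. norm (of_int (prefix_value s n) / 2 ^ n - x) \<le> (1 / 2) ^ n"
      using err by (simp add: power_one_over)
    show "(\<lambda>n. (1 / 2) ^ n) \<longlonglongrightarrow> (0 :: real)" by (rule LIMSEQ_power_zero) simp
  qed
  then have "(\<lambda>n. of_int (prefix_value s n) / 2 ^ n) \<longlonglongrightarrow> x"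
    by (rule LIM_zero_cancel)
  then have "(\<lambda>n. of_bool (s n) / 2 ^ Suc n) sums x"
    by (simp only: sums_def partial_sum_prefix_value)
  moreover have "infinite {n. \<not> s n}"
  proof
    assume "finite {n. \<not> s n}"
    then obtain m where m: "\<And>n. n \<ge> m \<Longrightarrow> s n"
      by (metis finite_nat_set_iff_bounded mem_Collect_eq not_less)
    \<comment> \<open>With only ones from \<open>m\<close> on, the right end stays fixed while the
      intervals shrink, so \<open>x\<close> reaches that right end, contrary to the floor
      formula.\<close>
    have tail: "(of_int (prefix_value s (m + k)) + 1) / 2 ^ (m + k) = (of_int (prefix_value s m) + 1) / (2 ^ m :: real)" for k
    proof (induction k)
      case (Suc k)
      have "(of_int (prefix_value s (m + Suc k)) + 1) / 2 ^ (m + Suc k) = (of_int (prefix_value s (m + k)) + 1) / (2 ^ (m + k) :: real)"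
        using m[of "m + k"] by (simp add: field_simps)
      then show ?case using Suc by simp
    qed simp
    then have "(of_int (prefix_value s m) + 1) / 2 ^ m - 1 / 2 ^ (m + k) \<le> x" for k
      using prefix_value_bounds(1)[OF \<open>_ sums x\<close>, of "m + k"] tail[of k] unfolding add_divide_distrib by linarith
    then have "(of_int (prefix_value s m) + 1) / 2 ^ m - 1 / 2 ^ m * (1 / 2) ^ k \<le> x" for k
      by (simp add: power_add power_one_over)
    moreover have "(\<lambda>k. (of_int (prefix_value s m) + 1) / 2 ^ m - 1 / 2 ^ m * (1 / 2) ^ k) \<longlonglongrightarrow>
        (of_int (prefix_value s m) + 1) / 2 ^ m - 1 / 2 ^ m * (0 :: real)"
      by (intro tendsto_intros LIMSEQ_power_zero) simp
    ultimately have "(of_int (prefix_value s m) + 1) / 2 ^ m - 1 / 2 ^ m * 0 \<le> x"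
      by (intro LIMSEQ_le_const2) auto
    then have "of_int (prefix_value s m) + 1 \<le> 2 ^ m * x" by (simp add: field_simps)
    then show False unfolding pv by linarith
  qed
  ultimately show ?thesis by blast
qed

lemma binary_expansion_sums:
  assumes "x \<in> {0..1}"
  shows "(\<lambda>n. of_bool (binary_expansion x n) / 2 ^ Suc n) sums x"
proof (cases "x = 1")
  case True
  have "(\<lambda>n. 1 / 2 * (1 / 2) ^ n) sums (1 / 2 * (1 / (1 - 1 / 2)) :: real)"
    by (intro sums_mult geometric_sums) simp
  then show ?thesis using True by (simp add: binary_expansion_def power_one_over)
next
  case False
  then obtain s where s: "(\<lambda>n. of_bool (s n) / 2 ^ Suc n) sums x \<and> infinite {n. \<not> s n}"
    using binary_expansion_exists[of x] assms by auto
  have "s' = s" if s': "(\<lambda>n. of_bool (s' n) / 2 ^ Suc n) sums x \<and> infinite {n. \<not> s' n}" for s'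
  proof
    fix n
    have pv: "prefix_value s' k = prefix_value s k" for k
      using prefix_value_floor[of s' x k] prefix_value_floor[of s x k] s s' by simp
    have "of_bool (s' n) = (of_bool (s n) :: int)"
      using pv[of "Suc n"] unfolding prefix_value.simps pv by (rule add_left_imp_eq)
    then show "s' n = s n" by (simp only: of_bool_eq_iff)
  qed
  then have "(THE s. (\<lambda>n. of_bool (s n) / 2 ^ Suc n) sums x \<and> infinite {n. \<not> s n}) = s"
  proof (intro the_equality)
    show "(\<lambda>n. of_bool (s n) / 2 ^ Suc n) sums x \<and> infinite {n. \<not> s n}" by (rule s)
  qed
  then have "binary_expansion x = s" using False by (simp only: binary_expansion_def if_False)
  then show ?thesis using s by simp
qed

section \<open>Frequencies of visits to an interval\<close>

definition visits :: "(nat \<Rightarrow> real) \<Rightarrow> real \<Rightarrow> real \<Rightarrow> nat \<Rightarrow> nat" where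
  "visits u a b N = card {n. n < N \<and> frac (u n) \<in> {a..<b}}"

lemma visits_split:
  assumes "0 \<le> a" "a \<le> b" "b \<le> 1"
  shows "visits u 0 a N + visits u a b N + visits u b 1 N = N"
proof -
  let ?A = "\<lambda>a b. {n. n < N \<and> frac (u n) \<in> {a..<b}}"
  have "card (?A 0 a \<union> ?A a b \<union> ?A b 1) = card (?A 0 a \<union> ?A a b) + card (?A b 1)"
    by (rule card_Un_disjoint) (use assms in auto)
  also have "card (?A 0 a \<union> ?A a b) = card (?A 0 a) + card (?A a b)"
    by (rule card_Un_disjoint) auto
  finally have "card (?A 0 a \<union> ?A a b \<union> ?A b 1) = card (?A 0 a) + card (?A a b) + card (?A b 1)" .
  moreover have "?A 0 a \<union> ?A a b \<union> ?A b 1 = {..<N}" using assms by (auto simp: frac_lt_1)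
  ultimately show ?thesis by (simp add: visits_def)
qed

text \<open>Upper bounds suffice, since the complement of an interval consists of two intervals.\<close>

lemma uniformly_distributed_upperI:
  assumes "\<And>a b \<epsilon>. 0 \<le> a \<Longrightarrow> a < b \<Longrightarrow> b \<le> 1 \<Longrightarrow> \<epsilon> > 0 \<Longrightarrow>
    eventually (\<lambda>N. real (visits u a b N) \<le> (b - a + \<epsilon>) * real N) sequentially"
  shows "uniformly_distributed_mod_one u"
  unfolding uniformly_distributed_mod_one_def
proof (intro allI impI)
  fix a b :: real
  assume ab: "0 \<le> a \<and> a < b \<and> b \<le> 1"
  have up: "eventually (\<lambda>N. real (visits u a b N) \<le> (b - a + \<epsilon>) * real N) sequentially"
    if "0 \<le> a" "a \<le> b" "b \<le> 1" "\<epsilon> > 0" for a b \<epsilon>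
  proof (cases "a = b")
    case True
    then show ?thesis using that by (simp add: visits_def)
  qed (use assms that in simp)
  have "(\<lambda>N. real (visits u a b N) / real N) \<longlonglongrightarrow> b - a"
  proof (rule tendstoI)
    fix \<epsilon> :: real assume "\<epsilon> > 0"
    then have \<epsilon>: "\<epsilon> / 4 > 0" by simp
    have ev: "eventually (\<lambda>N. real (visits u a b N) \<le> (b - a + \<epsilon> / 4) * real N) sequentially"
      "eventually (\<lambda>N. real (visits u 0 a N) \<le> (a - 0 + \<epsilon> / 4) * real N) sequentially"
      "eventually (\<lambda>N. real (visits u b 1 N) \<le> (1 - b + \<epsilon> / 4) * real N) sequentially"
      by (intro up \<epsilon>; use ab in simp)+
    show "eventually (\<lambda>N. dist (real (visits u a b N) / real N) (b - a) < \<epsilon>) sequentially"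
      using ev eventually_gt_at_top[of 0]
    proof eventually_elim
      case (elim N)
      have "real (visits u 0 a N) + real (visits u a b N) + real (visits u b 1 N) = real N"
        using visits_split[of a b u N] ab by (simp flip: of_nat_add)
      then have "(b - a - \<epsilon> / 2) * real N \<le> real (visits u a b N)" using elim by (simp add: algebra_simps)
      then have "b - a - \<epsilon> / 2 \<le> real (visits u a b N) / real N"
        "real (visits u a b N) / real N \<le> b - a + \<epsilon> / 4"
        using elim by (simp_all add: pos_le_divide_eq pos_divide_le_eq)
      then show ?case using \<open>\<epsilon> > 0\<close> by (simp add: dist_real_def abs_less_iff)
    qed
  qed
  then show "(\<lambda>N. real (card {n. n < N \<and> frac (u n) \<in> {a..<b}}) / real N) \<longlonglongrightarrow> b - a"
    by (simp add: visits_def)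
qed

text \<open>Pigeonhole: if every class eventually stays below the smaller frequency, summing over
  the \<open>r\<close> classes bounds the whole sequence. Half of \<epsilon> absorbs the terms
  before \<open>m0\<close> and the incomplete last block. The start \<open>m0\<close> is free since
  the estimates for the traces hold only from some index on.\<close>

lemma residue_class_with_many_visits:
  fixes u :: "nat \<Rightarrow> real"
  assumes freq: "frequently (\<lambda>N. real (visits u a b N) > (\<mu> + \<epsilon>) * real N) sequentially"
    and \<epsilon>: "\<epsilon> > 0" and \<mu>: "\<mu> \<ge> 0" and r: "r > 0"
  obtains m where "m \<ge> m0" "frequently (\<lambda>N. real (visits (\<lambda>k. u (r * k + m)) a b N) > (\<mu> + \<epsilon> / 2) * real N) sequentially"
proof (rule ccontr)
  note found = that
  assume "\<not> thesis"
  then have none: False if "m \<ge> m0"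
      "frequently (\<lambda>N. real (visits (\<lambda>k. u (r * k + m)) a b N) > (\<mu> + \<epsilon> / 2) * real N) sequentially" for m
    using found[OF that] \<open>\<not> thesis\<close> by blast
  have "\<forall>m\<in>{m0..<m0 + r}. eventually (\<lambda>N. real (visits (\<lambda>k. u (r * k + m)) a b N) \<le> (\<mu> + \<epsilon> / 2) * real N) sequentially"
  proof (intro ballI, rule ccontr)
    fix m assume "m \<in> {m0..<m0 + r}"
      "\<not> eventually (\<lambda>N. real (visits (\<lambda>k. u (r * k + m)) a b N) \<le> (\<mu> + \<epsilon> / 2) * real N) sequentially"
    then show False using none[of m] by (simp add: frequently_def not_less)
  qed
  then have "eventually (\<lambda>N. \<forall>m\<in>{m0..<m0 + r}. real (visits (\<lambda>k. u (r * k + m)) a b N) \<le> (\<mu> + \<epsilon> / 2) * real N) sequentially"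
    by (subst eventually_ball_finite_distrib) auto
  then obtain N0 where N0: "\<And>N m. N \<ge> N0 \<Longrightarrow> m \<in> {m0..<m0 + r} \<Longrightarrow>
      real (visits (\<lambda>k. u (r * k + m)) a b N) \<le> (\<mu> + \<epsilon> / 2) * real N"
    unfolding eventually_sequentially by blast
  let ?C = "real m0 + (\<mu> + \<epsilon> / 2) * real r"
  have bound: "real (visits u a b n) \<le> ?C + (\<mu> + \<epsilon> / 2) * real n" if n: "n \<ge> r * N0" for n
  proof -
    let ?N = "Suc (n div r)"
    let ?A = "\<lambda>m. {k. k < ?N \<and> frac (u (r * k + m)) \<in> {a..<b}}"
    have "{k. k < n \<and> frac (u k) \<in> {a..<b}} \<subseteq> {..<m0} \<union> (\<Union>m\<in>{m0..<m0 + r}. (\<lambda>k. r * k + m) ` ?A m)"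
    proof
      fix k assume k: "k \<in> {k. k < n \<and> frac (u k) \<in> {a..<b}}"
      show "k \<in> {..<m0} \<union> (\<Union>m\<in>{m0..<m0 + r}. (\<lambda>k. r * k + m) ` ?A m)"
      proof (cases "k < m0")
        case False
        define q m where "q = (k - m0) div r" and "m = m0 + (k - m0) mod r"
        have eq: "k = r * q + m" using False by (simp add: q_def m_def)
        have "q \<le> n div r" unfolding q_def using k by (intro div_le_mono) (simp, linarith)
        then have "q \<in> ?A m" using k eq by simp
        moreover have "m \<in> {m0..<m0 + r}" using r by (simp add: m_def)
        ultimately show ?thesis using eq by blast
      qed simp
    qed
    then have "visits u a b n \<le> card ({..<m0} \<union> (\<Union>m\<in>{m0..<m0 + r}. (\<lambda>k. r * k + m) ` ?A m))"
      unfolding visits_def by (intro card_mono) auto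
    also have "\<dots> \<le> m0 + card (\<Union>m\<in>{m0..<m0 + r}. (\<lambda>k. r * k + m) ` ?A m)"
      using card_Un_le[of "{..<m0}"] by simp
    also have "card (\<Union>m\<in>{m0..<m0 + r}. (\<lambda>k. r * k + m) ` ?A m) \<le> (\<Sum>m\<in>{m0..<m0 + r}. card ((\<lambda>k. r * k + m) ` ?A m))"
      by (rule card_UN_le) simp
    also have "\<dots> \<le> (\<Sum>m\<in>{m0..<m0 + r}. visits (\<lambda>k. u (r * k + m)) a b ?N)"
      unfolding visits_def by (intro sum_mono card_image_le) auto
    finally have "visits u a b n \<le> m0 + (\<Sum>m\<in>{m0..<m0 + r}. visits (\<lambda>k. u (r * k + m)) a b ?N)"
      by simp
    then have "real (visits u a b n) \<le> real (m0 + (\<Sum>m\<in>{m0..<m0 + r}. visits (\<lambda>k. u (r * k + m)) a b ?N))"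
      by (simp only: of_nat_le_iff)
    then have 1: "real (visits u a b n) \<le> real m0 + (\<Sum>m\<in>{m0..<m0 + r}. real (visits (\<lambda>k. u (r * k + m)) a b ?N))"
      by simp
    have "N0 \<le> n div r" using n r by (simp add: less_eq_div_iff_mult_less_eq mult.commute)
    then have "?N \<ge> N0" by simp
    then have "(\<Sum>m\<in>{m0..<m0 + r}. real (visits (\<lambda>k. u (r * k + m)) a b ?N)) \<le> (\<Sum>m\<in>{m0..<m0 + r}. (\<mu> + \<epsilon> / 2) * real ?N)"
      by (intro sum_mono N0)
    also have "\<dots> = (\<mu> + \<epsilon> / 2) * real (r * ?N)"
      unfolding of_nat_mult by simp
    also have "\<dots> \<le> (\<mu> + \<epsilon> / 2) * real (r + n)"
    proof (rule mult_left_mono)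
      show "real (r * ?N) \<le> real (r + n)"
        by (simp only: of_nat_le_iff mult_Suc_right add_le_cancel_left times_div_less_eq_dividend)
    qed (use \<mu> \<epsilon> in simp)
    finally show ?thesis using 1 by (simp add: distrib_left)
  qed
  have "eventually (\<lambda>n. real (visits u a b n) \<le> (\<mu> + \<epsilon>) * real n) sequentially"
    using eventually_ge_at_top[of "r * N0"] eventually_ge_at_top[of "nat \<lceil>?C / (\<epsilon> / 2)\<rceil>"]
  proof eventually_elim
    case (elim n)
    have "?C / (\<epsilon> / 2) \<le> real n" using elim(2) by linarith
    then have "?C \<le> \<epsilon> / 2 * real n" using \<epsilon> by (simp add: pos_divide_le_eq mult.commute)
    then show ?case using bound[OF elim(1)] by (simp add: algebra_simps)
  qed
  then show False using freq by (simp add: frequently_def not_less)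
qed

lemma limsup_infinityI:
  assumes "\<And>B n0. \<exists>n\<ge>n0. f n \<ge> (B :: real)"
  shows "limsup (\<lambda>n. ereal (f n)) = \<infinity>"
proof (rule ereal_top)
  fix B
  show "ereal B \<le> limsup (\<lambda>n. ereal (f n))"
    unfolding limsup_INF_SUP
  proof (rule INF_greatest)
    fix n0
    obtain n where "n \<ge> n0" "f n \<ge> B" using assms by blast
    then show "ereal B \<le> (SUP m\<in>{n0..}. ereal (f m))" by (intro SUP_upper2[of n]) auto
  qed
qed

section \<open>Non-uniform distribution makes the strategy succeed\<close>

lemma phase_le: "phase T K \<theta> n \<le> n"
  by (induction n) auto

text \<open>Without a change of phase the scale is at least \<theta> and is halved; with one it is
  at most \<open>2 * \<theta>\<close> and is multiplied by a number between
  \<open>\<rho>' / 2\<close> and \<open>\<rho> / 2\<close>. Since it never falls below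
  \<open>\<theta> / 2\<close>, a new phase starts with scale at least
  \<open>\<rho>' * \<theta> / 4\<close>.\<close>

lemma phase_scale:
  fixes T :: "nat \<Rightarrow> int" and \<theta> \<rho> \<rho>' Q :: real and K :: nat
  defines "ph \<equiv> phase T K \<theta>"
  assumes T: "\<And>k. T k > 0" and up: "\<And>k. of_int (T (Suc k)) \<le> \<rho> * of_int (T k)"
    and lo: "\<And>k. \<rho>' * of_int (T k) \<le> of_int (T (Suc k))"
    and \<theta>: "0 < \<theta>" "\<theta> \<le> 1" "1 / 2 ^ K \<le> \<theta>" and Q: "1 \<le> Q" "Q \<le> \<rho>' * \<theta> / 4"
  shows "\<theta> / 2 \<le> of_int (T (ph n)) / 2 ^ n"
    and "of_int (T (ph n)) / 2 ^ n \<le> of_int (T 0) + \<rho> * \<theta>"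
    and "of_int ((2 ^ K * T (ph n)) div 2 ^ n) < \<theta> * 2 ^ K \<Longrightarrow> Q \<le> of_int (T (ph (Suc n))) / 2 ^ Suc n"
proof -
  define sc where "sc n = real_of_int (T (ph n)) / 2 ^ n" for n
  define fl where "fl n \<longleftrightarrow> real_of_int ((2 ^ K * T (ph n)) div 2 ^ n) < \<theta> * 2 ^ K" for n
  have ph_Suc: "ph (Suc n) = (if fl n then Suc (ph n) else ph n)" for n
    by (simp add: ph_def fl_def)
  have T_real: "real_of_int (T k) \<ge> 1" for k using T[of k] by simp
  have "0 < \<rho> * real_of_int (T 0)" using up[of 0] T_real[of 1] by simp
  then have \<rho>: "\<rho> > 0" using T_real[of 0] by (simp add: zero_less_mult_iff)
  have "0 < \<rho>' * \<theta>" using Q by linarith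
  then have \<rho>': "\<rho>' > 0" using \<theta> by (simp add: zero_less_mult_iff)
  have sc_pos: "sc n > 0" for n using T by (simp add: sc_def)
  have keep: "sc (Suc n) = sc n / 2" "\<theta> \<le> sc n" if "\<not> fl n" for n
    using that quotient_threshold(1)[of K "T (ph n)" n \<theta>] by (simp_all add: sc_def ph_Suc fl_def)
  have move: "sc (Suc n) \<le> \<rho> * sc n / 2" "\<rho>' * sc n / 2 \<le> sc (Suc n)" "sc n \<le> 2 * \<theta>" if "fl n" for n
  proof -
    have eq: "sc (Suc n) = real_of_int (T (Suc (ph n))) / (2 * 2 ^ n)" using that by (simp add: sc_def ph_Suc)
    have eq': "\<rho> * sc n / 2 = \<rho> * real_of_int (T (ph n)) / (2 * 2 ^ n)"
      "\<rho>' * sc n / 2 = \<rho>' * real_of_int (T (ph n)) / (2 * 2 ^ n)"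
      by (simp_all add: sc_def)
    show "sc (Suc n) \<le> \<rho> * sc n / 2" "\<rho>' * sc n / 2 \<le> sc (Suc n)"
      unfolding eq eq' by (rule divide_right_mono[OF up] divide_right_mono[OF lo], simp)+
    have "sc n < \<theta> + 1 / 2 ^ K"
      using that quotient_threshold(2)[of K "T (ph n)" n \<theta>] by (simp add: sc_def fl_def)
    then show "sc n \<le> 2 * \<theta>" using \<theta>(3) by linarith
  qed
  have jump: "Q \<le> sc (Suc n)" if "fl n" "\<theta> / 2 \<le> sc n" for n
  proof -
    have "\<rho>' * (\<theta> / 2) \<le> \<rho>' * sc n" using that(2) \<rho>' by (intro mult_left_mono) auto
    then show ?thesis using move(2)[OF that(1)] Q(2) by linarith
  qed
  have lower: "\<theta> / 2 \<le> sc n" for n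
  proof (induction n)
    case 0
    have "sc 0 \<ge> 1" using T_real by (simp add: sc_def ph_def)
    then show ?case using \<theta> by linarith
  next
    case (Suc n)
    show ?case
    proof (cases "fl n")
      case True
      then show ?thesis using jump[OF True Suc] Q(1) \<theta> by linarith
    qed (use keep in fastforce)
  qed
  show "\<theta> / 2 \<le> of_int (T (ph n)) / 2 ^ n" using lower[of n] by (simp add: sc_def)
  show "Q \<le> of_int (T (ph (Suc n))) / 2 ^ Suc n" if "of_int ((2 ^ K * T (ph n)) div 2 ^ n) < \<theta> * 2 ^ K"
    using jump[OF _ lower, of n] that by (simp add: sc_def fl_def)
  have "sc n \<le> of_int (T 0) + \<rho> * \<theta>"
  proof (induction n)
    case 0
    have "0 < \<rho> * \<theta>" using \<rho> \<theta> by simp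
    then show ?case by (simp add: sc_def ph_def)
  next
    case (Suc n)
    show ?case
    proof (cases "fl n")
      case True
      have "\<rho> * sc n \<le> \<rho> * (2 * \<theta>)" using move(3)[OF True] \<rho> by (intro mult_left_mono) auto
      then show ?thesis using move(1)[OF True] T_real[of 0] by linarith
    next
      case False
      then show ?thesis using keep(1)[OF False] Suc sc_pos[of n] by linarith
    qed
  qed
  then show "of_int (T (ph n)) / 2 ^ n \<le> of_int (T 0) + \<rho> * \<theta>" by (simp add: sc_def)
qed

text \<open>The scale stays above a constant, so \<open>2 ^ n\<close> is at most a constant times
  the multiplier, which grows by a factor of at most \<open>2 ^ W\<close> per phase. Up to a
  constant, a phase thus lasts at most \<open>W\<close> digits on average.\<close>

lemma phase_growth:
  fixes T :: "nat \<Rightarrow> int" and \<theta> :: real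
  assumes T: "\<And>k. T k > 0" and up: "\<And>k. of_int (T (Suc k)) \<le> 2 ^ W * real_of_int (T k)"
    and lower: "\<And>n. \<theta> / 2 \<le> of_int (T (phase T K \<theta> n)) / 2 ^ n" and \<theta>: "\<theta> > 0"
    and N0: "2 * of_int (T 0) / \<theta> \<le> 2 ^ N0"
  shows "n \<le> N0 + W * phase T K \<theta> n"
proof -
  have "real_of_int (T k) \<le> 2 ^ (W * k) * of_int (T 0)" for k
  proof (induction k)
    case (Suc k)
    have "real_of_int (T (Suc k)) \<le> 2 ^ W * of_int (T k)" by (rule up)
    also have "\<dots> \<le> 2 ^ W * (2 ^ (W * k) * of_int (T 0))" using Suc by (intro mult_left_mono) auto
    finally show ?case by (simp add: power_add)
  qed simp
  moreover have "\<theta> / 2 * 2 ^ n \<le> of_int (T (phase T K \<theta> n))"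
    using lower[of n] by (simp only: pos_le_divide_eq zero_less_power zero_less_numeral)
  ultimately have "\<theta> / 2 * 2 ^ n \<le> 2 ^ (W * phase T K \<theta> n) * of_int (T 0)"
    by (meson order_trans)
  then have "2 ^ n \<le> 2 ^ (W * phase T K \<theta> n) * (2 * of_int (T 0) / \<theta>)"
    using \<theta> by (simp add: field_simps)
  also have "\<dots> \<le> 2 ^ (W * phase T K \<theta> n) * 2 ^ N0" using N0 by (intro mult_left_mono) auto
  also have "\<dots> = 2 ^ (N0 + W * phase T K \<theta> n)" by (simp add: power_add)
  finally show ?thesis by simp
qed

text \<open>The phase is unbounded and moves by at most one per digit.\<close>

lemma phase_surj:
  assumes "\<And>n. n \<le> N0 + W * phase T K \<theta> n"
  obtains n where "phase T K \<theta> n = N"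
proof -
  have ex: "\<exists>n. N \<le> phase T K \<theta> n"
  proof (rule ccontr)
    assume "\<not> ?thesis"
    then have "W * phase T K \<theta> n \<le> W * N" for n by (intro mult_left_mono) (simp_all add: not_le less_imp_le)
    then show False using assms[of "Suc (N0 + W * N)"] by (metis add_le_cancel_left not_less_eq_eq order_trans)
  qed
  define n where "n = (LEAST n. N \<le> phase T K \<theta> n)"
  have ge: "N \<le> phase T K \<theta> n" unfolding n_def by (rule LeastI_ex[OF ex])
  have "phase T K \<theta> n \<le> N"
  proof (cases n)
    case (Suc m)
    then have "m < n" by simp
    then have "\<not> N \<le> phase T K \<theta> m" unfolding n_def by (rule not_less_Least)
    then show ?thesis unfolding Suc by simp
  qed simp
  then show thesis using ge that by simp
qed

lemma ex_power2_ge: "\<exists>n. (x :: real) \<le> 2 ^ n"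
  using real_arch_pow[of 2 x] less_imp_le by auto

text \<open>The real constants enter the machine only through the finite tables of
  \<open>flag\<close> and \<open>stake\<close>, so arbitrary real end points are admissible.\<close>

lemma frequent_visits_martingale:
  fixes x \<beta> a0 b0 \<epsilon> :: real
  assumes x: "x \<in> {0..1}" and pisot: "pisot \<beta>" and ab: "0 \<le> a0" "a0 < b0" "b0 \<le> 1" and \<epsilon>: "0 < \<epsilon>"
    and freq: "frequently (\<lambda>N. real (visits (\<lambda>n. x * \<beta> ^ n) a0 b0 N) > (b0 - a0 + \<epsilon>) * real N) sequentially"
  shows "\<exists>f. martingale f \<and> polynomial_time_computable f \<and> succeeds_on f (binary_expansion x)"
proof -
  have \<beta>: "\<beta> > 1" using pisot by (simp add: pisot_def)
  obtain t d c where d: "d > 0" and rec: "\<And>m. t (m + d) = (\<Sum>l<d. c l * t (m + l))"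
    and lim: "(\<lambda>m. of_int (t m) - \<beta> ^ m) \<longlonglongrightarrow> 0"
    by (rule pisot_traces[OF pisot]) (rule that)
  \<comment> \<open>A frequency cannot exceed 1, so the surplus leaves room for enlarging the arc
    while \<open>\<alpha> \<le> 1\<close>.\<close>
  have \<epsilon>1: "b0 - a0 + \<epsilon> < 1"
  proof -
    obtain N where N: "real (visits (\<lambda>n. x * \<beta> ^ n) a0 b0 N) > (b0 - a0 + \<epsilon>) * real N" "N \<ge> 1"
      using freq unfolding frequently_def eventually_sequentially by blast
    have "visits (\<lambda>n. x * \<beta> ^ n) a0 b0 N \<le> card {..<N}" unfolding visits_def by (intro card_mono) auto
    then have "real (visits (\<lambda>n. x * \<beta> ^ n) a0 b0 N) \<le> 1 * real N" by simp
    then have "(b0 - a0 + \<epsilon>) * real N < 1 * real N" using N(1) by linarith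
    then show ?thesis using N(2) by (simp add: mult_less_cancel_right)
  qed
  then have "\<epsilon> < 1" using ab by linarith
  \<comment> \<open>The arc is widened by \<open>2 * \<eta>\<close> on either side: \<eta> for
    replacing the power of \<beta> by the trace, and \<eta> for the length of the image interval at
    the end of a phase, which is below \<open>2 * \<theta>\<close>. The widening and
    \<open>1 / Q\<close> cost \<open>\<epsilon> / 8\<close> each; of the surplus
    \<open>\<epsilon> / 2\<close> in the residue class, \<open>\<epsilon> / 4\<close> per phase
    remains.\<close>
  define \<eta> where "\<eta> = \<epsilon> / 32"
  define \<theta> where "\<theta> = \<eta> / 2"
  define Q where "Q = 8 / \<epsilon>"
  define a where "a = a0 - 2 * \<eta>"
  define \<alpha> where "\<alpha> = b0 - a0 + 4 * \<eta>"
  have \<eta>: "0 < \<eta>" "\<eta> \<le> 1 / 32" using \<epsilon> \<open>\<epsilon> < 1\<close> by (simp_all add: \<eta>_def)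
  have \<theta>: "0 < \<theta>" "\<theta> \<le> 1" using \<eta> by (simp_all add: \<theta>_def)
  have Q: "1 \<le> Q" "1 / Q = \<epsilon> / 8" using \<epsilon> \<open>\<epsilon> < 1\<close> by (simp_all add: Q_def)
  have \<alpha>: "0 \<le> \<alpha>" "\<alpha> \<le> 1" "\<alpha> = b0 - a0 + \<epsilon> / 8" using ab \<epsilon>1 \<epsilon> unfolding \<alpha>_def \<eta>_def by linarith+

  have "eventually (\<lambda>m. \<bar>of_int (t m) - \<beta> ^ m\<bar> < \<eta>) sequentially"
    using tendstoD[OF lim \<eta>(1)] by (simp add: dist_real_def)
  moreover have "eventually (\<lambda>m. 2 * Q \<le> \<beta> ^ m) sequentially"
  proof -
    obtain n where "2 * Q < \<beta> ^ n" using real_arch_pow[OF \<beta>] by blast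
    moreover have "\<beta> ^ n \<le> \<beta> ^ m" if "m \<ge> n" for m using that \<beta> by (intro power_increasing) auto
    ultimately have "\<forall>m\<ge>n. 2 * Q \<le> \<beta> ^ m" by (meson less_imp_le order_trans)
    then show ?thesis unfolding eventually_sequentially by blast
  qed
  ultimately have "eventually (\<lambda>m. \<bar>of_int (t m) - \<beta> ^ m\<bar> < \<eta> \<and> 2 * Q \<le> \<beta> ^ m) sequentially"
    by (rule eventually_conj)
  then obtain m1 where m1: "\<And>m. m \<ge> m1 \<Longrightarrow> \<bar>of_int (t m) - \<beta> ^ m\<bar> < \<eta> \<and> 2 * Q \<le> \<beta> ^ m"
    unfolding eventually_sequentially by blast
  have t_bounds: "\<beta> ^ m / 2 \<le> of_int (t m)" "of_int (t m) \<le> 2 * \<beta> ^ m" "Q \<le> of_int (t m)" if "m \<ge> m1" for m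
    using m1[OF that] \<eta> Q by linarith+

  \<comment> \<open>Consecutive multipliers have ratio at least \<open>\<beta> ^ r / 4\<close>, the
    scale may have sunk to \<open>\<theta> / 2\<close>, and the new bit halves it once more: this
    makes up the factor 16.\<close>
  obtain r0 where r0: "16 * Q / \<theta> < \<beta> ^ r0" using real_arch_pow[OF \<beta>] by blast
  define r where "r = Suc r0"
  have "\<beta> ^ r0 \<le> \<beta> ^ r" using \<beta> by (intro power_increasing) (simp_all add: r_def)
  then have r: "r > 0" "16 * Q / \<theta> \<le> \<beta> ^ r" using r0 by (simp add: r_def, linarith)
  obtain W where W: "4 * \<beta> ^ r \<le> 2 ^ W" using ex_power2_ge by blast
  \<comment> \<open>The loss per digit is \<open>\<delta> * (\<epsilon>' + 2 * \<delta>)\<close>.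
    Over \<open>W\<close> digits each summand costs at most
    \<open>\<delta> * (\<epsilon> / 16)\<close>, together half of the gain
    \<open>\<delta> * (\<epsilon> / 4)\<close> per phase.\<close>
  define \<epsilon>' where "\<epsilon>' = \<epsilon> / (16 * real (Suc W))"
  define \<delta> where "\<delta> = \<epsilon> / (32 * real (Suc W))"
  have \<epsilon>': "0 < \<epsilon>'" "\<epsilon>' \<le> 1 / 2" "\<epsilon>' * real W \<le> \<epsilon> / 16"
    using \<epsilon> \<open>\<epsilon> < 1\<close> by (simp_all add: \<epsilon>'_def pos_divide_le_eq distrib_left)
  have \<delta>: "0 < \<delta>" "\<delta> \<le> 1 / 2" "2 * \<delta> * real W \<le> \<epsilon> / 16"
    using \<epsilon> \<open>\<epsilon> < 1\<close> by (simp_all add: \<delta>_def pos_divide_le_eq distrib_left)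
  \<comment> \<open>The first entry makes the threshold test accurate up to \<theta>. The second
    limits the error from truncated positions to half of \<open>\<delta> * \<epsilon>'\<close>; the
    other half is left for rounding the stakes to \<open>D\<close> places.\<close>
  obtain K where K: "max (1 / \<theta>) (14 / (\<theta> * \<epsilon>')) \<le> 2 ^ K" using ex_power2_ge by blast
  have K1: "1 / 2 ^ K \<le> \<theta>"
  proof -
    have "1 / \<theta> \<le> 2 ^ K" using K by simp
    then have "1 \<le> 2 ^ K * \<theta>" using \<theta>(1) by (simp only: pos_divide_le_eq)
    then show ?thesis by (simp add: pos_divide_le_eq mult.commute)
  qed
  have K2: "7 * \<delta> / (\<theta> * 2 ^ K) \<le> \<delta> * \<epsilon>' / 2"
  proof -
    have "14 \<le> 2 ^ K * (\<theta> * \<epsilon>')" using K \<theta> \<epsilon>' by (simp add: pos_divide_le_eq)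
    then have "\<delta> * 14 \<le> \<delta> * (2 ^ K * (\<theta> * \<epsilon>'))" using \<delta> by (intro mult_left_mono) auto
    then have "7 * \<delta> \<le> \<delta> * \<epsilon>' / 2 * (\<theta> * 2 ^ K)" by (simp add: mult_ac)
    then show ?thesis using \<theta> by (simp add: pos_divide_le_eq)
  qed
  obtain D0 where D0: "2 / (\<delta> * \<epsilon>') \<le> 2 ^ D0" using ex_power2_ge by blast
  define D where "D = Suc D0"
  have D: "D > 0" "1 / 2 ^ D \<le> \<delta> * \<epsilon>' / 2"
  proof -
    have "0 < \<delta> * \<epsilon>'" using \<delta> \<epsilon>' by simp
    then have "2 \<le> 2 ^ D0 * (\<delta> * \<epsilon>')" using D0 by (simp only: pos_divide_le_eq)
    also have "\<dots> \<le> 2 ^ D * (\<delta> * \<epsilon>')"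
      using \<open>0 < \<delta> * \<epsilon>'\<close> by (intro mult_right_mono) (simp_all add: D_def)
    finally have "2 \<le> \<delta> * \<epsilon>' * 2 ^ D" by (simp only: mult.commute)
    then show "1 / 2 ^ D \<le> \<delta> * \<epsilon>' / 2" by (simp add: pos_divide_le_eq)
  qed (simp add: D_def)
  have err: "1 / 2 ^ D + 7 * \<delta> / (\<theta> * 2 ^ K) \<le> \<delta> * \<epsilon>'" using D K2 by linarith

  obtain m where m: "m \<ge> m1"
    and freq_m: "frequently (\<lambda>N. real (visits (\<lambda>k. x * \<beta> ^ (r * k + m)) a0 b0 N) > (b0 - a0 + \<epsilon> / 2) * real N) sequentially"
    using residue_class_with_many_visits[OF freq \<epsilon> _ r(1), of m1] ab by auto
  define T where "T k = t (r * k + m)" for k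
  define ph where "ph = phase T K \<theta>"
  define sc where "sc n = real_of_int (T (ph n)) / 2 ^ n" for n
  have e: "r * k + m \<ge> m1" for k using m by simp
  have T_pos: "T k > 0" for k
  proof -
    have "0 < real_of_int (T k)" unfolding T_def using t_bounds(3)[OF e, of k] Q(1) by linarith
    then show ?thesis by (simp only: of_int_0_less_iff)
  qed
  have T_up: "of_int (T (Suc k)) \<le> 4 * \<beta> ^ r * of_int (T k)" for k
  proof -
    have "of_int (T (Suc k)) \<le> 2 * \<beta> ^ (r * Suc k + m)" unfolding T_def by (rule t_bounds(2)[OF e])
    also have "\<dots> = 4 * \<beta> ^ r * (\<beta> ^ (r * k + m) / 2)" by (simp add: power_add)
    also have "\<dots> \<le> 4 * \<beta> ^ r * of_int (T k)"
      unfolding T_def using \<beta> by (intro mult_left_mono t_bounds(1)[OF e]) auto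
    finally show ?thesis .
  qed
  have T_lo: "\<beta> ^ r / 4 * of_int (T k) \<le> of_int (T (Suc k))" for k
  proof -
    have "\<beta> ^ r / 4 * of_int (T k) \<le> \<beta> ^ r / 4 * (2 * \<beta> ^ (r * k + m))"
      unfolding T_def using \<beta> by (intro mult_left_mono t_bounds(2)[OF e]) auto
    also have "\<dots> = \<beta> ^ (r * Suc k + m) / 2" by (simp add: power_add)
    also have "\<dots> \<le> of_int (T (Suc k))" unfolding T_def by (rule t_bounds(1)[OF e])
    finally show ?thesis .
  qed
  have Q_le: "Q \<le> \<beta> ^ r / 4 * \<theta> / 4"
    using r(2) \<theta> by (simp add: pos_divide_le_eq)
  note scale = phase_scale[of T "4 * \<beta> ^ r" "\<beta> ^ r / 4" \<theta> K Q, OF T_pos T_up T_lo \<theta> K1 Q(1) Q_le, folded ph_def]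
  \<comment> \<open>A register may run ahead of the multiplier by up to \<open>d\<close> places,
    whence \<open>\<beta> ^ d\<close>; the bracket is the bound for the scale in
    \<open>phase_scale\<close>.\<close>
  define B where "B = 4 * \<beta> ^ d * (of_int (T 0) + 4 * \<beta> ^ r * \<theta>)"
  define bnd where "bnd = \<lceil>2 ^ K * B\<rceil> + 2 ^ K"
  have t_ph: "\<bar>2 ^ K * t (r * ph n + m + i)\<bar> \<le> bnd * 2 ^ n" if "i < d" for n i
  proof -
    have pos: "0 < t (r * ph n + m + i)"
    proof -
      have "Q \<le> of_int (t (r * ph n + m + i))" using e[of "ph n"] by (intro t_bounds(3)) simp
      then have "0 < real_of_int (t (r * ph n + m + i))" using Q(1) by linarith
      then show ?thesis by (simp only: of_int_0_less_iff)
    qed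
    have "real_of_int (t (r * ph n + m + i)) \<le> 2 * \<beta> ^ (r * ph n + m + i)"
      using e[of "ph n"] by (intro t_bounds(2)) simp
    also have "\<dots> = 4 * \<beta> ^ i * (\<beta> ^ (r * ph n + m) / 2)" by (simp add: power_add)
    also have "\<dots> \<le> 4 * \<beta> ^ d * of_int (T (ph n))"
      unfolding T_def using \<beta> that by (intro mult_mono t_bounds(1)[OF e] mult_left_mono power_increasing) auto
    also have "of_int (T (ph n)) \<le> (of_int (T 0) + 4 * \<beta> ^ r * \<theta>) * 2 ^ n"
      using scale(2)[of n] by (simp add: pos_divide_le_eq)
    then have "4 * \<beta> ^ d * of_int (T (ph n)) \<le> B * 2 ^ n"
      unfolding B_def mult.assoc using \<beta> by (intro mult_left_mono) (auto simp: mult.assoc)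
    finally have "2 ^ K * real_of_int (t (r * ph n + m + i)) \<le> 2 ^ K * (B * 2 ^ n)"
      by (intro mult_left_mono) auto
    also have "\<dots> = (2 ^ K * B) * 2 ^ n" by simp
    also have "\<dots> \<le> of_int bnd * 2 ^ n"
      unfolding bnd_def by (intro mult_right_mono) (simp_all add: add_increasing2)
    finally have "real_of_int (2 ^ K * t (r * ph n + m + i)) \<le> real_of_int (bnd * 2 ^ n)" by simp
    then have "2 ^ K * t (r * ph n + m + i) \<le> bnd * 2 ^ n" by (simp only: of_int_le_iff)
    then show ?thesis using pos by (simp add: abs_mult)
  qed
  have "0 \<le> B" using \<beta> \<theta> T_pos[of 0] by (simp add: B_def)
  then have "0 \<le> 2 ^ K * B" by simp
  then have "0 \<le> \<lceil>2 ^ K * B\<rceil>" by linarith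
  then have bnd_ge: "2 ^ K \<le> bnd" by (simp add: bnd_def)
  interpret B: bettor t d c r m K D \<theta> a \<alpha> \<delta> bnd
    by unfold_locales (use d rec \<theta> \<alpha> \<delta> D bnd_ge t_ph in \<open>simp_all add: ph_def T_def[abs_def]\<close>)
  have B_ph: "B.ph = ph" by (simp add: B.ph_def ph_def T_def[abs_def])
  have B_scale: "B.scale n = sc n" for n by (simp add: B.scale_def sc_def B_ph T_def)
  have B_flagged: "B.flagged n \<longleftrightarrow> of_int ((2 ^ K * T (ph n)) div 2 ^ n) < \<theta> * 2 ^ K" for n
    by (simp add: B.flagged_def B_ph T_def)

  define s where "s = binary_expansion x"
  define G where "G k \<longleftrightarrow> frac (x * \<beta> ^ (r * k + m)) \<in> {a0..<b0}" for k
  have good: "\<exists>j :: int. a + of_int j \<le> B.pos s n \<and> B.pos s n + B.scale n \<le> a + of_int j + \<alpha>"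
    if "B.flagged n" "G (B.ph n)" for n
  proof -
    let ?y = "x * \<beta> ^ (r * ph n + m)" and ?T = "real_of_int (T (ph n))"
    have "sc n < \<theta> + \<theta>" using B.flagged_scale(2)[OF that(1)] K1 unfolding B_scale by linarith
    then have small: "sc n < \<eta>" by (simp add: \<theta>_def)
    have "x * \<bar>?T - \<beta> ^ (r * ph n + m)\<bar> \<le> 1 * \<eta>"
      using x m1[OF e] unfolding T_def by (intro mult_mono) (auto intro: less_imp_le)
    then have y: "\<bar>x * ?T - ?y\<bar> \<le> \<eta>"
      using x by (simp add: abs_mult flip: right_diff_distrib)
    have pv: "of_int (prefix_value s n) / 2 ^ n \<le> x" "x \<le> (of_int (prefix_value s n) + 1) / 2 ^ n"
      using prefix_value_bounds[OF binary_expansion_sums[OF x]] unfolding s_def by auto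
    have pos: "B.pos s n = ?T * (of_int (prefix_value s n) / 2 ^ n)"
      by (simp add: B.pos_def B_ph T_def)
    have T0: "0 \<le> ?T" using T_pos[of "ph n"] by simp
    have "B.pos s n \<le> ?T * x" unfolding pos by (intro mult_left_mono pv T0)
    moreover have "?T * x \<le> ?T * ((of_int (prefix_value s n) + 1) / 2 ^ n)"
      by (intro mult_left_mono pv T0)
    then have "?T * x \<le> B.pos s n + sc n"
      unfolding pos sc_def by (simp add: add_divide_distrib distrib_left)
    moreover have "?T * x = x * ?T" by (rule mult.commute)
    moreover have "a0 + of_int \<lfloor>?y\<rfloor> \<le> ?y" "?y < b0 + of_int \<lfloor>?y\<rfloor>"
      using that(2) unfolding G_def B_ph frac_def by simp_all
    ultimately show ?thesis
      using y small unfolding B_scale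
      by (intro exI[of _ "\<lfloor>?y\<rfloor>"] conjI; unfold a_def \<alpha>_def; linarith)
  qed
  have growth: "B.reg.capital (map s [0..<n]) > 0 \<and>
    ln (B.reg.capital (map s [0..<n])) \<ge>
      \<delta> * (hit_density \<alpha> (B.pos s n - a) (sc n) + card {k. k < ph n \<and> G k} - (\<alpha> + 1 / Q) * (ph n + 1))
      - (\<delta> * \<epsilon>' + 2 * \<delta>\<^sup>2) * n" for n
  proof -
    have "Q \<le> B.scale 0" using t_bounds(3)[OF m] by (simp add: B.scale_def)
    moreover have "Q \<le> B.scale (Suc n)" if "B.flagged n" for n
      using scale(3) that unfolding B_scale B_flagged sc_def by blast
    moreover have "0 < Q" using Q by simp
    ultimately show ?thesis
      using B.capital_growth[OF err \<epsilon>'(2), of Q G s n] T_pos good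
      unfolding B_scale B_ph T_def by blast
  qed

  obtain N0 where N0: "2 * of_int (T 0) / \<theta> \<le> 2 ^ N0" using ex_power2_ge by blast
  have time: "n \<le> N0 + W * ph n" for n
    unfolding ph_def
  proof (rule phase_growth[where T = T and W = W and \<theta> = \<theta> and K = K, OF T_pos _ _ \<theta>(1) N0])
    fix k
    have "4 * \<beta> ^ r * real_of_int (T k) \<le> 2 ^ W * of_int (T k)"
      using W T_pos[of k] by (intro mult_right_mono) auto
    then show "of_int (T (Suc k)) \<le> 2 ^ W * real_of_int (T k)" using T_up[of k] by linarith
  qed (use scale(1) in \<open>simp add: ph_def\<close>)
  define \<kappa> where "\<kappa> = \<delta> * \<epsilon>' + 2 * \<delta>\<^sup>2"
  have \<kappa>: "0 \<le> \<kappa>" "\<kappa> * real W \<le> \<delta> * (\<epsilon> / 8)"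
  proof -
    show "0 \<le> \<kappa>" using \<delta> \<epsilon>' by (simp add: \<kappa>_def)
    have "\<kappa> * real W = \<delta> * (\<epsilon>' * real W + 2 * \<delta> * real W)"
      by (simp add: \<kappa>_def power2_eq_square algebra_simps)
    also have "\<dots> \<le> \<delta> * (\<epsilon> / 8)" using \<delta> \<epsilon>' by (intro mult_left_mono) auto
    finally show "\<kappa> * real W \<le> \<delta> * (\<epsilon> / 8)" .
  qed
  have ln_ge: "ln (B.reg.capital (map s [0..<n])) \<ge> \<delta> * (\<epsilon> / 8) * real N - (2 * \<delta> + \<kappa> * real N0)"
    if "ph n = N" "real (visits (\<lambda>k. x * \<beta> ^ (r * k + m)) a0 b0 N) > (b0 - a0 + \<epsilon> / 2) * real N" for n N
  proof -
    have sc_pos: "sc n > 0" using T_pos[of "ph n"] by (simp add: sc_def)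
    have "card {k. k < ph n \<and> G k} = visits (\<lambda>k. x * \<beta> ^ (r * k + m)) a0 b0 N"
      unfolding visits_def that(1) G_def ..
    moreover have "0 \<le> hit_density \<alpha> (B.pos s n - a) (sc n)" by (rule hit_density_bounds(1)[OF \<alpha>(1,2) sc_pos])
    moreover have "(\<alpha> + 1 / Q) * (real N + 1) = (b0 - a0 + \<epsilon> / 2) * real N - \<epsilon> / 4 * real N + (b0 - a0 + \<epsilon> / 4)"
      unfolding \<alpha>(3) Q(2) by (simp add: algebra_simps)
    ultimately have "\<epsilon> / 4 * real N - 2 \<le>
        hit_density \<alpha> (B.pos s n - a) (sc n) + card {k. k < ph n \<and> G k} - (\<alpha> + 1 / Q) * (real (ph n) + 1)"
      using that \<epsilon>1 \<open>\<epsilon> < 1\<close> \<epsilon> by simp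
    then have "\<delta> * (\<epsilon> / 4 * real N - 2) \<le>
        \<delta> * (hit_density \<alpha> (B.pos s n - a) (sc n) + card {k. k < ph n \<and> G k} - (\<alpha> + 1 / Q) * (real (ph n) + 1))"
      using \<delta> by (intro mult_left_mono) auto
    \<comment> \<open>The \<open>N\<close> phases use at most \<open>N0 + W * N\<close> digits, so
      the accumulated losses eat up only half of the gain, apart from a constant.\<close>
    moreover have "\<kappa> * real n \<le> \<kappa> * real N0 + \<delta> * (\<epsilon> / 8) * real N"
    proof -
      have "real n \<le> real (N0 + W * N)" using time[of n] unfolding that(1) by (simp only: of_nat_le_iff)
      then have "\<kappa> * real n \<le> \<kappa> * real (N0 + W * N)" using \<kappa>(1) by (rule mult_left_mono)
      also have "\<dots> = \<kappa> * real N0 + \<kappa> * real W * real N" by (simp add: algebra_simps)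
      also have "\<kappa> * real W * real N \<le> \<delta> * (\<epsilon> / 8) * real N" using \<kappa>(2) by (intro mult_right_mono) auto
      finally show ?thesis by simp
    qed
    moreover have "\<delta> * (\<epsilon> / 4 * real N - 2) = 2 * (\<delta> * (\<epsilon> / 8) * real N) - 2 * \<delta>"
      by (simp add: algebra_simps)
    moreover have "\<delta> * (hit_density \<alpha> (B.pos s n - a) (sc n) + card {k. k < ph n \<and> G k} - (\<alpha> + 1 / Q) * (real (ph n) + 1))
        - \<kappa> * real n \<le> ln (B.reg.capital (map s [0..<n]))"
      using growth[of n] unfolding \<kappa>_def by (simp add: add.commute)
    ultimately show ?thesis by linarith
  qed
  have "\<exists>n\<ge>n0. B.reg.capital (map s [0..<n]) \<ge> Bound" for n0 Bound
  proof -
    define M where "M = max Bound 1"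
    define C where "C = (ln M + (2 * \<delta> + \<kappa> * real N0)) / (\<delta> * (\<epsilon> / 8))"
    obtain N where N: "N \<ge> max n0 (nat \<lceil>C\<rceil>)"
      "real (visits (\<lambda>k. x * \<beta> ^ (r * k + m)) a0 b0 N) > (b0 - a0 + \<epsilon> / 2) * real N"
      using freq_m unfolding frequently_def eventually_sequentially by blast
    obtain n where n: "ph n = N" using phase_surj[OF time[unfolded ph_def]] unfolding ph_def by blast
    \<comment> \<open>At most one phase ends per digit, so a late phase means a long prefix.\<close>
    have "n \<ge> n0" using phase_le[of T K \<theta> n] n N(1) unfolding ph_def by simp
    have "0 < \<delta> * (\<epsilon> / 8)" using \<delta> \<epsilon> by simp
    moreover have "C \<le> real N" using N(1) by linarith
    ultimately have "ln M + (2 * \<delta> + \<kappa> * real N0) \<le> \<delta> * (\<epsilon> / 8) * real N"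
      unfolding C_def by (simp only: pos_divide_le_eq mult.commute)
    then have "ln M \<le> ln (B.reg.capital (map s [0..<n]))" using ln_ge[OF n N(2)] by linarith
    then have "M \<le> B.reg.capital (map s [0..<n])"
      using growth[of n] by (subst (asm) ln_le_cancel_iff) (auto simp: M_def)
    then show ?thesis using \<open>n \<ge> n0\<close> unfolding M_def by (intro exI[of _ n]) simp
  qed
  then have "succeeds_on B.reg.capital (binary_expansion x)"
    unfolding succeeds_on_def s_def by (rule limsup_infinityI)
  then show ?thesis
    using B.martingale_capital B.reg.polynomial_time_computable_capital by blast
qed

theorem theorem1p2:
  fixes x :: real
  assumes "x \<in> {0..1}" and "polynomial_time_random x"
  shows "\<forall>\<beta>. pisot \<beta> \<longrightarrow> uniformly_distributed_mod_one (\<lambda>n. x * \<beta> ^ n)"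
proof (intro allI impI uniformly_distributed_upperI)
  fix \<beta> a b \<epsilon> :: real
  assume "pisot \<beta>" "0 \<le> a" "a < b" "b \<le> 1" "0 < \<epsilon>"
  then have "\<not> frequently (\<lambda>N. real (visits (\<lambda>n. x * \<beta> ^ n) a b N) > (b - a + \<epsilon>) * real N) sequentially"
    using frequent_visits_martingale[OF assms(1)] assms(2) unfolding polynomial_time_random_def by blast
  then show "eventually (\<lambda>N. real (visits (\<lambda>n. x * \<beta> ^ n) a b N) \<le> (b - a + \<epsilon>) * real N) sequentially"
    by (simp add: frequently_def not_less)
qed

end
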